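(* Let $n\in\mathbb{N}$, $1\le p<\infty$, and let $r$ be defined by $\frac{1}{r}=1+\left|\frac{1}{p}-\frac{1}{2}\right|$. Let $m:\mathbb{N}_0^n\to\mathbb{C}$ and suppose that the Hermite multiplier $T_m:L^p(\mathbb{R}^n)\to L^p(\mathbb{R}^n)$ is $r$-nuclear. Then $$\mathrm{Tr}(T_m)=\sum_{\nu\in\mathbb{N}_0^n}m(\nu)=\sum_{i}\lambda_i(T_m),$$ where $\mathrm{Tr}(T_m)$ is the nuclear trace of $T_m$ and $(\lambda_i(T_m))_i$ is the sequence of eigenvalues of $T_m$ with multiplicities taken into account.
   Context: $\mathbb{N}_0=\{0,1,2,\dots\}$. For $\nu\in\mathbb{N}_0^n$ the Hermite function $\phi_\nu$ on $\mathbb{R}^n$ is $\phi_\nu(x)=\prod_{j=1}^n\phi_{\nu_j}(x_j)$, with $\phi_{\nu_j}(x_j)=(2^{\nu_j}\nu_j!\sqrt{\pi})^{-1/2}H_{\nu_j}(x_j)e^{-x_j^2/2}$ and $H_{\nu_j}$ the Hermite polynomial of order $\nu_j$. For a function $m$ on $\mathbb{N}_0^n$, the Hermite multiplier with symbol $m$ is the operator $T_mf(x)=\sum_{\nu\in\mathbb{N}_0^n}m(\nu)\widehat f(\phi_\nu)\phi_\nu(x)$, with $\widehat f(\phi_\nu)=\int_{\mathbb{R}^n}f(x)\phi_\nu(x)\,dx$; in particular $T_m\phi_\nu=m(\nu)\phi_\nu$ for every $\nu$. For Banach spaces $E,F$ and $0<r\le1$, a linear operator $T:E\to F$ is $r$-nuclear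 if there exist sequences $(e_i')$ in the dual $E'$ and $(y_i)$ in $F$ with $Tf=\sum_i e_i'(f)y_i$ for all $f\in E$ and $\sum_i\Vert e_i'\Vert_{E'}^r\Vert y_i\Vert_F^r<\infty$. When $E=F$ has the approximation property (as $L^p$-spaces do), the nuclear trace of such a $T$ is $\mathrm{Tr}(T)=\sum_i e_i'(y_i)$, which does not depend on the chosen representation. *)

theory Defs
  imports "HOL-Analysis.Analysis"
begin

section \<open>Hermite functions and Hermite coefficients\<close>

text \<open>Physicists' normalisation, i.e. orthogonal with respect to the weight \<open>exp (- x\<^sup>2)\<close>
  and with leading coefficient \<open>2 ^ k\<close>.\<close>

fun hermite_polynomial :: "nat \<Rightarrow> real \<Rightarrow> real" where
  "hermite_polynomial 0 x = 1"
| "hermite_polynomial (Suc 0) x = 2 * x"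
| "hermite_polynomial (Suc (Suc k)) x =
     2 * x * hermite_polynomial (Suc k) x - 2 * real (Suc k) * hermite_polynomial k x"

definition hermite_function_1d :: "nat \<Rightarrow> real \<Rightarrow> real" where
  "hermite_function_1d k x =
     (2 ^ k * fact k * sqrt pi) powr (- (1 / 2)) * hermite_polynomial k x * exp (- (x\<^sup>2 / 2))"

definition hermite_function :: "nat ^ 'n \<Rightarrow> real ^ 'n \<Rightarrow> real" where
  "hermite_function \<nu> x = (\<Prod>j\<in>UNIV. hermite_function_1d (\<nu> $ j) (x $ j))"

definition hermite_coeff :: "(real ^ 'n \<Rightarrow> complex) \<Rightarrow> nat ^ 'n \<Rightarrow> complex" where
  "hermite_coeff f \<nu> = (LINT x|lborel. f x * of_real (hermite_function \<nu> x))"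


section \<open>The complex space \<open>L\<^sup>p\<close> on \<open>n\<close>-space\<close>

text \<open>Elements of \<open>L\<^sup>p\<close> are represented by functions, two of which are identified if they agree
  almost everywhere.  All notions below are invariant under this identification.\<close>

definition Lp :: "real \<Rightarrow> (real ^ 'n \<Rightarrow> complex) set" where
  "Lp p = {f \<in> borel_measurable lborel. integrable lborel (\<lambda>x. norm (f x) powr p)}"

definition Lp_norm :: "real \<Rightarrow> (real ^ 'n \<Rightarrow> complex) \<Rightarrow> real" where
  "Lp_norm p f = (LINT x|lborel. norm (f x) powr p) powr (1 / p)"

definition Lp_dual :: "real \<Rightarrow> ((real ^ 'n \<Rightarrow> complex) \<Rightarrow> complex) set" where
  "Lp_dual p = {e.
     (\<forall>f\<in>Lp p. \<forall>g\<in>Lp p. e (\<lambda>x. f x + g x) = e f + e g) \<and>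
     (\<forall>c. \<forall>f\<in>Lp p. e (\<lambda>x. c * f x) = c * e f) \<and>
     (\<exists>C. \<forall>f\<in>Lp p. norm (e f) \<le> C * Lp_norm p f)}"

definition Lp_dual_norm :: "real \<Rightarrow> ((real ^ 'n \<Rightarrow> complex) \<Rightarrow> complex) \<Rightarrow> real" where
  "Lp_dual_norm p e = (SUP f\<in>{f \<in> Lp p. Lp_norm p f \<le> 1}. norm (e f))"

definition Lp_linear ::
    "real \<Rightarrow> ((real ^ 'n \<Rightarrow> complex) \<Rightarrow> real ^ 'n \<Rightarrow> complex) \<Rightarrow> bool" where
  "Lp_linear p T \<longleftrightarrow>
     (\<forall>f\<in>Lp p. T f \<in> Lp p) \<and>
     (\<forall>f\<in>Lp p. \<forall>g\<in>Lp p. (AE x in lborel. f x = g x) \<longrightarrow> (AE x in lborel. T f x = T g x)) \<and>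
     (\<forall>f\<in>Lp p. \<forall>g\<in>Lp p. AE x in lborel. T (\<lambda>x. f x + g x) x = T f x + T g x) \<and>
     (\<forall>c. \<forall>f\<in>Lp p. AE x in lborel. T (\<lambda>x. c * f x) x = c * T f x)"

definition Lp_bounded ::
    "real \<Rightarrow> ((real ^ 'n \<Rightarrow> complex) \<Rightarrow> real ^ 'n \<Rightarrow> complex) \<Rightarrow> bool" where
  "Lp_bounded p T \<longleftrightarrow> (\<exists>C. \<forall>f\<in>Lp p. Lp_norm p (T f) \<le> C * Lp_norm p f)"


section \<open>Hermite multipliers\<close>

definition hermite_multiplier ::
    "(nat ^ 'n \<Rightarrow> complex) \<Rightarrow> (real ^ 'n \<Rightarrow> complex) \<Rightarrow> real ^ 'n \<Rightarrow> complex" where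
  "hermite_multiplier m f x =
     (\<Sum>\<^sub>\<infinity>\<nu>. m \<nu> * hermite_coeff f \<nu> * of_real (hermite_function \<nu> x))"

definition hermite_span :: "(real ^ 'n \<Rightarrow> complex) set" where
  "hermite_span = {f. \<exists>A c. finite A \<and> f = (\<lambda>x. \<Sum>\<nu>\<in>A. c \<nu> * of_real (hermite_function \<nu> x))}"

text \<open>\<open>T\<close> is the operator \<open>T\<^sub>m\<close> on \<open>L\<^sup>p\<close>.  The series defining \<open>T\<^sub>m f\<close> has only finitely many
  nonzero terms if \<open>f\<close> lies in the span of the Hermite functions.  It need not converge in norm
  for a general \<open>f\<close> in \<open>L\<^sup>p\<close>, so \<open>T\<^sub>m\<close> on all of \<open>L\<^sup>p\<close> is the bounded linear extension from the
  span, which is dense for finite \<open>p\<close>; hence \<open>m\<close> and \<open>p\<close> determine \<open>T\<close> up to equality a.e.\<close>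

definition is_hermite_multiplier ::
    "real \<Rightarrow> (nat ^ 'n \<Rightarrow> complex) \<Rightarrow> ((real ^ 'n \<Rightarrow> complex) \<Rightarrow> real ^ 'n \<Rightarrow> complex) \<Rightarrow> bool" where
  "is_hermite_multiplier p m T \<longleftrightarrow>
     Lp_linear p T \<and> Lp_bounded p T \<and>
     (\<forall>f\<in>hermite_span. AE x in lborel. T f x = hermite_multiplier m f x)"


section \<open>Nuclear operators and the nuclear trace\<close>

definition nuclear_representation ::
    "real \<Rightarrow> real \<Rightarrow> ((real ^ 'n \<Rightarrow> complex) \<Rightarrow> real ^ 'n \<Rightarrow> complex) \<Rightarrow>
      (nat \<Rightarrow> (real ^ 'n \<Rightarrow> complex) \<Rightarrow> complex) \<Rightarrow> (nat \<Rightarrow> real ^ 'n \<Rightarrow> complex) \<Rightarrow> bool" where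
  "nuclear_representation p r T e y \<longleftrightarrow>
     (\<forall>i. e i \<in> Lp_dual p) \<and> (\<forall>i. y i \<in> Lp p) \<and>
     (\<forall>f\<in>Lp p. (\<lambda>N. Lp_norm p (\<lambda>x. T f x - (\<Sum>i<N. e i f * y i x))) \<longlonglongrightarrow> 0) \<and>
     summable (\<lambda>i. Lp_dual_norm p (e i) powr r * Lp_norm p (y i) powr r)"

definition r_nuclear ::
    "real \<Rightarrow> real \<Rightarrow> ((real ^ 'n \<Rightarrow> complex) \<Rightarrow> real ^ 'n \<Rightarrow> complex) \<Rightarrow> bool" where
  "r_nuclear p r T \<longleftrightarrow> Lp_linear p T \<and> (\<exists>e y. nuclear_representation p r T e y)"

text \<open>The common value of the traces of all representations.\<close>

definition nuclear_trace ::
    "real \<Rightarrow> real \<Rightarrow> ((real ^ 'n \<Rightarrow> complex) \<Rightarrow> real ^ 'n \<Rightarrow> complex) \<Rightarrow> complex" where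
  "nuclear_trace p r T =
     (THE t. \<forall>e y. nuclear_representation p r T e y \<longrightarrow> (\<lambda>i. e i (y i)) sums t)"


section \<open>Eigenvalues and their multiplicities\<close>

definition gen_eigenspace ::
    "real \<Rightarrow> ((real ^ 'n \<Rightarrow> complex) \<Rightarrow> real ^ 'n \<Rightarrow> complex) \<Rightarrow> complex \<Rightarrow>
      (real ^ 'n \<Rightarrow> complex) set" where
  "gen_eigenspace p T \<mu> =
     {f \<in> Lp p. \<exists>k. AE x in lborel. ((\<lambda>g x. T g x - \<mu> * g x) ^^ k) f x = 0}"

text \<open>The space \<open>V\<close>, modulo equality a.e., has finite dimension \<open>d\<close>.\<close>

definition has_dim_ae :: "(real ^ 'n \<Rightarrow> complex) set \<Rightarrow> nat \<Rightarrow> bool" where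
  "has_dim_ae V d \<longleftrightarrow> (\<exists>b.
     (\<forall>i<d. b i \<in> V) \<and>
     (\<forall>c. (AE x in lborel. (\<Sum>i<d. c i * b i x) = 0) \<longrightarrow> (\<forall>i<d. c i = 0)) \<and>
     (\<forall>f\<in>V. \<exists>c. AE x in lborel. f x = (\<Sum>i<d. c i * b i x)))"

text \<open>Every nonzero eigenvalue occurs as often as its algebraic multiplicity, and a nonzero number
  that is not an eigenvalue (trivial generalized eigenspace) does not occur.  Terms equal to \<open>0\<close>
  are unrestricted, in particular they fill up the sequence if there are only finitely many nonzero
  eigenvalues.\<close>

definition eigenvalue_sequence ::
    "real \<Rightarrow> ((real ^ 'n \<Rightarrow> complex) \<Rightarrow> real ^ 'n \<Rightarrow> complex) \<Rightarrow> (nat \<Rightarrow> complex) \<Rightarrow> bool" where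
  "eigenvalue_sequence p T l \<longleftrightarrow>
     (\<forall>\<mu>. \<mu> \<noteq> 0 \<longrightarrow>
        finite {i. l i = \<mu>} \<and> has_dim_ae (gen_eigenspace p T \<mu>) (card {i. l i = \<mu>}))"

end

theory Submission
  imports Defs "HOL-Probability.Distributions"
begin

text \<open>Rescale a nuclear representation to \<open>T f = (\<Sum>i. E\<^sub>i(f) Y\<^sub>i)\<close> with \<open>\<parallel>E\<^sub>i\<parallel> \<le> A\<^sub>i\<close>, \<open>\<parallel>Y\<^sub>i\<parallel> = B\<^sub>i\<close>,
  where \<open>(A\<^sub>i)\<close> is summable with exponent \<open>\<alpha>\<close>, the conjugate of \<open>max p 2\<close>, and \<open>(B\<^sub>i)\<close> with
  exponent \<open>\<beta> = min p 2\<close>; the value of \<open>r\<close> says precisely that \<open>r / \<alpha> + r / \<beta> = 1\<close>.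
  The map \<open>f \<mapsto> (E\<^sub>i(f))\<^sub>i\<close> into square-summable sequences intertwines \<open>T\<close> with the matrix
  \<open>(E\<^sub>i(Y\<^sub>j))\<close> and sends the Hermite functions to eigenvectors.  Gram-Schmidt on finitely many of
  them, indexed by \<open>F\<close>, shows that \<open>\<Sum>\<nu>\<in>F. m \<nu>\<close> is the trace of the matrix compressed by an
  orthogonal projection.  As \<open>F\<close> grows these projections converge to the identity on the columns,
  since Hermite functions are dense in \<open>L\<^sup>p\<close>.  The tail of the trace is small uniformly in \<open>F\<close>:
  a contraction of square-summable sequences does not increase the square function
  \<open>(\<Sum>j. \<bar>Y\<^sub>j(x)\<bar>\<^sup>2)\<close> pointwise, and Jensen's inequality for \<open>t \<mapsto> t powr (p / 2)\<close> turns this into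
  a bound in terms of \<open>A\<close> and \<open>B\<close>.  So no dual space has to be identified.
  Hermite coefficients are injective on \<open>L\<^sup>p\<close>, hence the nonzero eigenvalues are the nonzero
  values of \<open>m\<close> with the right multiplicities.\<close>

section \<open>Orthonormal families of square-summable sequences\<close>

text \<open>The partial sums of a Hermite expansion need not be uniformly bounded on L^p, so the
  trace cannot be read off by truncating that expansion in L^p itself. Orthogonal projections of
  sequences are contractions whatever their range, which is the reason for moving to a matrix; its
  entries are bounded by \<open>A i * B j\<close>, with both factors square-summable because
  \<alpha> and \<beta> are at most 2. The obstacle is the tail: estimating the projected diagonal
  entries one at a time gives only a multiple of \<open>B j\<close>, and the sum of these may
  diverge if \<beta> > 1. All columns of the tail are therefore treated together through the square
  function. The numbers \<open>min p 2\<close> and \<open>max p 2\<close> are the type and cotype of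
  L^p, and they are what this passage costs; this explains the condition on \<open>r\<close>.
  Convergence along all finite sets \<open>F\<close> yields unconditional summability of
  \<open>m\<close>. It also gives the independence of the trace from the representation, since the
  sum of \<open>m\<close> mentions none, and the eigenvalue formula is the same sum regrouped by the
  level sets of \<open>m\<close>.\<close>

definition l2 :: "(nat \<Rightarrow> complex) set" where
  "l2 = {u. summable (\<lambda>i. (cmod (u i))\<^sup>2)}"

definition norm2 :: "(nat \<Rightarrow> complex) \<Rightarrow> real" where
  "norm2 u = (\<Sum>i. (cmod (u i))\<^sup>2)"

definition ip :: "(nat \<Rightarrow> complex) \<Rightarrow> (nat \<Rightarrow> complex) \<Rightarrow> complex" where
  "ip u v = (\<Sum>i. u i * cnj (v i))"

lemma l2_mult_summable:
  fixes f g :: "nat \<Rightarrow> real"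
  assumes "summable (\<lambda>i. (f i)\<^sup>2)" "summable (\<lambda>i. (g i)\<^sup>2)"
  shows "summable (\<lambda>i. \<bar>f i * g i\<bar>)"
proof (rule summable_comparison_test)
  show "\<exists>N. \<forall>n\<ge>N. norm \<bar>f n * g n\<bar> \<le> (f n)\<^sup>2 + (g n)\<^sup>2"
  proof (intro exI allI impI)
    fix n
    have "2 * (\<bar>f n\<bar> * \<bar>g n\<bar>) \<le> (f n)\<^sup>2 + (g n)\<^sup>2"
      using sum_squares_bound[of "\<bar>f n\<bar>" "\<bar>g n\<bar>"] by (simp add: mult.assoc)
    moreover have "0 \<le> \<bar>f n\<bar> * \<bar>g n\<bar>" by simp
    ultimately have "\<bar>f n\<bar> * \<bar>g n\<bar> \<le> (f n)\<^sup>2 + (g n)\<^sup>2" by linarith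
    then show "norm \<bar>f n * g n\<bar> \<le> (f n)\<^sup>2 + (g n)\<^sup>2" by (simp add: abs_mult)
  qed
  show "summable (\<lambda>n. (f n)\<^sup>2 + (g n)\<^sup>2)" using assms by (rule summable_add)
qed

lemma ip_norm_summable:
  assumes "u \<in> l2" "v \<in> l2"
  shows "summable (\<lambda>i. norm (u i * cnj (v i)))"
  using l2_mult_summable[of "\<lambda>i. cmod (u i)" "\<lambda>i. cmod (v i)"] assms
  by (simp add: l2_def norm_mult)

lemma ip_summable:
  assumes "u \<in> l2" "v \<in> l2"
  shows "summable (\<lambda>i. u i * cnj (v i))"
  using ip_norm_summable[OF assms] by (rule summable_norm_cancel)

lemma l2_scale: "u \<in> l2 \<Longrightarrow> (\<lambda>i. c * u i) \<in> l2"
  unfolding l2_def by (auto simp: norm_mult power_mult_distrib intro: summable_mult)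

lemma l2_zero: "(\<lambda>i. 0) \<in> l2"
  by (simp add: l2_def)

lemma l2_add:
  assumes "u \<in> l2" "v \<in> l2"
  shows "(\<lambda>i. u i + v i) \<in> l2"
  unfolding l2_def
proof (clarify, rule summable_comparison_test)
  show "\<exists>N. \<forall>n\<ge>N. norm ((cmod (u n + v n))\<^sup>2) \<le> 2 * (cmod (u n))\<^sup>2 + 2 * (cmod (v n))\<^sup>2"
  proof (intro exI allI impI)
    fix n
    have "(cmod (u n + v n))\<^sup>2 \<le> (cmod (u n) + cmod (v n))\<^sup>2"
      by (intro power_mono norm_triangle_ineq norm_ge_zero)
    also have "\<dots> \<le> 2 * (cmod (u n))\<^sup>2 + 2 * (cmod (v n))\<^sup>2"
      using sum_squares_bound[of "cmod (u n)" "cmod (v n)"] by (simp add: power2_sum)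
    finally show "norm ((cmod (u n + v n))\<^sup>2) \<le> 2 * (cmod (u n))\<^sup>2 + 2 * (cmod (v n))\<^sup>2" by simp
  qed
  show "summable (\<lambda>n. 2 * (cmod (u n))\<^sup>2 + 2 * (cmod (v n))\<^sup>2)"
    using assms unfolding l2_def by (auto intro!: summable_add summable_mult)
qed

lemma l2_diff: "u \<in> l2 \<Longrightarrow> v \<in> l2 \<Longrightarrow> (\<lambda>i. u i - v i) \<in> l2"
  using l2_add[of u "\<lambda>i. - 1 * v i"] l2_scale[of v "- 1"] by simp

lemma l2_sum:
  assumes "finite F" "\<And>k. k \<in> F \<Longrightarrow> u k \<in> l2"
  shows "(\<lambda>i. \<Sum>k\<in>F. c k * u k i) \<in> l2"
  using assms
proof (induction F rule: finite_induct)
  case (insert x F)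
  then have "(\<lambda>i. c x * u x i) \<in> l2" "(\<lambda>i. \<Sum>k\<in>F. c k * u k i) \<in> l2"
    by (auto intro: l2_scale)
  from l2_add[OF this] show ?case using insert by simp
qed (simp add: l2_zero)

lemma ip_scale_left: "u \<in> l2 \<Longrightarrow> v \<in> l2 \<Longrightarrow> ip (\<lambda>i. c * u i) v = c * ip u v"
  unfolding ip_def using ip_summable[of u v] by (simp add: mult.assoc suminf_mult)

lemma ip_add_left:
  "u \<in> l2 \<Longrightarrow> w \<in> l2 \<Longrightarrow> v \<in> l2 \<Longrightarrow> ip (\<lambda>i. u i + w i) v = ip u v + ip w v"
  unfolding ip_def using ip_summable[of u v] ip_summable[of w v]
  by (simp add: distrib_right suminf_add)

lemma ip_diff_left:
  "u \<in> l2 \<Longrightarrow> w \<in> l2 \<Longrightarrow> v \<in> l2 \<Longrightarrow> ip (\<lambda>i. u i - w i) v = ip u v - ip w v"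
  unfolding ip_def using ip_summable[of u v] ip_summable[of w v]
  by (simp add: left_diff_distrib suminf_diff)

lemma ip_zero_left: "ip (\<lambda>i. 0) v = 0"
  by (simp add: ip_def)

lemma ip_sum_left:
  assumes "finite F" "\<And>k. k \<in> F \<Longrightarrow> u k \<in> l2" "v \<in> l2"
  shows "ip (\<lambda>i. \<Sum>k\<in>F. c k * u k i) v = (\<Sum>k\<in>F. c k * ip (u k) v)"
  using assms
proof (induction F rule: finite_induct)
  case (insert x F)
  have "ip (\<lambda>i. c x * u x i + (\<Sum>k\<in>F. c k * u k i)) v
      = ip (\<lambda>i. c x * u x i) v + ip (\<lambda>i. \<Sum>k\<in>F. c k * u k i) v"
    using insert by (intro ip_add_left l2_scale l2_sum) auto
  then show ?case using insert by (simp add: ip_scale_left)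
qed (simp add: ip_zero_left)

lemma ip_commute: "u \<in> l2 \<Longrightarrow> v \<in> l2 \<Longrightarrow> ip v u = cnj (ip u v)"
proof -
  assume "u \<in> l2" "v \<in> l2"
  then have "(\<lambda>i. cnj (u i * cnj (v i))) sums cnj (ip u v)"
    unfolding ip_def sums_cnj by (intro summable_sums ip_summable)
  then show "ip v u = cnj (ip u v)"
    by (simp add: ip_def sums_iff mult.commute)
qed

lemma ip_self: "u \<in> l2 \<Longrightarrow> ip u u = complex_of_real (norm2 u)"
  unfolding ip_def norm2_def l2_def
  by (simp add: complex_norm_square[symmetric] suminf_of_real flip: of_real_power)

lemma norm2_nonneg: "u \<in> l2 \<Longrightarrow> 0 \<le> norm2 u"
  unfolding norm2_def l2_def by (intro suminf_nonneg) auto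

lemma sum_le_norm2: "u \<in> l2 \<Longrightarrow> finite I \<Longrightarrow> (\<Sum>i\<in>I. (cmod (u i))\<^sup>2) \<le> norm2 u"
  unfolding norm2_def l2_def by (intro sum_le_suminf) auto

lemma component_le_norm2: "u \<in> l2 \<Longrightarrow> (cmod (u i))\<^sup>2 \<le> norm2 u"
  using sum_le_norm2[of u "{i}"] by simp

lemma norm2_eq_0: "u \<in> l2 \<Longrightarrow> norm2 u = 0 \<Longrightarrow> u i = 0"
  using component_le_norm2[of u i] by simp

section \<open>Orthogonal projections onto finite orthonormal families\<close>

definition orthonormal :: "(nat \<Rightarrow> complex) set \<Rightarrow> bool" where
  "orthonormal G \<longleftrightarrow> finite G \<and> G \<subseteq> l2 \<and> (\<forall>g\<in>G. \<forall>h\<in>G. ip g h = (if g = h then 1 else 0))"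

definition proj :: "(nat \<Rightarrow> complex) set \<Rightarrow> (nat \<Rightarrow> complex) \<Rightarrow> nat \<Rightarrow> complex" where
  "proj G v = (\<lambda>i. \<Sum>g\<in>G. ip v g * g i)"

context
  fixes G assumes G: "orthonormal G"
begin

lemma orthonormal_l2: "g \<in> G \<Longrightarrow> g \<in> l2" and orthonormal_finite: "finite G"
  and orthonormal_ip: "g \<in> G \<Longrightarrow> h \<in> G \<Longrightarrow> ip g h = (if g = h then 1 else 0)"
  using G unfolding orthonormal_def by auto

lemma ip_comb:
  assumes "h \<in> G" shows "ip (\<lambda>i. \<Sum>g\<in>G. c g * g i) h = c h"
proof -
  have "ip (\<lambda>i. \<Sum>g\<in>G. c g * g i) h = (\<Sum>g\<in>G. c g * ip g h)"
    using orthonormal_finite orthonormal_l2 assms by (intro ip_sum_left) auto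
  also have "\<dots> = (\<Sum>g\<in>G. if g = h then c g else 0)"
    using assms by (intro sum.cong) (auto simp: orthonormal_ip)
  finally show ?thesis using assms orthonormal_finite by simp
qed

lemma proj_l2: "proj G v \<in> l2"
  unfolding proj_def using orthonormal_finite orthonormal_l2 by (intro l2_sum) auto

lemma comb_l2: "(\<lambda>i. \<Sum>g\<in>G. c g * g i) \<in> l2"
  using orthonormal_finite orthonormal_l2 by (intro l2_sum) auto

lemma norm2_comb: "norm2 (\<lambda>i. \<Sum>g\<in>G. c g * g i) = (\<Sum>g\<in>G. (cmod (c g))\<^sup>2)"
proof -
  let ?w = "\<lambda>i. \<Sum>g\<in>G. c g * g i"
  have "complex_of_real (norm2 ?w) = ip ?w ?w"
    by (simp add: ip_self[OF comb_l2])
  also have "\<dots> = (\<Sum>g\<in>G. c g * ip g ?w)"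
    using orthonormal_finite orthonormal_l2 comb_l2 by (intro ip_sum_left) auto
  also have "\<dots> = (\<Sum>g\<in>G. c g * cnj (c g))"
    using ip_commute[OF comb_l2 orthonormal_l2] ip_comb by (intro sum.cong) auto
  also have "\<dots> = complex_of_real (\<Sum>g\<in>G. (cmod (c g))\<^sup>2)"
    by (simp add: complex_norm_square[symmetric] flip: of_real_power)
  finally show ?thesis using of_real_eq_iff by blast
qed

lemma residual_orthogonal:
  assumes "v \<in> l2" "g \<in> G" shows "ip (\<lambda>i. v i - proj G v i) g = 0"
  using assms ip_comb[of g "ip v"] by (simp add: ip_diff_left proj_l2 orthonormal_l2 proj_def[symmetric])

text \<open>Pythagoras: the residual is orthogonal to the projection, so its inner product with
  itself equals its inner product with \<open>v\<close>.\<close>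

lemma norm2_residual:
  assumes v: "v \<in> l2"
  shows "norm2 (\<lambda>i. v i - proj G v i) = norm2 v - (\<Sum>g\<in>G. (cmod (ip v g))\<^sup>2)"
proof -
  let ?w = "\<lambda>i. v i - proj G v i"
  have w: "?w \<in> l2" using v proj_l2 by (rule l2_diff)
  have pw: "ip (proj G v) ?w = 0"
  proof -
    have "ip (proj G v) ?w = (\<Sum>g\<in>G. ip v g * ip g ?w)"
      unfolding proj_def[of G v] using orthonormal_finite orthonormal_l2 w[unfolded proj_def]
      by (intro ip_sum_left) auto
    also have "\<dots> = 0"
      using residual_orthogonal[OF v] ip_commute[OF w orthonormal_l2] by (intro sum.neutral) auto
    finally show ?thesis .
  qed
  have vp: "ip v (proj G v) = complex_of_real (\<Sum>g\<in>G. (cmod (ip v g))\<^sup>2)"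
  proof -
    have "ip (proj G v) v = (\<Sum>g\<in>G. ip v g * ip g v)"
      unfolding proj_def using orthonormal_finite orthonormal_l2 v by (intro ip_sum_left) auto
    also have "\<dots> = complex_of_real (\<Sum>g\<in>G. (cmod (ip v g))\<^sup>2)"
      using ip_commute[OF v orthonormal_l2]
      by (simp add: complex_norm_square[symmetric] flip: of_real_power)
    finally show ?thesis using ip_commute[OF proj_l2 v] by simp
  qed
  have "complex_of_real (norm2 ?w) = ip ?w ?w" using w by (simp add: ip_self)
  also have "\<dots> = ip v ?w" using pw by (simp add: ip_diff_left[OF v proj_l2 w])
  also have "\<dots> = cnj (ip ?w v)" using ip_commute[OF w v] .
  also have "\<dots> = cnj (ip v v - ip (proj G v) v)" using ip_diff_left[OF v proj_l2 v] by simp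
  also have "\<dots> = ip v v - ip v (proj G v)"
    using ip_commute[OF proj_l2 v] ip_commute[OF v v] by simp
  also have "\<dots> = complex_of_real (norm2 v - (\<Sum>g\<in>G. (cmod (ip v g))\<^sup>2))"
    using vp by (simp add: ip_self[OF v])
  finally show ?thesis using of_real_eq_iff by blast
qed

lemma bessel: "v \<in> l2 \<Longrightarrow> (\<Sum>g\<in>G. (cmod (ip v g))\<^sup>2) \<le> norm2 v"
  using norm2_residual[of v] norm2_nonneg[OF l2_diff[OF _ proj_l2], of v v] by linarith

text \<open>Best approximation: \<open>h\<close> is fixed by the projection, so \<open>v\<close> and
  \<open>v - h\<close> have the same residual, and by Pythagoras a residual is never longer than the
  vector it comes from.\<close>

lemma residual_le:
  assumes v: "v \<in> l2" and h: "h \<in> l2" "proj G h = h"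
  shows "norm2 (\<lambda>i. v i - proj G v i) \<le> norm2 (\<lambda>i. v i - h i)"
proof -
  let ?w = "\<lambda>i. v i - h i"
  have "proj G ?w i = proj G v i - proj G h i" for i
    unfolding proj_def using v h orthonormal_l2
    by (simp add: ip_diff_left left_diff_distrib sum_subtractf)
  then have "(\<lambda>i. ?w i - proj G ?w i) = (\<lambda>i. v i - proj G v i)"
    using h(2) by auto
  then show ?thesis
    using norm2_residual[of ?w] l2_diff[OF v h(1)]
    by (simp add: sum_nonneg)
qed

lemma proj_comb:
  assumes "finite F" "\<And>k. k \<in> F \<Longrightarrow> u k \<in> l2" "\<And>k. k \<in> F \<Longrightarrow> proj G (u k) = u k"
  shows "proj G (\<lambda>i. \<Sum>k\<in>F. c k * u k i) = (\<lambda>i. \<Sum>k\<in>F. c k * u k i)"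
proof
  fix i
  have "proj G (\<lambda>i. \<Sum>k\<in>F. c k * u k i) i = (\<Sum>g\<in>G. (\<Sum>k\<in>F. c k * ip (u k) g) * g i)"
    unfolding proj_def using assms orthonormal_l2 by (intro sum.cong) (auto simp: ip_sum_left)
  also have "\<dots> = (\<Sum>g\<in>G. \<Sum>k\<in>F. c k * (ip (u k) g * g i))"
    by (simp add: sum_distrib_right mult.assoc)
  also have "\<dots> = (\<Sum>k\<in>F. c k * proj G (u k) i)"
    unfolding proj_def by (subst sum.swap) (simp add: sum_distrib_left)
  finally show "proj G (\<lambda>i. \<Sum>k\<in>F. c k * u k i) i = (\<Sum>k\<in>F. c k * u k i)"
    using assms by simp
qed

end

section \<open>Diagonal models\<close>

lemma summable_mult_l2:
  fixes a :: "nat \<Rightarrow> real"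
  assumes "summable (\<lambda>i. (a i)\<^sup>2)" "\<And>i. 0 \<le> a i" "g \<in> l2"
  shows "summable (\<lambda>i. a i * cmod (g i))"
  using l2_mult_summable[of a "\<lambda>i. cmod (g i)"] assms by (simp add: l2_def)

text \<open>The matrix detached from L^p: \<open>s j\<close> is column \<open>j\<close>, and
  \<open>u \<nu>\<close> stands for the image of a Hermite function. These images may be dependent
  or zero because all the functionals may vanish on a combination of Hermite functions;
  \<open>independent\<close> therefore asks only that the coefficients of a relation vanish where
  \<open>m\<close> does not. In \<open>tail\<close> the index \<open>N0\<close> is chosen before the
  family \<open>G\<close>, which makes the estimate uniform in the projection.\<close>

locale diagonal_model =
  fixes s :: "nat \<Rightarrow> nat \<Rightarrow> complex" and A B :: "nat \<Rightarrow> real"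
    and u :: "'a \<Rightarrow> nat \<Rightarrow> complex" and m :: "'a \<Rightarrow> complex"
  assumes A_nonneg: "\<And>i. 0 \<le> A i" and B_nonneg: "\<And>j. 0 \<le> B j"
    and A_square: "summable (\<lambda>i. (A i)\<^sup>2)" and B_square: "summable (\<lambda>j. (B j)\<^sup>2)"
    and s_bound: "\<And>i j. cmod (s j i) \<le> A i * B j"
    and u_l2: "\<And>\<nu>. u \<nu> \<in> l2"
    and eigen: "\<And>\<nu> i. (\<lambda>j. u \<nu> j * s j i) sums (m \<nu> * u \<nu> i)"
    and independent: "\<And>F c \<nu>. finite F \<Longrightarrow> (\<And>i. (\<Sum>\<nu>\<in>F. c \<nu> * u \<nu> i) = 0) \<Longrightarrow> \<nu> \<in> F \<Longrightarrow> c \<nu> * m \<nu> = 0"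
    and dense: "\<And>j e. 0 < e \<Longrightarrow>
      \<exists>F c. finite F \<and> norm2 (\<lambda>i. s j i - (\<Sum>\<nu>\<in>F. c \<nu> * u \<nu> i)) < e"
    and tail: "\<And>e. 0 < e \<Longrightarrow> \<exists>N0. \<forall>N\<ge>N0. \<forall>M G. orthonormal G \<longrightarrow>
      cmod (\<Sum>j\<in>{N..<M}. proj G (s j) j) \<le> e"
begin

lemma s_l2: "s j \<in> l2"
  unfolding l2_def
proof (clarify, rule summable_comparison_test)
  show "\<exists>N. \<forall>n\<ge>N. norm ((cmod (s j n))\<^sup>2) \<le> (A n)\<^sup>2 * (B j)\<^sup>2"
  proof (intro exI allI impI)
    fix n show "norm ((cmod (s j n))\<^sup>2) \<le> (A n)\<^sup>2 * (B j)\<^sup>2"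
      using power_mono[OF s_bound, of j n 2] by (simp add: power_mult_distrib)
  qed
  show "summable (\<lambda>n. (A n)\<^sup>2 * (B j)\<^sup>2)" using A_square by (rule summable_mult2)
qed

lemma diagonal_summable: "summable (\<lambda>j. s j j)"
proof (rule summable_norm_cancel, rule summable_comparison_test)
  show "\<exists>N. \<forall>n\<ge>N. norm (norm (s n n)) \<le> \<bar>A n * B n\<bar>"
    using s_bound A_nonneg B_nonneg by auto
  show "summable (\<lambda>n. \<bar>A n * B n\<bar>)" by (rule l2_mult_summable[OF A_square B_square])
qed

text \<open>Interchange of the sums over \<open>i\<close> and \<open>j\<close>. All partial sums
  over \<open>j\<close> are dominated by \<open>K * (A i * cmod (h i))\<close>, which is summable in
  \<open>i\<close>, so Tannery's theorem applies.\<close>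

lemma sums_ip:
  assumes g: "g \<in> l2" and h: "h \<in> l2" and v: "\<And>i. (\<lambda>j. g j * s j i) sums v i"
  shows "(\<lambda>j. g j * ip (s j) h) sums ip v h"
proof -
  have sB: "summable (\<lambda>j. B j * cmod (g j))" and sA: "summable (\<lambda>i. A i * cmod (h i))"
    using summable_mult_l2 A_square A_nonneg B_square B_nonneg g h by auto
  define K where "K = (\<Sum>j. B j * cmod (g j))"
  let ?a = "\<lambda>i N. (\<Sum>j<N. g j * s j i) * cnj (h i)"
  have bd: "norm (?a i N) \<le> K * (A i * cmod (h i))" for i N
  proof -
    have "cmod (\<Sum>j<N. g j * s j i) \<le> (\<Sum>j<N. A i * (B j * cmod (g j)))"
    proof (rule sum_norm_le)
      fix j
      have "norm (g j * s j i) \<le> cmod (g j) * (A i * B j)"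
        unfolding norm_mult using s_bound by (intro mult_left_mono) auto
      then show "norm (g j * s j i) \<le> A i * (B j * cmod (g j))" by (simp add: mult_ac)
    qed
    also have "\<dots> = A i * (\<Sum>j<N. B j * cmod (g j))" by (simp add: sum_distrib_left)
    also have "\<dots> \<le> A i * K"
      unfolding K_def using A_nonneg B_nonneg by (intro mult_left_mono sum_le_suminf sB) auto
    finally have "cmod (\<Sum>j<N. g j * s j i) * cmod (h i) \<le> (A i * K) * cmod (h i)"
      by (rule mult_right_mono) simp
    then show ?thesis by (simp add: norm_mult mult_ac)
  qed
  have "(\<lambda>N. \<Sum>i. ?a i N) \<longlonglongrightarrow> (\<Sum>i. v i * cnj (h i))"
  proof (rule tannerys_theorem[THEN conjunct2, THEN conjunct2])
    show "(\<lambda>N. ?a i N) \<longlonglongrightarrow> v i * cnj (h i)" for i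
      using v[of i] by (intro tendsto_intros) (simp add: sums_def)
    show "\<forall>\<^sub>F (i, N) in sequentially \<times>\<^sub>F sequentially. norm (?a i N) \<le> K * (A i * cmod (h i))"
      using bd by (simp add: case_prod_unfold)
    show "summable (\<lambda>i. K * (A i * cmod (h i)))" using sA by (rule summable_mult)
  qed simp
  moreover have "(\<Sum>i. ?a i N) = (\<Sum>j<N. g j * ip (s j) h)" for N
    using ip_sum_left[of "{..<N}" s h g] s_l2 h by (simp add: ip_def)
  ultimately show ?thesis by (simp add: sums_def ip_def)
qed

section \<open>The matrix as an operator on the span of its eigenvectors, and its trace
  there\<close>

definition S :: "(nat \<Rightarrow> complex) \<Rightarrow> nat \<Rightarrow> complex" where
  "S g = (\<lambda>i. \<Sum>j. g j * s j i)"

lemma S_span: "S (\<lambda>j. \<Sum>\<nu>\<in>F. c \<nu> * u \<nu> j) = (\<lambda>i. \<Sum>\<nu>\<in>F. c \<nu> * (m \<nu> * u \<nu> i))"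
  and S_span_sums: "g = (\<lambda>j. \<Sum>\<nu>\<in>F. c \<nu> * u \<nu> j) \<Longrightarrow> (\<lambda>j. g j * s j i) sums S g i"
proof -
  have *: "(\<lambda>j. (\<Sum>\<nu>\<in>F. c \<nu> * u \<nu> j) * s j i) sums (\<Sum>\<nu>\<in>F. c \<nu> * (m \<nu> * u \<nu> i))" for i
    using sums_sum[of F "\<lambda>\<nu> j. c \<nu> * (u \<nu> j * s j i)", OF sums_mult[OF eigen]]
    by (simp add: sum_distrib_right mult.assoc)
  then show "S (\<lambda>j. \<Sum>\<nu>\<in>F. c \<nu> * u \<nu> j) = (\<lambda>i. \<Sum>\<nu>\<in>F. c \<nu> * (m \<nu> * u \<nu> i))"
    unfolding S_def by (simp add: sums_iff)
  then show "g = (\<lambda>j. \<Sum>\<nu>\<in>F. c \<nu> * u \<nu> j) \<Longrightarrow> (\<lambda>j. g j * s j i) sums S g i"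
    using *[of i] by simp
qed

definition span_u :: "'a set \<Rightarrow> (nat \<Rightarrow> complex) set" where
  "span_u F = {g. \<exists>c. g = (\<lambda>i. \<Sum>\<nu>\<in>F. c \<nu> * u \<nu> i)}"

lemma span_u_l2: "finite F \<Longrightarrow> g \<in> span_u F \<Longrightarrow> g \<in> l2"
  unfolding span_u_def using u_l2 by (auto intro: l2_sum)

lemma span_u_mono:
  assumes "g \<in> span_u F" "F \<subseteq> F'" "finite F'" shows "g \<in> span_u F'"
proof -
  obtain c where c: "g = (\<lambda>i. \<Sum>\<nu>\<in>F. c \<nu> * u \<nu> i)" using assms by (auto simp: span_u_def)
  have "g = (\<lambda>i. \<Sum>\<nu>\<in>F'. (if \<nu> \<in> F then c \<nu> else 0) * u \<nu> i)"
    unfolding c using assms by (intro ext sum.mono_neutral_cong_left) auto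
  then show ?thesis by (auto simp: span_u_def)
qed

lemma span_u_lincomb:
  assumes "finite K" "\<And>k. k \<in> K \<Longrightarrow> g k \<in> span_u F"
  shows "(\<lambda>i. \<Sum>k\<in>K. a k * g k i) \<in> span_u F"
proof -
  have "\<forall>k\<in>K. \<exists>c. g k = (\<lambda>i. \<Sum>\<nu>\<in>F. c \<nu> * u \<nu> i)" using assms by (auto simp: span_u_def)
  then obtain c where c: "\<forall>k\<in>K. g k = (\<lambda>i. \<Sum>\<nu>\<in>F. c k \<nu> * u \<nu> i)" by (metis (no_types))
  have "(\<Sum>k\<in>K. a k * g k i) = (\<Sum>\<nu>\<in>F. (\<Sum>k\<in>K. a k * c k \<nu>) * u \<nu> i)" for i
  proof -
    have "(\<Sum>k\<in>K. a k * g k i) = (\<Sum>k\<in>K. \<Sum>\<nu>\<in>F. a k * c k \<nu> * u \<nu> i)"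
      using c by (intro sum.cong) (auto simp: sum_distrib_left mult.assoc)
    then show ?thesis by (subst (asm) sum.swap) (simp add: sum_distrib_right)
  qed
  then show ?thesis
    unfolding span_u_def by (intro CollectI exI[of _ "\<lambda>\<nu>. \<Sum>k\<in>K. a k * c k \<nu>"]) auto
qed

lemma span_u_S: "g \<in> span_u F \<Longrightarrow> S g \<in> span_u F"
  unfolding span_u_def using S_span by (auto simp: mult.assoc[symmetric])

lemma S_sums: "g \<in> span_u F \<Longrightarrow> (\<lambda>j. g j * s j i) sums S g i"
  unfolding span_u_def using S_span_sums by auto

lemma S_lincomb:
  assumes "finite K" "\<And>k. k \<in> K \<Longrightarrow> g k \<in> span_u F"
  shows "S (\<lambda>i. \<Sum>k\<in>K. a k * g k i) = (\<lambda>i. \<Sum>k\<in>K. a k * S (g k) i)"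
proof
  fix i
  have "(\<lambda>j. \<Sum>k\<in>K. a k * (g k j * s j i)) sums (\<Sum>k\<in>K. a k * S (g k) i)"
    using assms by (intro sums_sum sums_mult S_sums) auto
  then show "S (\<lambda>i. \<Sum>k\<in>K. a k * g k i) i = (\<Sum>k\<in>K. a k * S (g k) i)"
    unfolding S_def[of "\<lambda>i. \<Sum>k\<in>K. a k * g k i"] by (simp add: sum_distrib_right mult.assoc sums_iff)
qed

lemma proj_span_u:
  assumes "orthonormal G" "finite F" "\<And>\<nu>. \<nu> \<in> F \<Longrightarrow> proj G (u \<nu>) = u \<nu>" "g \<in> span_u F"
  shows "proj G g = g"
  using assms(4) proj_comb[OF assms(1,2) u_l2 assms(3)] unfolding span_u_def by auto

text \<open>Adjoining \<open>\<nu>\<close> to \<open>F\<close> adds the residual \<open>w\<close> of \<open>u \<nu>\<close>, and \<open>S w - m \<nu> w\<close> lies in the old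
  span, hence is orthogonal to \<open>w\<close>: in this basis \<open>S\<close> is triangular with diagonal \<open>m\<close>.  If
  \<open>w = 0\<close>, nothing is added, and \<open>m \<nu> = 0\<close> by the independence assumption.\<close>

lemma orthonormal_basis_trace:
  assumes "finite F"
  shows "\<exists>G. orthonormal G \<and> G \<subseteq> span_u F \<and> (\<forall>\<nu>\<in>F. proj G (u \<nu>) = u \<nu>) \<and>
    (\<Sum>g\<in>G. ip (S g) g) = (\<Sum>\<nu>\<in>F. m \<nu>)"
  using assms
proof (induction F rule: finite_induct)
  case empty
  show ?case by (rule exI[of _ "{}"]) (simp add: orthonormal_def)
next
  case (insert \<nu> F)
  then obtain G where G: "orthonormal G" "G \<subseteq> span_u F" "\<And>\<nu>. \<nu> \<in> F \<Longrightarrow> proj G (u \<nu>) = u \<nu>"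
    "(\<Sum>g\<in>G. ip (S g) g) = (\<Sum>\<nu>\<in>F. m \<nu>)" by auto
  have Gfin: "finite G" and Gl2: "g \<in> G \<Longrightarrow> g \<in> l2" for g using G(1) by (auto simp: orthonormal_def)
  define w where "w = (\<lambda>i. u \<nu> i - proj G (u \<nu>) i)"
  have pF: "proj G (u \<nu>) \<in> span_u F"
    unfolding proj_def using G(2) Gfin by (intro span_u_lincomb) auto
  then obtain c where c: "proj G (u \<nu>) = (\<lambda>i. \<Sum>\<nu>\<in>F. c \<nu> * u \<nu> i)" by (auto simp: span_u_def)
  \<comment> \<open>Written in the eigenvectors, \<open>w\<close> has coefficient 1 at
    \<open>\<nu>\<close>; this is the coefficient to which \<open>independent\<close> is applied if
    \<open>w\<close> vanishes.\<close>
  have w_eq: "w = (\<lambda>i. \<Sum>\<kappa>\<in>insert \<nu> F. (if \<kappa> = \<nu> then 1 else - c \<kappa>) * u \<kappa> i)"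
  proof
    fix i
    have "(\<Sum>\<kappa>\<in>F. (if \<kappa> = \<nu> then 1 else - c \<kappa>) * u \<kappa> i) = (\<Sum>\<kappa>\<in>F. - (c \<kappa> * u \<kappa> i))"
      using insert.hyps by (intro sum.cong) auto
    then show "w i = (\<Sum>\<kappa>\<in>insert \<nu> F. (if \<kappa> = \<nu> then 1 else - c \<kappa>) * u \<kappa> i)"
      using insert.hyps unfolding w_def c by (simp add: sum_negf)
  qed
  then have w_span: "w \<in> span_u (insert \<nu> F)"
    unfolding span_u_def by (intro CollectI exI)
  have w_l2: "w \<in> l2" using span_u_l2 w_span insert.hyps by blast
  have w_orth: "ip w g = 0" if "g \<in> G" for g
    unfolding w_def using residual_orthogonal[OF G(1) u_l2 that] .
  have G_span: "G \<subseteq> span_u (insert \<nu> F)"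
    using G(2) span_u_mono[of _ F "insert \<nu> F"] insert.hyps by auto
  show ?case
  proof (cases "norm2 w = 0")
    case True
    have w0: "w i = 0" for i using norm2_eq_0[OF w_l2 True] .
    have "(if \<nu> = \<nu> then 1 else - c \<nu>) * m \<nu> = 0"
      by (rule independent[of "insert \<nu> F" "\<lambda>\<kappa>. if \<kappa> = \<nu> then 1 else - c \<kappa>"])
         (use w0 insert.hyps fun_cong[OF w_eq] in auto)
    then have "m \<nu> = 0" by simp
    moreover have "proj G (u \<nu>) = u \<nu>" using w0 by (auto simp: w_def fun_eq_iff)
    ultimately show ?thesis using G G_span insert.hyps by (intro exI[of _ G]) auto
  next
    case False
    then have pos: "norm2 w > 0" using norm2_nonneg[OF w_l2] by simp
    define a where "a = complex_of_real (1 / sqrt (norm2 w))"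
    have aa: "a * cnj a * norm2 w = 1"
      using pos unfolding a_def by (simp flip: of_real_mult)
    define g0 where "g0 = (\<lambda>i. a * w i)"
    have g0_l2: "g0 \<in> l2" unfolding g0_def by (intro l2_scale w_l2)
    have ip_g0_right: "ip h g0 = cnj a * ip h w" if "h \<in> l2" for h
      using ip_commute[OF g0_l2 that] ip_commute[OF w_l2 that] ip_scale_left[OF w_l2 that]
      by (simp add: g0_def)
    have g0_orth: "ip g0 g = 0" "ip g g0 = 0" if "g \<in> G" for g
    proof -
      show "ip g0 g = 0" using w_orth[OF that] ip_scale_left[OF w_l2 Gl2[OF that]] by (simp add: g0_def)
      then show "ip g g0 = 0" using ip_commute[OF g0_l2 Gl2[OF that]] by simp
    qed
    have g0_norm: "ip g0 g0 = 1"
    proof -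
      have "ip g0 g0 = a * cnj a * ip w w"
        using ip_g0_right[OF g0_l2] ip_scale_left[OF w_l2 w_l2] by (simp add: g0_def)
      then show ?thesis using aa by (simp add: ip_self[OF w_l2])
    qed
    have g0_notin: "g0 \<notin> G" using g0_orth(1) g0_norm by force
    have G': "orthonormal (insert g0 G)"
      using G(1) g0_l2 g0_orth g0_norm g0_notin unfolding orthonormal_def by auto
    have g0_span: "g0 \<in> span_u (insert \<nu> F)"
      using span_u_lincomb[of "{w}" "\<lambda>w. w" "insert \<nu> F" "\<lambda>_. a"] w_span by (simp add: g0_def)
    have proj_F: "proj (insert g0 G) (u \<kappa>) = u \<kappa>" if \<kappa>: "\<kappa> \<in> F" for \<kappa>
    proof -
      have "ip (u \<kappa>) g0 = ip (proj G (u \<kappa>)) g0" using G(3)[OF \<kappa>] by simp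
      also have "\<dots> = (\<Sum>g\<in>G. ip (u \<kappa>) g * ip g g0)"
        unfolding proj_def using Gfin Gl2 g0_l2 by (intro ip_sum_left) auto
      also have "\<dots> = 0" using g0_orth by (intro sum.neutral) auto
      finally have "proj (insert g0 G) (u \<kappa>) = proj G (u \<kappa>)"
        using Gfin g0_notin by (simp add: proj_def)
      then show ?thesis using G(3)[OF \<kappa>] by simp
    qed
    have proj_\<nu>: "proj (insert g0 G) (u \<nu>) = u \<nu>"
    proof
      fix i
      have pw: "ip (proj G (u \<nu>)) w = 0"
      proof -
        have "ip (proj G (u \<nu>)) w = (\<Sum>g\<in>G. ip (u \<nu>) g * ip g w)"
          unfolding proj_def using Gfin Gl2 w_l2 by (intro ip_sum_left) auto
        also have "\<dots> = 0" using w_orth ip_commute[OF w_l2 Gl2] by (intro sum.neutral) auto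
        finally show ?thesis .
      qed
      have "ip (u \<nu>) w = ip (\<lambda>i. w i + proj G (u \<nu>) i) w" by (simp add: w_def)
      also have "\<dots> = norm2 w"
        using pw proj_l2[OF G(1)] w_l2 by (simp add: ip_add_left ip_self)
      finally have "ip (u \<nu>) g0 * g0 i = (a * cnj a * norm2 w) * w i"
        using ip_g0_right[OF u_l2] by (simp add: g0_def)
      then have "ip (u \<nu>) g0 * g0 i = w i" using aa by simp
      then show "proj (insert g0 G) (u \<nu>) i = u \<nu> i"
        using Gfin g0_notin by (simp add: proj_def w_def)
    qed
    have "ip (S g0) g0 = m \<nu>"
    proof -
      have Sw: "S w = (\<lambda>i. m \<nu> * w i + (m \<nu> * proj G (u \<nu>) i - S (proj G (u \<nu>)) i))"
      proof
        fix i
        have "(\<Sum>\<kappa>\<in>F. (if \<kappa> = \<nu> then 1 else - c \<kappa>) * (m \<kappa> * u \<kappa> i)) = - (\<Sum>\<kappa>\<in>F. c \<kappa> * (m \<kappa> * u \<kappa> i))"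
          using insert.hyps unfolding sum_negf[symmetric] by (intro sum.cong) auto
        then have "S w i = m \<nu> * u \<nu> i - S (proj G (u \<nu>)) i"
          using insert.hyps unfolding w_eq S_span c by simp
        then show "S w i = m \<nu> * w i + (m \<nu> * proj G (u \<nu>) i - S (proj G (u \<nu>)) i)"
          by (simp add: w_def algebra_simps)
      qed
      \<comment> \<open>A vector of the old span equals its projection onto \<open>G\<close>, and
        \<open>w\<close> is orthogonal to \<open>G\<close>.\<close>
      have orth: "ip h w = 0" if h: "h \<in> span_u F" for h
      proof -
        have "ip h w = ip (proj G h) w" using proj_span_u[OF G(1) insert.hyps(1) G(3) h] by simp
        also have "\<dots> = (\<Sum>g\<in>G. ip h g * ip g w)"
          unfolding proj_def using Gfin Gl2 w_l2 by (intro ip_sum_left) auto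
        also have "\<dots> = 0" using w_orth ip_commute[OF w_l2 Gl2] by (intro sum.neutral) auto
        finally show ?thesis .
      qed
      note l2s = span_u_l2[OF insert.hyps(1) pF] span_u_l2[OF insert.hyps(1) span_u_S[OF pF]]
      have "ip (S w) w = m \<nu> * ip w w + (m \<nu> * ip (proj G (u \<nu>)) w - ip (S (proj G (u \<nu>))) w)"
        unfolding Sw using w_l2 l2s by (simp add: ip_add_left ip_diff_left ip_scale_left l2_scale l2_diff)
      then have ipSw: "ip (S w) w = m \<nu> * norm2 w"
        using orth[OF pF] orth[OF span_u_S[OF pF]] by (simp add: ip_self[OF w_l2])
      have Sg0: "S g0 = (\<lambda>i. a * S w i)"
        using S_lincomb[of "{w}" "\<lambda>w. w" "insert \<nu> F" "\<lambda>_. a"] w_span by (simp add: g0_def)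
      have Sw_l2: "S w \<in> l2" using span_u_l2 span_u_S w_span insert.hyps by blast
      have "ip (S g0) g0 = a * cnj a * ip (S w) w"
        unfolding Sg0 using ip_g0_right[OF l2_scale[OF Sw_l2]] ip_scale_left[OF Sw_l2 w_l2] by simp
      then have "ip (S g0) g0 = (a * cnj a * norm2 w) * m \<nu>" unfolding ipSw by (simp add: mult_ac)
      then show ?thesis using aa by simp
    qed
    then have "(\<Sum>g\<in>insert g0 G. ip (S g) g) = (\<Sum>\<nu>\<in>insert \<nu> F. m \<nu>)"
      using G(4) Gfin g0_notin insert.hyps by simp
    then show ?thesis
      using G' g0_span G_span proj_F proj_\<nu> by (intro exI[of _ "insert g0 G"]) auto
  qed
qed

lemma trace_has_sum: "(m has_sum (\<Sum>j. s j j)) UNIV"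
  unfolding has_sum_def
proof (rule tendstoI)
  fix e :: real assume e: "0 < e"
  define t where "t = (\<Sum>j. s j j)"
  obtain N1 where N1: "\<And>N M G. N \<ge> N1 \<Longrightarrow> orthonormal G \<Longrightarrow> cmod (\<Sum>j\<in>{N..<M}. proj G (s j) j) \<le> e / 4"
    using tail[of "e / 4"] e by fastforce
  have "(\<lambda>N. \<Sum>j<N. s j j) \<longlonglongrightarrow> t"
    using summable_sums[OF diagonal_summable] by (simp add: sums_def t_def)
  then obtain N2 where N2: "\<And>N. N \<ge> N2 \<Longrightarrow> cmod ((\<Sum>j<N. s j j) - t) < e / 4"
    using LIMSEQ_D[of "\<lambda>N. \<Sum>j<N. s j j" t "e / 4"] e by auto
  define N where "N = max N1 N2"
  \<comment> \<open>\<open>N\<close> diagonal errors of size at most \<open>d\<close> add up to at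
    most \<open>e / 4\<close>; the added 1 covers \<open>N = 0\<close>.\<close>
  define d where "d = e / (4 * (real N + 1))"
  have d: "0 < d" using e by (simp add: d_def)
  have "\<forall>j. \<exists>F c. finite F \<and> norm2 (\<lambda>i. s j i - (\<Sum>\<nu>\<in>F. c \<nu> * u \<nu> i)) < d\<^sup>2"
    using dense d by simp
  then obtain F c where F: "\<And>j. finite (F j)"
    "\<And>j. norm2 (\<lambda>i. s j i - (\<Sum>\<nu>\<in>F j. c j \<nu> * u \<nu> i)) < d\<^sup>2" by metis
  define F0 where "F0 = (\<Union>j<N. F j)"
  have main: "dist (sum m X) t < e" if X: "finite X" "F0 \<subseteq> X" for X
  proof -
    obtain G where G: "orthonormal G" "G \<subseteq> span_u X" "\<And>\<nu>. \<nu> \<in> X \<Longrightarrow> proj G (u \<nu>) = u \<nu>"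
      "(\<Sum>g\<in>G. ip (S g) g) = sum m X" using orthonormal_basis_trace[OF X(1)] by auto
    have Gfin: "finite G" and Gl2: "g \<in> G \<Longrightarrow> g \<in> l2" for g using G(1) by (auto simp: orthonormal_def)
    \<comment> \<open>Expanding \<open>S g\<close> by columns in \<open>ip (S g) g\<close> and
      summing over \<open>g\<close> produces the diagonal of the projected matrix.\<close>
    have "(\<lambda>j. \<Sum>g\<in>G. g j * ip (s j) g) sums (\<Sum>g\<in>G. ip (S g) g)"
      using G(2) Gl2 by (intro sums_sum sums_ip S_sums) auto
    then have sums: "(\<lambda>j. proj G (s j) j) sums sum m X"
      unfolding G(4) proj_def by (simp add: mult.commute)
    \<comment> \<open>\<open>F0\<close> serves the first \<open>N\<close> columns. As
      \<open>X\<close> contains it, the approximant chosen for column \<open>j\<close> lies in the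
      span over \<open>X\<close>, and the projection approximates at least as well.\<close>
    have "cmod (s j j - proj G (s j) j) \<le> d" if j: "j < N" for j
    proof -
      let ?h = "\<lambda>i. \<Sum>\<nu>\<in>F j. c j \<nu> * u \<nu> i"
      have "?h \<in> span_u (F j)" by (auto simp: span_u_def)
      then have h: "?h \<in> span_u X" by (rule span_u_mono) (use X j in \<open>auto simp: F0_def\<close>)
      have "(cmod (s j j - proj G (s j) j))\<^sup>2 \<le> norm2 (\<lambda>i. s j i - proj G (s j) i)"
        using component_le_norm2[OF l2_diff[OF s_l2 proj_l2[OF G(1)]]] .
      also have "\<dots> \<le> norm2 (\<lambda>i. s j i - ?h i)"
        using residual_le[OF G(1) s_l2 span_u_l2[OF X(1) h] proj_span_u[OF G(1) X(1) G(3) h]] .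
      also have "\<dots> < d\<^sup>2" by (rule F(2))
      finally show ?thesis using power2_less_imp_less[of _ d] d by force
    qed
    then have "cmod (\<Sum>j<N. s j j - proj G (s j) j) \<le> (\<Sum>j<N. d)"
      by (intro sum_norm_le) auto
    also have "\<dots> = real N * e / (4 * (real N + 1))" by (simp add: d_def)
    also have "\<dots> \<le> e / 4" using e by (simp add: field_simps)
    finally have b1: "cmod (\<Sum>j<N. s j j - proj G (s j) j) \<le> e / 4" .
    have lim: "(\<lambda>M. \<Sum>j\<in>{N..<M}. proj G (s j) j) \<longlonglongrightarrow> sum m X - (\<Sum>j<N. proj G (s j) j)"
    proof (rule Lim_transform_eventually)
      show "(\<lambda>M. (\<Sum>j<M. proj G (s j) j) - (\<Sum>j<N. proj G (s j) j)) \<longlonglongrightarrow> sum m X - (\<Sum>j<N. proj G (s j) j)"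
        using sums by (intro tendsto_intros) (simp add: sums_def)
      show "\<forall>\<^sub>F M in sequentially. (\<Sum>j<M. proj G (s j) j) - (\<Sum>j<N. proj G (s j) j) = (\<Sum>j\<in>{N..<M}. proj G (s j) j)"
        using eventually_ge_at_top[of N]
      proof eventually_elim
        case (elim M)
        show ?case using sum_diff_nat_ivl[of 0 N M "\<lambda>j. proj G (s j) j"] elim by (simp add: lessThan_atLeast0)
      qed
    qed
    have b2: "cmod (sum m X - (\<Sum>j<N. proj G (s j) j)) \<le> e / 4"
      using N1[OF _ G(1), of N] by (intro Lim_norm_ubound[OF _ lim]) (auto simp: N_def)
    have b3: "cmod ((\<Sum>j<N. s j j) - t) < e / 4" using N2[of N] by (simp add: N_def)
    have "sum m X - t = (sum m X - (\<Sum>j<N. proj G (s j) j)) - (\<Sum>j<N. s j j - proj G (s j) j) + ((\<Sum>j<N. s j j) - t)"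
      by (simp add: sum_subtractf)
    also have "cmod \<dots> \<le> cmod (sum m X - (\<Sum>j<N. proj G (s j) j)) + cmod (\<Sum>j<N. s j j - proj G (s j) j) + cmod ((\<Sum>j<N. s j j) - t)"
      by (meson add_right_mono norm_triangle_ineq norm_triangle_ineq4 order_trans)
    also have "\<dots> < e" using b1 b2 b3 e by linarith
    finally show ?thesis by (simp add: dist_norm)
  qed
  have "finite F0" using F by (auto simp: F0_def)
  then show "\<forall>\<^sub>F X in finite_subsets_at_top UNIV. dist (sum m X) (\<Sum>j. s j j) < e"
    unfolding t_def[symmetric] eventually_finite_subsets_at_top using main by auto
qed

end

section \<open>Mixed-norm inequalities\<close>

text \<open>Concavity: the graph lies below its tangent at 1. This is the weighted inequality of
  arithmetic and geometric means for \<open>t\<close> and 1.\<close>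

lemma powr_le_tangent:
  fixes t q :: real
  assumes "0 \<le> t" "0 < q" "q \<le> 1"
  shows "t powr q \<le> 1 + q * (t - 1)"
proof (cases "t = 0")
  case False
  then show ?thesis using Youngs_inequality_0[of q "1 - q" t 1] assms by (simp add: algebra_simps)
qed (use assms in simp)

text \<open>The concave case with exponent \<open>1 / q\<close>, applied to
  \<open>t powr q\<close>.\<close>

lemma powr_ge_tangent:
  fixes t q :: real
  assumes "0 \<le> t" "1 \<le> q"
  shows "1 + q * (t - 1) \<le> t powr q"
proof -
  have "(t powr q) powr (1 / q) \<le> 1 + (1 / q) * (t powr q - 1)"
    using assms by (intro powr_le_tangent) auto
  then show ?thesis using assms by (simp add: powr_powr field_simps)
qed

text \<open>Jensen's inequality for powers. The tangent inequality is applied to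
  \<open>x i / M\<close> and averaged; its linear part drops out because the weighted mean of the
  \<open>x i / M\<close> is 1.\<close>

lemma powr_weighted_mean:
  fixes w x :: "'i \<Rightarrow> real" and q :: real
  assumes w: "\<And>i. i \<in> I \<Longrightarrow> 0 \<le> w i" "(\<Sum>i\<in>I. w i) = 1"
    and x: "\<And>i. i \<in> I \<Longrightarrow> 0 \<le> x i" and fin: "finite I"
  shows "1 \<le> q \<Longrightarrow> (\<Sum>i\<in>I. w i * x i) powr q \<le> (\<Sum>i\<in>I. w i * x i powr q)"
    and "0 < q \<Longrightarrow> q \<le> 1 \<Longrightarrow> (\<Sum>i\<in>I. w i * x i powr q) \<le> (\<Sum>i\<in>I. w i * x i) powr q"
proof -
  define M where "M = (\<Sum>i\<in>I. w i * x i)"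
  have M0: "0 \<le> M" unfolding M_def using w x by (intro sum_nonneg) auto
  have lin: "(\<Sum>i\<in>I. w i * (1 + q * (x i / M - 1))) = 1" if "M \<noteq> 0"
  proof -
    have "(\<Sum>i\<in>I. w i * (1 + q * (x i / M - 1))) = (\<Sum>i\<in>I. (1 - q) * w i + (q / M) * (w i * x i))"
      using that by (intro sum.cong) (auto simp: field_simps)
    also have "\<dots> = (1 - q) * 1 + (q / M) * M"
      unfolding sum.distrib sum_distrib_left[symmetric] M_def w by simp
    finally show ?thesis using that by simp
  qed
  have scale: "M powr q * (\<Sum>i\<in>I. w i * (x i / M) powr q) = (\<Sum>i\<in>I. w i * x i powr q)" if "M \<noteq> 0"
    unfolding sum_distrib_left using M0 that x
    by (intro sum.cong) (auto simp: powr_divide)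
  show "(\<Sum>i\<in>I. w i * x i) powr q \<le> (\<Sum>i\<in>I. w i * x i powr q)" if q: "1 \<le> q"
  proof (cases "M = 0")
    case True
    then show ?thesis unfolding M_def[symmetric] using w by (auto intro!: sum_nonneg)
  next
    case False
    have "(\<Sum>i\<in>I. w i * (1 + q * (x i / M - 1))) \<le> (\<Sum>i\<in>I. w i * (x i / M) powr q)"
      using w x M0 q by (intro sum_mono mult_left_mono powr_ge_tangent) auto
    then have "M powr q * 1 \<le> M powr q * (\<Sum>i\<in>I. w i * (x i / M) powr q)"
      unfolding lin[OF False] by (intro mult_left_mono) auto
    then show ?thesis unfolding scale[OF False] by (simp add: M_def)
  qed
  show "(\<Sum>i\<in>I. w i * x i powr q) \<le> (\<Sum>i\<in>I. w i * x i) powr q" if q: "0 < q" "q \<le> 1"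
  proof (cases "M = 0")
    case True
    then have "\<forall>i\<in>I. w i * x i = 0"
      unfolding M_def using fin w x by (subst (asm) sum_nonneg_eq_0_iff) auto
    then have "(\<Sum>i\<in>I. w i * x i powr q) = 0" by (intro sum.neutral) auto
    then show ?thesis by simp
  next
    case False
    have "(\<Sum>i\<in>I. w i * (x i / M) powr q) \<le> (\<Sum>i\<in>I. w i * (1 + q * (x i / M - 1)))"
      using w x M0 q by (intro sum_mono mult_left_mono powr_le_tangent) auto
    then have "M powr q * (\<Sum>i\<in>I. w i * (x i / M) powr q) \<le> M powr q * 1"
      unfolding lin[OF False] by (intro mult_left_mono) auto
    then show ?thesis unfolding scale[OF False] by (simp add: M_def)
  qed
qed

text \<open>By homogeneity the sum may be taken to be 1. Then every term lies in [0, 1], where a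
  larger exponent gives a smaller power.\<close>

lemma powr_sum_additivity:
  fixes x :: "'i \<Rightarrow> real" and q :: real
  assumes x: "\<And>i. i \<in> I \<Longrightarrow> 0 \<le> x i" and fin: "finite I"
  shows "1 \<le> q \<Longrightarrow> (\<Sum>i\<in>I. x i powr q) \<le> (\<Sum>i\<in>I. x i) powr q"
    and "0 < q \<Longrightarrow> q \<le> 1 \<Longrightarrow> (\<Sum>i\<in>I. x i) powr q \<le> (\<Sum>i\<in>I. x i powr q)"
proof -
  define S where "S = (\<Sum>i\<in>I. x i)"
  have S0: "0 \<le> S" unfolding S_def using x by (rule sum_nonneg)
  have xS: "x i \<le> S" if "i \<in> I" for i unfolding S_def using that x fin by (intro member_le_sum) auto
  have one: "(\<Sum>i\<in>I. x i / S) = 1" if "S \<noteq> 0"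
    using that by (simp add: sum_divide_distrib[symmetric] S_def)
  have scale: "S powr q * (\<Sum>i\<in>I. (x i / S) powr q) = (\<Sum>i\<in>I. x i powr q)" if "S \<noteq> 0"
    unfolding sum_distrib_left using S0 that x by (intro sum.cong) (auto simp: powr_divide)
  have zero: "(\<Sum>i\<in>I. x i powr q) = 0" if "S = 0"
    using that fin x unfolding S_def by (subst (asm) sum_nonneg_eq_0_iff) auto
  show "(\<Sum>i\<in>I. x i powr q) \<le> (\<Sum>i\<in>I. x i) powr q" if q: "1 \<le> q"
  proof (cases "S = 0")
    case False
    have "(\<Sum>i\<in>I. (x i / S) powr q) \<le> (\<Sum>i\<in>I. x i / S)"
    proof (rule sum_mono)
      fix i assume "i \<in> I"
      then show "(x i / S) powr q \<le> x i / S"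
        using powr_mono'[of 1 q "x i / S"] x xS S0 False q by (auto simp: divide_le_eq_1)
    qed
    then have "S powr q * (\<Sum>i\<in>I. (x i / S) powr q) \<le> S powr q * 1"
      unfolding one[OF False] by (intro mult_left_mono) auto
    then show ?thesis unfolding scale[OF False] by (simp add: S_def)
  qed (use zero in simp)
  show "(\<Sum>i\<in>I. x i) powr q \<le> (\<Sum>i\<in>I. x i powr q)" if q: "0 < q" "q \<le> 1"
  proof (cases "S = 0")
    case False
    have "(\<Sum>i\<in>I. x i / S) \<le> (\<Sum>i\<in>I. (x i / S) powr q)"
    proof (rule sum_mono)
      fix i assume "i \<in> I"
      then show "x i / S \<le> (x i / S) powr q"
        using powr_mono'[of q 1 "x i / S"] x xS S0 False q by (auto simp: divide_le_eq_1)
    qed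
    then have "S powr q * 1 \<le> S powr q * (\<Sum>i\<in>I. (x i / S) powr q)"
      unfolding one[OF False] by (intro mult_left_mono) auto
    then show ?thesis unfolding scale[OF False] by (simp add: S_def)
  qed (use zero q in \<open>simp add: S_def\<close>)
qed

text \<open>Minkowski's inequality for nonnegative functions, \<open>l i\<close> being a positive
  upper bound for the norm of \<open>h i\<close> with exponent \<open>q\<close>. Pointwise, Jensen
  is used with weights \<open>l i / L\<close> and values \<open>h i x / l i\<close>; after
  integration each value contributes at most its weight.\<close>

lemma integral_powr_sum_le:
  fixes h :: "'i \<Rightarrow> 'a \<Rightarrow> real"
  assumes q: "1 \<le> q" and fin: "finite I"
    and h: "\<And>i x. i \<in> I \<Longrightarrow> 0 \<le> h i x" "\<And>i. i \<in> I \<Longrightarrow> h i \<in> borel_measurable M"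
    and int: "\<And>i. i \<in> I \<Longrightarrow> integrable M (\<lambda>x. h i x powr q)"
    and l: "\<And>i. i \<in> I \<Longrightarrow> 0 < l i" "\<And>i. i \<in> I \<Longrightarrow> (LINT x|M. h i x powr q) \<le> l i powr q"
  shows "integrable M (\<lambda>x. (\<Sum>i\<in>I. h i x) powr q)"
    and "(LINT x|M. (\<Sum>i\<in>I. h i x) powr q) \<le> (\<Sum>i\<in>I. l i) powr q"
proof -
  define L where "L = (\<Sum>i\<in>I. l i)"
  define g where "g = (\<lambda>x. \<Sum>i\<in>I. L powr q * (l i / L / l i powr q) * (h i x powr q))"
  have gint: "integrable M g" unfolding g_def using int by auto
  have pw: "(\<Sum>i\<in>I. h i x) powr q \<le> g x" for x
  proof (cases "I = {}")
    case True then show ?thesis by (simp add: g_def)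
  next
    case False
    then have L: "0 < L" unfolding L_def using fin l by (intro sum_pos) auto
    have "(\<Sum>i\<in>I. h i x) = (\<Sum>i\<in>I. L * ((l i / L) * (h i x / l i)))"
      using l(1) L by (intro sum.cong) fastforce+
    also have "\<dots> = L * (\<Sum>i\<in>I. (l i / L) * (h i x / l i))" by (simp add: sum_distrib_left)
    finally have e: "(\<Sum>i\<in>I. h i x) = L * (\<Sum>i\<in>I. (l i / L) * (h i x / l i))" .
    have l0: "\<And>i. i \<in> I \<Longrightarrow> 0 \<le> l i" using l(1) by force
    have "(\<Sum>i\<in>I. h i x) powr q = L powr q * (\<Sum>i\<in>I. (l i / L) * (h i x / l i)) powr q"
      unfolding e by (rule powr_mult)
    also have "\<dots> \<le> L powr q * (\<Sum>i\<in>I. (l i / L) * (h i x / l i) powr q)"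
    proof (intro mult_left_mono powr_weighted_mean(1))
      show "(\<Sum>i\<in>I. l i / L) = 1" using L by (simp add: sum_divide_distrib[symmetric] L_def)
    qed (use l0 L h fin q in auto)
    also have "\<dots> = g x"
      unfolding g_def sum_distrib_left using h(1) l0 by (intro sum.cong) (auto simp: powr_divide)
    finally show ?thesis .
  qed
  have gI: "(LINT x|M. g x) \<le> L powr q"
  proof (cases "I = {}")
    case False
    then have L: "0 < L" unfolding L_def using fin l by (intro sum_pos) auto
    have "(LINT x|M. g x) = (\<Sum>i\<in>I. L powr q * (l i / L / l i powr q) * (LINT x|M. h i x powr q))"
      unfolding g_def using int by (subst Bochner_Integration.integral_sum) auto
    also have "\<dots> \<le> (\<Sum>i\<in>I. L powr q * (l i / L / l i powr q) * l i powr q)"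
    proof (intro sum_mono mult_left_mono l)
      fix i assume "i \<in> I" then show "0 \<le> L powr q * (l i / L / l i powr q)"
        using l(1)[of i] L by auto
    qed
    also have "\<dots> = (\<Sum>i\<in>I. L powr q * (l i / L))"
    proof (intro sum.cong refl)
      fix i assume "i \<in> I" then show "L powr q * (l i / L / l i powr q) * l i powr q = L powr q * (l i / L)"
        using l(1)[of i] by simp
    qed
    also have "\<dots> = L powr q"
      using L unfolding sum_distrib_left[symmetric] sum_divide_distrib[symmetric] by (simp add: L_def)
    finally show ?thesis .
  qed (simp add: g_def L_def)
  have meas: "(\<lambda>x. (\<Sum>i\<in>I. h i x) powr q) \<in> borel_measurable M" using h by measurable
  show i: "integrable M (\<lambda>x. (\<Sum>i\<in>I. h i x) powr q)"
    by (rule Bochner_Integration.integrable_bound[OF gint meas])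
       (use pw in \<open>auto intro!: AE_I2 order_trans[OF pw]\<close>)
  show "(LINT x|M. (\<Sum>i\<in>I. h i x) powr q) \<le> (\<Sum>i\<in>I. l i) powr q"
    using integral_mono[OF i gint pw] gI by (simp add: L_def)
qed

lemma integrable_powr_sum_concave:
  fixes h :: "'i \<Rightarrow> 'a \<Rightarrow> real"
  assumes q: "0 < q" "q \<le> 1" and fin: "finite I"
    and h: "\<And>i x. i \<in> I \<Longrightarrow> 0 \<le> h i x" "\<And>i. i \<in> I \<Longrightarrow> h i \<in> borel_measurable M"
    and int: "\<And>i. i \<in> I \<Longrightarrow> integrable M (\<lambda>x. h i x powr q)"
  shows "integrable M (\<lambda>x. (\<Sum>i\<in>I. h i x) powr q)"
proof (rule Bochner_Integration.integrable_bound)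
  show "integrable M (\<lambda>x. \<Sum>i\<in>I. h i x powr q)" using int by auto
  show "(\<lambda>x. (\<Sum>i\<in>I. h i x) powr q) \<in> borel_measurable M" using h by measurable
  show "AE x in M. norm ((\<Sum>i\<in>I. h i x) powr q) \<le> norm (\<Sum>i\<in>I. h i x powr q)"
    using powr_sum_additivity(2)[OF h(1) fin q] by (auto intro!: AE_I2 simp: sum_nonneg)
qed

text \<open>For exponents at most 1 Minkowski's inequality is reversed: the same argument, with the
  concave half of Jensen and with the weights taken from the integrals themselves.\<close>

lemma integral_powr_sum_ge:
  fixes h :: "'i \<Rightarrow> 'a \<Rightarrow> real"
  assumes q: "0 < q" "q \<le> 1" and fin: "finite I"
    and h: "\<And>i x. i \<in> I \<Longrightarrow> 0 \<le> h i x" "\<And>i. i \<in> I \<Longrightarrow> h i \<in> borel_measurable M"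
    and int: "\<And>i. i \<in> I \<Longrightarrow> integrable M (\<lambda>x. h i x powr q)"
  shows "(\<Sum>i\<in>I. (LINT x|M. h i x powr q) powr (1 / q)) powr q \<le> (LINT x|M. (\<Sum>i\<in>I. h i x) powr q)"
proof -
  define N where "N = (\<lambda>i. LINT x|M. h i x powr q)"
  have N0: "0 \<le> N i" for i unfolding N_def by (rule Bochner_Integration.integral_nonneg) simp
  define l where "l = (\<lambda>i. N i powr (1 / q))"
  have lq: "l i powr q = N i" for i using N0 q by (simp add: l_def powr_powr)
  have l0: "0 \<le> l i" for i by (simp add: l_def)
  define L where "L = (\<Sum>i\<in>I. l i)"
  show ?thesis
  proof (cases "L = 0")
    case True
    then have "(\<Sum>i\<in>I. (LINT x|M. h i x powr q) powr (1 / q)) = 0" by (simp add: L_def l_def N_def)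
    then show ?thesis by (simp add: Bochner_Integration.integral_nonneg)
  next
    case False
    have L: "0 < L" using False sum_nonneg[of I l] l0 unfolding L_def by force
    \<comment> \<open>Functions with zero integral would lead to a division by 0. Leaving them out
      only decreases the sum under the integral.\<close>
    define I' where "I' = {i\<in>I. l i \<noteq> 0}"
    have I': "I' \<subseteq> I" "finite I'" using fin by (auto simp: I'_def)
    have lpos: "0 < l i" if "i \<in> I'" for i using that l0[of i] by (auto simp: I'_def)
    have LI': "(\<Sum>i\<in>I'. l i) = L"
      unfolding L_def I'_def using fin by (intro sum.mono_neutral_left) auto
    define g where "g = (\<lambda>x. \<Sum>i\<in>I'. L powr q * (l i / L / l i powr q) * (h i x powr q))"
    have gint: "integrable M g" unfolding g_def using int I'
      by (intro Bochner_Integration.integrable_sum Bochner_Integration.integrable_mult_right) auto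
    have pw: "g x \<le> (\<Sum>i\<in>I. h i x) powr q" for x
    proof -
      have "g x = L powr q * (\<Sum>i\<in>I'. (l i / L) * (h i x / l i) powr q)"
        unfolding g_def sum_distrib_left using h(1) l0 I' by (intro sum.cong) (auto simp: powr_divide)
      also have "\<dots> \<le> L powr q * (\<Sum>i\<in>I'. (l i / L) * (h i x / l i)) powr q"
      proof (intro mult_left_mono powr_weighted_mean(2))
        show "(\<Sum>i\<in>I'. l i / L) = 1" using L LI' by (simp add: sum_divide_distrib[symmetric])
      qed (use l0 L h I' q in auto)
      also have "\<dots> = (L * (\<Sum>i\<in>I'. (l i / L) * (h i x / l i))) powr q"
        by (rule powr_mult[symmetric])
      also have "L * (\<Sum>i\<in>I'. (l i / L) * (h i x / l i)) = (\<Sum>i\<in>I'. h i x)"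
        unfolding sum_distrib_left using lpos L by (intro sum.cong) fastforce+
      also have "(\<Sum>i\<in>I'. h i x) powr q \<le> (\<Sum>i\<in>I. h i x) powr q"
        using h(1) I' fin q by (intro powr_mono2 sum_mono2 sum_nonneg) auto
      finally show ?thesis .
    qed
    have "(LINT x|M. g x) = (\<Sum>i\<in>I'. L powr q * (l i / L / l i powr q) * N i)"
      unfolding g_def N_def using int I' by (subst Bochner_Integration.integral_sum) auto
    also have "\<dots> = (\<Sum>i\<in>I'. L powr q * (l i / L))"
    proof (intro sum.cong refl)
      fix i assume "i \<in> I'"
      then have "N i \<noteq> 0" using lpos[of i] lq[of i] by (metis less_irrefl powr_eq_0_iff)
      then show "L powr q * (l i / L / l i powr q) * N i = L powr q * (l i / L)"
        by (simp add: lq)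
    qed
    also have "\<dots> = L powr q"
      using L unfolding sum_distrib_left[symmetric] sum_divide_distrib[symmetric] LI' by simp
    finally have "L powr q = (LINT x|M. g x)" by simp
    also have "\<dots> \<le> (LINT x|M. (\<Sum>i\<in>I. h i x) powr q)"
      using integrable_powr_sum_concave[OF q fin h int] by (intro integral_mono gint pw) auto
    finally show ?thesis unfolding L_def l_def N_def .
  qed
qed

lemma square_powr_half: "((cmod z)\<^sup>2) powr (p / 2) = cmod z powr p"
  by (simp add: powr_powr flip: powr_numeral)

text \<open>Both families are compared with their square functions, whose squares are raised to the
  power \<open>p / 2\<close>. For \<open>p \<le> 2\<close> that power is subadditive, which controls
  the side of the \<open>Y j\<close>, and the reverse Minkowski inequality controls the side of the
  \<open>F i\<close>. For \<open>p > 2\<close> the roles are exchanged: superadditivity for the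
  \<open>F i\<close>, Minkowski for the \<open>Y j\<close>. The result goes from exponent
  \<open>min p 2\<close> to exponent \<open>max p 2\<close> in both cases.\<close>

lemma mixed_norm_bound:
  fixes F Y :: "'i \<Rightarrow> 'a \<Rightarrow> complex" and p :: real
  assumes p: "1 \<le> p" and fin: "finite I" "finite J"
    and F: "\<And>i. i \<in> I \<Longrightarrow> F i \<in> borel_measurable M" "\<And>i. i \<in> I \<Longrightarrow> integrable M (\<lambda>x. cmod (F i x) powr p)"
    and Y: "\<And>j. j \<in> J \<Longrightarrow> Y j \<in> borel_measurable M" "\<And>j. j \<in> J \<Longrightarrow> integrable M (\<lambda>x. cmod (Y j x) powr p)"
    and le: "\<And>x. (\<Sum>i\<in>I. (cmod (F i x))\<^sup>2) \<le> (\<Sum>j\<in>J. (cmod (Y j x))\<^sup>2)"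
    and B: "\<And>j. j \<in> J \<Longrightarrow> 0 < B j" "\<And>j. j \<in> J \<Longrightarrow> (LINT x|M. cmod (Y j x) powr p) \<le> B j powr p"
  shows "(\<Sum>i\<in>I. (LINT x|M. cmod (F i x) powr p) powr (max p 2 / p)) \<le>
    (\<Sum>j\<in>J. B j powr min p 2) powr (max p 2 / min p 2)"
proof (cases "p \<le> 2")
  case True
  define q where "q = p / 2"
  have q: "0 < q" "q \<le> 1" using True p by (auto simp: q_def)
  have sq: "((cmod z)\<^sup>2) powr q = cmod z powr p" for z unfolding q_def by (rule square_powr_half)
  have "(\<Sum>i\<in>I. (LINT x|M. cmod (F i x) powr p) powr (1 / q)) powr q
      \<le> (LINT x|M. (\<Sum>i\<in>I. (cmod (F i x))\<^sup>2) powr q)"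
    using integral_powr_sum_ge[OF q fin(1), of "\<lambda>i x. (cmod (F i x))\<^sup>2" M] F by (simp add: sq)
  also have "\<dots> \<le> (LINT x|M. (\<Sum>j\<in>J. cmod (Y j x) powr p))"
  proof (rule integral_mono)
    show "integrable M (\<lambda>x. (\<Sum>i\<in>I. (cmod (F i x))\<^sup>2) powr q)"
      using F by (intro integrable_powr_sum_concave q fin) (auto simp: sq)
    show "integrable M (\<lambda>x. \<Sum>j\<in>J. cmod (Y j x) powr p)" using Y by auto
    fix x
    have "(\<Sum>i\<in>I. (cmod (F i x))\<^sup>2) powr q \<le> (\<Sum>j\<in>J. (cmod (Y j x))\<^sup>2) powr q"
      using le q by (intro powr_mono2 sum_nonneg) auto
    also have "\<dots> \<le> (\<Sum>j\<in>J. cmod (Y j x) powr p)"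
      using powr_sum_additivity(2)[of J "\<lambda>j. (cmod (Y j x))\<^sup>2" q] fin q by (simp add: sq)
    finally show "(\<Sum>i\<in>I. (cmod (F i x))\<^sup>2) powr q \<le> (\<Sum>j\<in>J. cmod (Y j x) powr p)" .
  qed
  also have "\<dots> = (\<Sum>j\<in>J. LINT x|M. cmod (Y j x) powr p)"
    using Y by (subst Bochner_Integration.integral_sum) auto
  also have "\<dots> \<le> (\<Sum>j\<in>J. B j powr p)" by (intro sum_mono B)
  finally have "((\<Sum>i\<in>I. (LINT x|M. cmod (F i x) powr p) powr (1 / q)) powr q) powr (1 / q)
      \<le> (\<Sum>j\<in>J. B j powr p) powr (1 / q)"
    using q by (intro powr_mono2) auto
  then show ?thesis using True p q by (simp add: powr_powr sum_nonneg max_absorb2 min_absorb1 q_def)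
next
  case False
  define q where "q = p / 2"
  have q: "1 \<le> q" using False by (auto simp: q_def)
  have sq: "((cmod z)\<^sup>2) powr q = cmod z powr p" for z unfolding q_def by (rule square_powr_half)
  have Bq: "((B j)\<^sup>2) powr q = B j powr p" if "j \<in> J" for j
    using B(1)[OF that] by (simp add: q_def powr_powr flip: powr_numeral)
  have B2: "0 < (B j)\<^sup>2" if "j \<in> J" for j using B(1)[OF that] by simp
  note YI = integral_powr_sum_le[OF q fin(2), of "\<lambda>j x. (cmod (Y j x))\<^sup>2" M "\<lambda>j. (B j)\<^sup>2"]
  have "(\<Sum>i\<in>I. LINT x|M. cmod (F i x) powr p) = (LINT x|M. (\<Sum>i\<in>I. cmod (F i x) powr p))"
    using F by (subst Bochner_Integration.integral_sum) auto
  also have "\<dots> \<le> (LINT x|M. (\<Sum>j\<in>J. (cmod (Y j x))\<^sup>2) powr q)"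
  proof (rule integral_mono)
    show "integrable M (\<lambda>x. \<Sum>i\<in>I. cmod (F i x) powr p)" using F by auto
    show "integrable M (\<lambda>x. (\<Sum>j\<in>J. (cmod (Y j x))\<^sup>2) powr q)"
      using Y B Bq B2 by (intro YI) (auto simp: sq)
    fix x
    have "(\<Sum>i\<in>I. cmod (F i x) powr p) \<le> (\<Sum>i\<in>I. (cmod (F i x))\<^sup>2) powr q"
      using powr_sum_additivity(1)[of I "\<lambda>i. (cmod (F i x))\<^sup>2" q] fin q by (simp add: sq)
    also have "\<dots> \<le> (\<Sum>j\<in>J. (cmod (Y j x))\<^sup>2) powr q"
      using le q by (intro powr_mono2 sum_nonneg) auto
    finally show "(\<Sum>i\<in>I. cmod (F i x) powr p) \<le> (\<Sum>j\<in>J. (cmod (Y j x))\<^sup>2) powr q" .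
  qed
  also have "\<dots> \<le> (\<Sum>j\<in>J. (B j)\<^sup>2) powr q"
    using Y B Bq B2 by (intro YI) (auto simp: sq)
  finally have *: "(\<Sum>i\<in>I. LINT x|M. cmod (F i x) powr p) \<le> (\<Sum>j\<in>J. (B j)\<^sup>2) powr q" .
  have "(\<Sum>i\<in>I. (LINT x|M. cmod (F i x) powr p) powr (max p 2 / p)) = (\<Sum>i\<in>I. LINT x|M. cmod (F i x) powr p)"
    using False p by (intro sum.cong) (auto simp: max_absorb1 intro!: Bochner_Integration.integral_nonneg)
  moreover have "(\<Sum>j\<in>J. B j powr min p 2) = (\<Sum>j\<in>J. (B j)\<^sup>2)"
    using False B(1)[THEN less_imp_le] by (intro sum.cong) (auto simp: min_absorb2)
  ultimately show ?thesis using * False by (simp add: q_def max_absorb1 min_absorb2)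
qed

text \<open>Hoelder's inequality up to a constant: Young's inequality for \<open>A i\<close> and
  \<open>n i / t\<close>, with the coefficients \<open>1 / s\<close> and \<open>(s - 1) / s\<close>
  estimated by 1. The form suits a small \<open>t\<close> and a bracket that stays bounded.\<close>

lemma young_sum_bound:
  fixes A n :: "'i \<Rightarrow> real"
  assumes s: "1 < s" and A: "\<And>i. i \<in> I \<Longrightarrow> 0 \<le> A i" and n: "\<And>i. i \<in> I \<Longrightarrow> 0 \<le> n i"
    and fin: "finite I" and t: "0 \<le> t" "(\<Sum>i\<in>I. n i powr s) \<le> t powr s"
  shows "(\<Sum>i\<in>I. A i * n i) \<le> t * ((\<Sum>i\<in>I. A i powr (s / (s - 1))) + 1)"
proof (cases "t = 0")
  case True
  then have "(\<Sum>i\<in>I. n i powr s) = 0" using t(2) s by (intro antisym sum_nonneg) auto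
  then have "\<forall>i\<in>I. n i = 0" using fin by (subst (asm) sum_nonneg_eq_0_iff) auto
  then show ?thesis using True by simp
next
  case False
  then have t0: "0 < t" using t by simp
  have "(\<Sum>i\<in>I. A i * (n i / t)) \<le> (\<Sum>i\<in>I. A i powr (s / (s - 1)) + (n i / t) powr s)"
  proof (rule sum_mono)
    fix i assume i: "i \<in> I"
    have "A i * (n i / t) \<le> A i powr (s / (s - 1)) / (s / (s - 1)) + (n i / t) powr s / s"
      using s A n i t0 by (intro Youngs_inequality) (auto simp: field_simps)
    also have "\<dots> \<le> A i powr (s / (s - 1)) / 1 + (n i / t) powr s / 1"
      using s by (intro add_mono divide_left_mono) (auto simp: field_simps)
    finally show "A i * (n i / t) \<le> A i powr (s / (s - 1)) + (n i / t) powr s" by simp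
  qed
  also have "\<dots> \<le> (\<Sum>i\<in>I. A i powr (s / (s - 1))) + 1"
  proof -
    have "(\<Sum>i\<in>I. (n i / t) powr s) = (\<Sum>i\<in>I. n i powr s) / t powr s"
      unfolding sum_divide_distrib using n t0 by (intro sum.cong) (auto simp: powr_divide)
    also have "\<dots> \<le> 1" using t t0 by simp
    finally show ?thesis by (simp add: sum.distrib)
  qed
  finally have "t * (\<Sum>i\<in>I. A i * (n i / t)) \<le> t * ((\<Sum>i\<in>I. A i powr (s / (s - 1))) + 1)"
    using t0 by (intro mult_left_mono) auto
  then show ?thesis using t0 by (simp add: sum_distrib_left)
qed

section \<open>One-dimensional Hermite functions\<close>

text \<open>Merges the recursion for the indices 1 and above into one formula: at
  \<open>k = 0\<close> the truncated index \<open>k - 1\<close> comes with the factor 0.\<close>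

lemma hermite_polynomial_step:
  "hermite_polynomial (Suc k) x =
     2 * x * hermite_polynomial k x - 2 * real k * hermite_polynomial (k - 1) x"
  by (cases k) auto

lemma hermite_polynomial_deriv:
  "(hermite_polynomial k has_real_derivative 2 * real k * hermite_polynomial (k - 1) x) (at x)"
proof (induction k rule: induct_nat_012)
  case 0
  have "hermite_polynomial 0 = (\<lambda>x. 1)" by auto
  then show ?case by simp
next
  case 1
  have "hermite_polynomial (Suc 0) = (\<lambda>x. 2 * x)" by auto
  then show ?case by (auto intro!: derivative_eq_intros)
next
  case (ge2 k)
  have "hermite_polynomial (Suc (Suc k)) =
      (\<lambda>x. 2 * x * hermite_polynomial (Suc k) x - 2 * real (Suc k) * hermite_polynomial k x)"
    by auto
  then have "(hermite_polynomial (Suc (Suc k)) has_real_derivative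
      2 * hermite_polynomial (Suc k) x + 2 * x * (2 * real (Suc k) * hermite_polynomial k x)
      - 2 * real (Suc k) * (2 * real k * hermite_polynomial (k - 1) x)) (at x)"
    using ge2 by (auto intro!: derivative_eq_intros)
  also have "2 * hermite_polynomial (Suc k) x + 2 * x * (2 * real (Suc k) * hermite_polynomial k x)
      - 2 * real (Suc k) * (2 * real k * hermite_polynomial (k - 1) x)
      = 2 * real (Suc (Suc k)) * hermite_polynomial (Suc k) x"
    by (simp add: hermite_polynomial_step[of k x] algebra_simps)
  finally show ?case by simp
qed

lemma isCont_hermite_polynomial: "isCont (hermite_polynomial k) x"
  using hermite_polynomial_deriv by (rule DERIV_isCont)

lemma borel_measurable_hermite_polynomial [measurable]:
  "hermite_polynomial k \<in> borel_measurable borel"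
  by (intro borel_measurable_continuous_onI continuous_at_imp_continuous_on ballI
      isCont_hermite_polynomial)

text \<open>Absorbs a factor \<open>x\<close> at the price of an arbitrarily slow Gaussian growth.
  The constant makes both coefficients of \<open>(1 + 1 / d) * (1 + d * x\<^sup>2)\<close> at least
  1.\<close>

lemma abs_le_exp_square:
  fixes d x :: real
  assumes "0 < d"
  shows "\<bar>x\<bar> \<le> (1 + 1 / d) * exp (d * x\<^sup>2)"
proof -
  have "\<bar>x\<bar> \<le> 1 + x\<^sup>2"
    using sum_squares_bound[of 1 "\<bar>x\<bar>"] by simp
  also have "\<dots> \<le> (1 + 1 / d) * (1 + d * x\<^sup>2)"
    using assms by (simp add: field_simps)
  also have "\<dots> \<le> (1 + 1 / d) * exp (d * x\<^sup>2)"
    using assms by (intro mult_left_mono exp_ge_add_one_self) auto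
  finally show ?thesis .
qed

text \<open>The rate \<open>d\<close> varies in the induction because the recursion spends half of
  it on the factor \<open>x\<close>.\<close>

lemma hermite_polynomial_growth:
  assumes "0 < d"
  shows "\<exists>C\<ge>0. \<forall>x. \<bar>hermite_polynomial k x\<bar> \<le> C * exp (d * x\<^sup>2)"
  using assms
proof (induction k arbitrary: d rule: induct_nat_012)
  case 0
  then show ?case by (intro exI[of _ 1]) auto
next
  case 1
  define c where "c = 1 + 1 / d"
  have "\<bar>hermite_polynomial (Suc 0) x\<bar> \<le> 2 * c * exp (d * x\<^sup>2)" for x
    using abs_le_exp_square[OF 1, of x] unfolding c_def[symmetric] by (simp add: abs_mult)
  moreover have "0 \<le> c" using 1 by (simp add: c_def)
  ultimately show ?case by (intro exI[of _ "2 * c"]) auto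
next
  case (ge2 k d)
  obtain C1 where C1: "C1 \<ge> 0" "\<And>x. \<bar>hermite_polynomial (Suc k) x\<bar> \<le> C1 * exp (d / 2 * x\<^sup>2)"
    using ge2(2)[of "d / 2"] ge2(3) by auto
  obtain C2 where C2: "C2 \<ge> 0" "\<And>x. \<bar>hermite_polynomial k x\<bar> \<le> C2 * exp (d * x\<^sup>2)"
    using ge2(1)[of d] ge2(3) by auto
  let ?c = "1 + 1 / (d / 2)"
  have c: "0 \<le> ?c" using ge2(3) by simp
  have "\<bar>hermite_polynomial (Suc (Suc k)) x\<bar> \<le> (2 * ?c * C1 + 2 * real (Suc k) * C2) * exp (d * x\<^sup>2)" for x
  proof -
    have "\<bar>x\<bar> * \<bar>hermite_polynomial (Suc k) x\<bar> \<le> (?c * exp (d / 2 * x\<^sup>2)) * (C1 * exp (d / 2 * x\<^sup>2))"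
      using C1 abs_le_exp_square[of "d / 2" x] ge2(3) c by (intro mult_mono) auto
    also have "\<dots> = ?c * C1 * exp (d * x\<^sup>2)" by (simp add: exp_add[symmetric] field_simps)
    finally have a: "\<bar>x\<bar> * \<bar>hermite_polynomial (Suc k) x\<bar> \<le> ?c * C1 * exp (d * x\<^sup>2)" .
    have "\<bar>hermite_polynomial (Suc (Suc k)) x\<bar>
        \<le> 2 * (\<bar>x\<bar> * \<bar>hermite_polynomial (Suc k) x\<bar>) + 2 * real (Suc k) * \<bar>hermite_polynomial k x\<bar>"
      using abs_triangle_ineq4[of "2 * x * hermite_polynomial (Suc k) x" "2 * real (Suc k) * hermite_polynomial k x"]
      by (simp add: abs_mult)
    also have "\<dots> \<le> 2 * (?c * C1 * exp (d * x\<^sup>2)) + 2 * real (Suc k) * (C2 * exp (d * x\<^sup>2))"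
      using a C2(2)[of x] by (intro add_mono mult_left_mono) auto
    finally show ?thesis by (simp add: algebra_simps)
  qed
  then show ?case using c C1 C2
    by (intro exI[of _ "2 * ?c * C1 + 2 * real (Suc k) * C2"]) auto
qed

lemma integrable_gaussian:
  fixes c :: real
  assumes "0 < c"
  shows "integrable lborel (\<lambda>x. exp (- (c * x\<^sup>2)))"
proof -
  define \<sigma> where "\<sigma> = sqrt (1 / (2 * c))"
  have s: "\<sigma>\<^sup>2 = 1 / (2 * c)" "0 < \<sigma>" using assms by (auto simp: \<sigma>_def)
  have "exp (- (c * x\<^sup>2)) = sqrt (2 * pi * \<sigma>\<^sup>2) * normal_density 0 \<sigma> x" for x
    using s assms by (simp add: normal_density_def field_simps)
  then show ?thesis using integrable_normal_density[of \<sigma> 0] s by simp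
qed

lemma integral_gaussian: "(LINT x|lborel. exp (- (x\<^sup>2))) = sqrt pi"
proof -
  define \<sigma> :: real where "\<sigma> = sqrt (1 / 2)"
  have s: "\<sigma>\<^sup>2 = 1 / 2" "0 < \<sigma>" by (auto simp: \<sigma>_def)
  have "exp (- (x\<^sup>2)) = sqrt pi * normal_density 0 \<sigma> x" for x :: real
    using s by (simp add: normal_density_def field_simps)
  then show ?thesis using integral_normal_density[of \<sigma> 0] s by simp
qed

lemma hermite_product_bound:
  "\<exists>C\<ge>0. \<forall>x. \<bar>hermite_polynomial j x * hermite_polynomial k x * exp (- (x\<^sup>2))\<bar> \<le> C * exp (- (1/2 * x\<^sup>2))"
proof -
  obtain C where C: "C \<ge> 0" "\<And>x. \<bar>hermite_polynomial j x\<bar> \<le> C * exp (1/4 * x\<^sup>2)"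
    using hermite_polynomial_growth[of "1/4" j] by auto
  obtain D where D: "D \<ge> 0" "\<And>x. \<bar>hermite_polynomial k x\<bar> \<le> D * exp (1/4 * x\<^sup>2)"
    using hermite_polynomial_growth[of "1/4" k] by auto
  have "\<bar>hermite_polynomial j x * hermite_polynomial k x * exp (- (x\<^sup>2))\<bar> \<le> (C * D) * exp (- (1/2 * x\<^sup>2))" for x
  proof -
    have "\<bar>hermite_polynomial j x * hermite_polynomial k x * exp (- (x\<^sup>2))\<bar>
        \<le> (C * exp (1/4 * x\<^sup>2)) * (D * exp (1/4 * x\<^sup>2)) * exp (- (x\<^sup>2))"
      unfolding abs_mult using C D by (intro mult_mono) auto
    also have "\<dots> = (C * D) * (exp (1/4 * x\<^sup>2) * exp (1/4 * x\<^sup>2) * exp (- (x\<^sup>2)))" by simp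
    also have "exp (1/4 * x\<^sup>2) * exp (1/4 * x\<^sup>2) * exp (- (x\<^sup>2)) = exp (- (1/2 * x\<^sup>2))"
      unfolding exp_add[symmetric] by (simp add: field_simps)
    finally show ?thesis .
  qed
  then show ?thesis using C D by (intro exI[of _ "C * D"]) auto
qed

lemma hermite_product_integrable:
  "integrable lborel (\<lambda>x. hermite_polynomial j x * hermite_polynomial k x * exp (- (x\<^sup>2)))"
proof -
  obtain C where C: "\<And>x. \<bar>hermite_polynomial j x * hermite_polynomial k x * exp (- (x\<^sup>2))\<bar> \<le> C * exp (- (1/2 * x\<^sup>2))"
    using hermite_product_bound by blast
  show ?thesis
  proof (rule Bochner_Integration.integrable_bound)
    show "integrable lborel (\<lambda>x. C * exp (- (1/2 * x\<^sup>2)))"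
      by (intro Bochner_Integration.integrable_mult_right integrable_gaussian) auto
  qed (use C in \<open>auto intro!: AE_I2 order_trans[OF C]\<close>)
qed

text \<open>Integration by parts: \<open>hermite_polynomial (Suc k) x * exp (- (x\<^sup>2))\<close>
  is minus the derivative of \<open>hermite_polynomial k x * exp (- (x\<^sup>2))\<close>. The
  boundary term \<open>F\<close> tends to 0 in both directions by its Gaussian bound.\<close>

lemma hermite_product_parts:
  "(LINT x|lborel. hermite_polynomial j x * hermite_polynomial (Suc k) x * exp (- (x\<^sup>2))) =
   2 * real j * (LINT x|lborel. hermite_polynomial (j - 1) x * hermite_polynomial k x * exp (- (x\<^sup>2)))"
proof -
  define F where "F = (\<lambda>x. hermite_polynomial j x * hermite_polynomial k x * exp (- (x\<^sup>2)))"
  define f where "f = (\<lambda>x. 2 * real j * (hermite_polynomial (j - 1) x * hermite_polynomial k x * exp (- (x\<^sup>2)))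
      - hermite_polynomial j x * hermite_polynomial (Suc k) x * exp (- (x\<^sup>2)))"
  obtain C where C: "\<And>x. \<bar>F x\<bar> \<le> C * exp (- (1/2 * x\<^sup>2))"
    using hermite_product_bound unfolding F_def by blast
  have f_int: "integrable lborel f"
    unfolding f_def by (intro Bochner_Integration.integrable_diff Bochner_Integration.integrable_mult_right
        hermite_product_integrable)
  have "(LBINT x=-\<infinity>..\<infinity>. f x) = 0 - 0"
  proof (rule interval_integral_FTC_integrable)
    show "(F has_vector_derivative f x) (at x)" for x
      unfolding F_def f_def has_real_derivative_iff_has_vector_derivative[symmetric]
      by (auto intro!: derivative_eq_intros hermite_polynomial_deriv
          simp: hermite_polynomial_step[of k x] algebra_simps)
    show "isCont f x" for x
      unfolding f_def by (intro continuous_intros isCont_hermite_polynomial)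
    show "set_integrable lborel (einterval (-\<infinity>) \<infinity>) f"
      using f_int by (simp add: set_integrable_def)
    have lim: "((\<lambda>x. C * exp (- (1/2 * x\<^sup>2))) \<longlongrightarrow> 0) G" if "filterlim (\<lambda>x::real. x\<^sup>2) at_top G" for G
    proof -
      have "filterlim (\<lambda>x::real. 1/2 * x\<^sup>2) at_top G"
        using that by (intro filterlim_tendsto_pos_mult_at_top[of "\<lambda>_. 1/2" "1/2"]) auto
      then have "((\<lambda>x. exp (- (1/2 * x\<^sup>2))) \<longlongrightarrow> 0) G"
        by (intro filterlim_compose[OF exp_at_bot]) (simp add: filterlim_uminus_at_bot)
      then show ?thesis by (intro tendsto_mult_right_zero)
    qed
    have F0: "(F \<longlongrightarrow> 0) G" if "filterlim (\<lambda>x::real. x\<^sup>2) at_top G" for G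
      using C by (intro Lim_null_comparison[OF _ lim[OF that]]) auto
    have "(F \<longlongrightarrow> 0) at_bot"
      by (intro F0 filterlim_pow_at_bot_even filterlim_ident) auto
    then show "((F \<circ> real_of_ereal) \<longlongrightarrow> 0) (at_right (-\<infinity>))"
      by (simp add: ereal_tendsto_simps)
    have "(F \<longlongrightarrow> 0) at_top"
      by (intro F0 filterlim_pow_at_top filterlim_ident) auto
    then show "((F \<circ> real_of_ereal) \<longlongrightarrow> 0) (at_left \<infinity>)"
      by (simp add: ereal_tendsto_simps)
  qed simp
  then have "(LINT x|lborel. f x) = 0"
    by (simp add: interval_lebesgue_integral_def set_lebesgue_integral_def)
  moreover have "(LINT x|lborel. f x) =
      2 * real j * (LINT x|lborel. hermite_polynomial (j - 1) x * hermite_polynomial k x * exp (- (x\<^sup>2)))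
      - (LINT x|lborel. hermite_polynomial j x * hermite_polynomial (Suc k) x * exp (- (x\<^sup>2)))"
    unfolding f_def using hermite_product_integrable
    by (subst Bochner_Integration.integral_diff) (auto intro!: Bochner_Integration.integrable_mult_right)
  ultimately show ?thesis by simp
qed

text \<open>Integration by parts lowers both indices at once and yields the factor
  \<open>2 * real j\<close>. If one index reaches 0 before the other, this factor is 0; if both do
  together, the Gaussian integral remains.\<close>

lemma hermite_polynomial_orthogonal:
  "(LINT x|lborel. hermite_polynomial j x * hermite_polynomial k x * exp (- (x\<^sup>2))) =
   (if j = k then 2 ^ k * fact k * sqrt pi else 0)"
proof (induction k arbitrary: j)
  case 0
  show ?case
  proof (cases j)
    case 0
    then show ?thesis by (simp add: integral_gaussian)
  next
    case (Suc j')
    have "(LINT x|lborel. hermite_polynomial 0 x * hermite_polynomial (Suc j') x * exp (- (x\<^sup>2))) = 0"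
      by (subst hermite_product_parts) simp
    then show ?thesis using Suc by (simp add: mult.commute)
  qed
next
  case (Suc k)
  show ?case
  proof (cases j)
    case 0
    then show ?thesis by (subst hermite_product_parts) simp
  next
    case (Suc j')
    then show ?thesis
      by (subst hermite_product_parts) (simp add: Suc.IH)
  qed
qed

lemma hermite_function_1d_orthonormal:
  "(LINT x|lborel. hermite_function_1d j x * hermite_function_1d k x) = (if j = k then 1 else 0)"
  and hermite_function_1d_product_integrable:
  "integrable lborel (\<lambda>x. hermite_function_1d j x * hermite_function_1d k x)"
proof -
  define a where "a k = (2 ^ k * fact k * sqrt pi) powr (- (1 / 2))" for k :: nat
  have e: "exp (- (x\<^sup>2 / 2)) * exp (- (x\<^sup>2 / 2)) = exp (- (x\<^sup>2))" for x :: real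
    unfolding exp_add[symmetric] by simp
  have eq: "hermite_function_1d j x * hermite_function_1d k x =
      (a j * a k) * (hermite_polynomial j x * hermite_polynomial k x * exp (- (x\<^sup>2)))" for x
    unfolding hermite_function_1d_def a_def[symmetric] e[symmetric] by (simp add: mult_ac)
  have "K powr (- (1 / 2)) * K powr (- (1 / 2)) * K = 1" if "0 < K" for K :: real
    using that unfolding powr_add[symmetric] by (simp add: powr_minus)
  then have "a k * a k * (2 ^ k * fact k * sqrt pi) = 1" unfolding a_def by simp
  then show "(LINT x|lborel. hermite_function_1d j x * hermite_function_1d k x) = (if j = k then 1 else 0)"
    unfolding eq by (simp add: hermite_polynomial_orthogonal)
  show "integrable lborel (\<lambda>x. hermite_function_1d j x * hermite_function_1d k x)"
    unfolding eq by (intro Bochner_Integration.integrable_mult_right hermite_product_integrable)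
qed

lemma borel_measurable_hermite_function_1d [measurable]:
  "hermite_function_1d k \<in> borel_measurable borel"
  unfolding hermite_function_1d_def by measurable

lemma hermite_function_1d_bound:
  "\<exists>C\<ge>0. \<forall>x. \<bar>hermite_function_1d k x\<bar> \<le> C * exp (- (x\<^sup>2 / 4))"
proof -
  define a where "a = (2 ^ k * fact k * sqrt pi) powr (- (1 / 2))"
  obtain C where C: "C \<ge> 0" "\<And>x. \<bar>hermite_polynomial k x\<bar> \<le> C * exp (1/4 * x\<^sup>2)"
    using hermite_polynomial_growth[of "1/4" k] by auto
  have "\<bar>hermite_function_1d k x\<bar> \<le> (a * C) * exp (- (x\<^sup>2 / 4))" for x
  proof -
    have "\<bar>hermite_function_1d k x\<bar> = a * \<bar>hermite_polynomial k x\<bar> * exp (- (x\<^sup>2 / 2))"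
      by (simp add: hermite_function_1d_def a_def abs_mult)
    also have "\<dots> \<le> a * (C * exp (1/4 * x\<^sup>2)) * exp (- (x\<^sup>2 / 2))"
      using C by (intro mult_right_mono mult_left_mono) (auto simp: a_def)
    also have "\<dots> = (a * C) * (exp (1/4 * x\<^sup>2) * exp (- (x\<^sup>2 / 2)))" by simp
    also have "exp (1/4 * x\<^sup>2) * exp (- (x\<^sup>2 / 2)) = exp (- (x\<^sup>2 / 4))"
      unfolding exp_add[symmetric] by (simp add: field_simps)
    finally show ?thesis .
  qed
  then show ?thesis using C by (intro exI[of _ "a * C"]) (auto simp: a_def)
qed

text \<open>The source of the invariance of \<open>hermite_span\<close> under multiplication by
  coordinates. At \<open>k = 0\<close> the coefficient of the function with index
  \<open>k - 1\<close> is 0.\<close>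

lemma hermite_function_1d_mult_x:
  "\<exists>a b. \<forall>x. x * hermite_function_1d k x = a * hermite_function_1d (Suc k) x + b * hermite_function_1d (k - 1) x"
proof -
  define a where "a k = (2 ^ k * fact k * sqrt pi) powr (- (1 / 2))" for k :: nat
  have a: "a k \<noteq> 0" for k by (simp add: a_def)
  have "x * hermite_function_1d k x = (a k / (2 * a (Suc k))) * hermite_function_1d (Suc k) x
      + (a k * real k / a (k - 1)) * hermite_function_1d (k - 1) x" for x
    unfolding hermite_function_1d_def a_def[symmetric] hermite_polynomial_step[of k x]
    using a[of "Suc k"] a[of "k - 1"] by (simp add: field_simps)
  then show ?thesis by blast
qed

section \<open>Hermite functions on \<open>n\<close>-space\<close>

text \<open>\<open>lborel\<close> is a product over \<open>Basis\<close>, whereas the Hermite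
  functions are products over coordinates; \<open>axis\<close> matches the two index sets.\<close>

lemma prod_vec_eq:
  fixes f :: "'n::finite \<Rightarrow> real \<Rightarrow> real" and x :: "real ^ 'n"
  shows "(\<Prod>j\<in>UNIV. f j (x $ j)) = (\<Prod>b\<in>Basis. f (THE j. b = axis j 1) (x \<bullet> b))"
proof -
  have the: "(THE j. axis i (1::real) = axis j 1) = i" for i :: 'n
    by (auto simp: axis_eq_axis)
  have "(\<Prod>b\<in>range (\<lambda>j. axis j (1::real)). f (THE j. b = axis j 1) (x \<bullet> b))
      = (\<Prod>j\<in>UNIV. f j (x $ j))"
    by (subst prod.reindex) (auto simp: inj_on_def axis_eq_axis the cart_eq_inner_axis)
  then show ?thesis by (simp add: Basis_vec_def UNION_singleton_eq_range)
qed

text \<open>Fubini, by writing \<open>lborel\<close> as the image of the product measure over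
  \<open>Basis\<close> under the map that assembles a vector from its coordinates.\<close>

lemma
  fixes f :: "'n::finite \<Rightarrow> real \<Rightarrow> real"
  assumes f: "\<And>j. integrable lborel (f j)"
  shows integrable_prod_vec: "integrable lborel (\<lambda>x::real^'n. \<Prod>j\<in>UNIV. f j (x $ j))"
    and integral_prod_vec:
      "(LINT x|(lborel::(real^'n) measure). (\<Prod>j\<in>UNIV. f j (x $ j))) = (\<Prod>j\<in>UNIV. LINT x|lborel. f j x)"
proof -
  define g where "g b = f (THE j. b = axis j 1)" for b :: "real ^ 'n"
  interpret product_sigma_finite "\<lambda>_::real^'n. lborel :: real measure" by standard
  have g: "integrable lborel (g b)" for b unfolding g_def by (rule f)
  have gm: "g b \<in> borel_measurable borel" for b using g[of b] by auto
  let ?P = "\<Pi>\<^sub>M b\<in>(Basis::(real^'n) set). (lborel::real measure)"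
  let ?T = "\<lambda>y. \<Sum>b\<in>(Basis::(real^'n) set). y b *\<^sub>R b"
  have T: "?T \<in> measurable ?P borel" by measurable
  have eq: "(\<Prod>j\<in>UNIV. f j (x $ j)) = (\<Prod>b\<in>Basis. g b (x \<bullet> b))" for x :: "real ^ 'n"
    unfolding g_def by (rule prod_vec_eq)
  have meas: "(\<lambda>x::real^'n. \<Prod>b\<in>Basis. g b (x \<bullet> b)) \<in> borel_measurable borel"
    using gm by (intro borel_measurable_prod measurable_compose[OF _ gm]) auto
  have eqT: "(\<Prod>b\<in>Basis. g b (?T y \<bullet> b)) = (\<Prod>b\<in>Basis. g b (y b))" for y
    by (intro prod.cong refl) (simp add: inner_sum_left inner_Basis if_distrib cong: if_cong)
  have P: "integrable ?P (\<lambda>y. \<Prod>b\<in>Basis. g b (y b))"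
    using g by (intro product_integrable_prod) auto
  show "integrable lborel (\<lambda>x::real^'n. \<Prod>j\<in>UNIV. f j (x $ j))"
    unfolding eq lborel_eq[where 'a = "real^'n"] using P eqT
    by (subst integrable_distr_eq[OF T meas]) simp
  have "(LINT x|(lborel::(real^'n) measure). (\<Prod>b\<in>Basis. g b (x \<bullet> b))) = (LINT y|?P. (\<Prod>b\<in>Basis. g b (y b)))"
    unfolding lborel_eq[where 'a = "real^'n"] by (subst integral_distr[OF T meas]) (simp add: eqT)
  also have "\<dots> = (\<Prod>b\<in>Basis. LINT x|lborel. g b x)"
    using g by (intro product_integral_prod) auto
  also have "\<dots> = (\<Prod>j\<in>UNIV. LINT x|lborel. f j x)"
    using prod_vec_eq[of "\<lambda>j _. LINT x|lborel. f j x" 0] by (simp add: g_def)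
  finally show "(LINT x|(lborel::(real^'n) measure). (\<Prod>j\<in>UNIV. f j (x $ j))) = (\<Prod>j\<in>UNIV. LINT x|lborel. f j x)"
    unfolding eq .
qed

section \<open>Gaussians and the linear span of the Hermite functions\<close>

definition gauss :: "real \<Rightarrow> real ^ 'n \<Rightarrow> real" where
  "gauss c x = exp (- (c * (norm x)\<^sup>2))"

lemma gauss_pos: "0 < gauss c x"
  by (simp add: gauss_def)

lemma gauss_le_1: "0 \<le> c \<Longrightarrow> gauss c x \<le> 1"
  by (simp add: gauss_def)

lemma gauss_half_le: "gauss (1/2) x \<le> gauss (1/4) x"
  by (simp add: gauss_def)

lemma borel_measurable_gauss [measurable]: "gauss c \<in> borel_measurable borel"
  unfolding gauss_def by measurable

lemma norm_square_vec: "(norm (x :: real ^ 'n))\<^sup>2 = (\<Sum>j\<in>UNIV. (x $ j)\<^sup>2)"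
  by (simp add: norm_vec_def L2_set_def sum_nonneg)

lemma gauss_prod: "gauss c (x :: real ^ 'n) = (\<Prod>j\<in>UNIV. exp (- (c * (x $ j)\<^sup>2)))"
  by (simp add: gauss_def norm_square_vec exp_sum[symmetric] sum_negf sum_distrib_left)

lemma integrable_gauss: "0 < c \<Longrightarrow> integrable lborel (gauss c :: real ^ 'n \<Rightarrow> real)"
  unfolding gauss_prod by (intro integrable_prod_vec integrable_gaussian)

lemma hermite_function_orthonormal:
  fixes \<mu> \<nu> :: "nat ^ 'n"
  shows
  "(LINT x|lborel. hermite_function \<mu> x * hermite_function \<nu> x) = (if \<mu> = \<nu> then 1 else 0)"
proof -
  let ?f = "\<lambda>j x. hermite_function_1d (\<mu> $ j) x * hermite_function_1d (\<nu> $ j) x"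
  have eq: "hermite_function \<mu> x * hermite_function \<nu> x = (\<Prod>j\<in>UNIV. ?f j (x $ j))" for x
    by (simp add: hermite_function_def prod.distrib)
  have "(\<Prod>j\<in>UNIV. LINT x|lborel. ?f j x) = (\<Prod>j\<in>UNIV. if \<mu> $ j = \<nu> $ j then 1 else 0)"
    by (simp add: hermite_function_1d_orthonormal)
  also have "\<dots> = (if \<mu> = \<nu> then 1 else 0)"
  proof (cases "\<mu> = \<nu>")
    case False
    then obtain j where "\<mu> $ j \<noteq> \<nu> $ j" by (auto simp: vec_eq_iff)
    then have "(\<Prod>j\<in>UNIV. if \<mu> $ j = \<nu> $ j then 1 else (0::real)) = 0"
      by (intro prod_zero) auto
    then show ?thesis using False by simp
  qed simp
  finally show "(LINT x|lborel. hermite_function \<mu> x * hermite_function \<nu> x) = (if \<mu> = \<nu> then 1 else 0)"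
    unfolding eq by (subst integral_prod_vec) (simp_all add: hermite_function_1d_product_integrable)
qed

lemma borel_measurable_hermite_function [measurable]:
  "hermite_function \<nu> \<in> borel_measurable (borel :: (real ^ 'n) measure)"
  unfolding hermite_function_def
  by (intro borel_measurable_prod measurable_compose[OF _ borel_measurable_hermite_function_1d]) simp

lemma hermite_function_bound:
  "\<exists>C\<ge>0. \<forall>x::real^'n. \<bar>hermite_function \<nu> x\<bar> \<le> C * gauss (1/4) x"
proof -
  have "\<forall>j. \<exists>C\<ge>0. \<forall>x. \<bar>hermite_function_1d (\<nu> $ j) x\<bar> \<le> C * exp (- (1/4 * x\<^sup>2))"
    using hermite_function_1d_bound by simp
  then obtain C where C: "\<And>j. C j \<ge> 0" "\<And>j x. \<bar>hermite_function_1d (\<nu> $ j) x\<bar> \<le> C j * exp (- (1/4 * x\<^sup>2))"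
    by metis
  have "\<bar>hermite_function \<nu> x\<bar> \<le> (\<Prod>j\<in>UNIV. C j) * gauss (1/4) x" for x :: "real ^ 'n"
    unfolding hermite_function_def gauss_prod prod.distrib[symmetric] abs_prod
    using C by (intro prod_mono) auto
  then show ?thesis using C by (intro exI[of _ "\<Prod>j\<in>UNIV. C j"]) (auto intro: prod_nonneg)
qed

lemma hermite_spanI: "(\<lambda>x. complex_of_real (hermite_function \<nu> x)) \<in> hermite_span"
  unfolding hermite_span_def by (intro CollectI exI[of _ "{\<nu>}"] exI[of _ "\<lambda>_. 1"]) auto

lemma hermite_span_scale: "f \<in> hermite_span \<Longrightarrow> (\<lambda>x. c * f x) \<in> hermite_span"
  unfolding hermite_span_def
proof clarify
  fix A a assume "finite (A :: (nat ^ 'n) set)"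
  then show "\<exists>A' a'. finite A' \<and> (\<lambda>x. c * (\<Sum>\<nu>\<in>A. a \<nu> * complex_of_real (hermite_function \<nu> x)))
      = (\<lambda>x. \<Sum>\<nu>\<in>A'. a' \<nu> * complex_of_real (hermite_function \<nu> x))"
    by (intro exI[of _ A] exI[of _ "\<lambda>\<nu>. c * a \<nu>"]) (auto simp: sum_distrib_left mult.assoc)
qed

lemma hermite_span_add:
  assumes "f \<in> hermite_span" "g \<in> hermite_span"
  shows "(\<lambda>x. f x + g x) \<in> hermite_span"
proof -
  obtain A a where A: "finite A" "f = (\<lambda>x. \<Sum>\<nu>\<in>A. a \<nu> * complex_of_real (hermite_function \<nu> x))"
    using assms(1) by (auto simp: hermite_span_def)
  obtain B b where B: "finite B" "g = (\<lambda>x. \<Sum>\<nu>\<in>B. b \<nu> * complex_of_real (hermite_function \<nu> x))"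
    using assms(2) by (auto simp: hermite_span_def)
  let ?c = "\<lambda>\<nu>. (if \<nu> \<in> A then a \<nu> else 0) + (if \<nu> \<in> B then b \<nu> else 0)"
  have "f x + g x = (\<Sum>\<nu>\<in>A \<union> B. ?c \<nu> * complex_of_real (hermite_function \<nu> x))" for x
  proof -
    have "f x = (\<Sum>\<nu>\<in>A \<union> B. (if \<nu> \<in> A then a \<nu> else 0) * complex_of_real (hermite_function \<nu> x))"
      unfolding A using A B by (intro sum.mono_neutral_cong_left) auto
    moreover have "g x = (\<Sum>\<nu>\<in>A \<union> B. (if \<nu> \<in> B then b \<nu> else 0) * complex_of_real (hermite_function \<nu> x))"
      unfolding B using A B by (intro sum.mono_neutral_cong_left) auto
    ultimately show ?thesis by (simp add: sum.distrib distrib_right)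
  qed
  then show ?thesis
    unfolding hermite_span_def using A B by (intro CollectI exI[of _ "A \<union> B"] exI[of _ ?c]) auto
qed

lemma hermite_span_zero: "(\<lambda>x. 0) \<in> hermite_span"
  using hermite_span_scale[OF hermite_spanI, of 0] by simp

lemma hermite_span_sum:
  assumes "finite K" "\<And>k. k \<in> K \<Longrightarrow> f k \<in> hermite_span"
  shows "(\<lambda>x. \<Sum>k\<in>K. c k * f k x) \<in> hermite_span"
  using assms
proof (induction K rule: finite_induct)
  case (insert k K)
  then show ?case using hermite_span_add[OF hermite_span_scale[of "f k" "c k"]] by simp
qed (simp add: hermite_span_zero)

lemma hermite_span_mult_coord:
  fixes f :: "real ^ 'n \<Rightarrow> complex" and j :: 'n
  assumes "f \<in> hermite_span"
  shows "(\<lambda>x. complex_of_real (x $ j) * f x) \<in> hermite_span"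
proof -
  define up :: "nat ^ 'n \<Rightarrow> nat \<Rightarrow> nat ^ 'n" where "up = (\<lambda>\<nu> k. \<chi> i. if i = j then k else \<nu> $ i)"
  have split: "hermite_function (up \<nu> k) x = hermite_function_1d k (x $ j) *
      (\<Prod>i\<in>UNIV - {j}. hermite_function_1d (\<nu> $ i) (x $ i))" for \<nu> k x
    unfolding hermite_function_def by (subst prod.remove[of _ j]) (auto simp: up_def intro!: prod.cong)
  have basic: "(\<lambda>x. complex_of_real (x $ j) * complex_of_real (hermite_function \<nu> x)) \<in> hermite_span" for \<nu>
  proof -
    obtain a b where ab: "\<And>y. y * hermite_function_1d (\<nu> $ j) y =
        a * hermite_function_1d (Suc (\<nu> $ j)) y + b * hermite_function_1d (\<nu> $ j - 1) y"
      using hermite_function_1d_mult_x by blast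
    have "up \<nu> (\<nu> $ j) = \<nu>" by (auto simp: up_def vec_eq_iff)
    then have "x $ j * hermite_function \<nu> x =
        a * hermite_function (up \<nu> (Suc (\<nu> $ j))) x + b * hermite_function (up \<nu> (\<nu> $ j - 1)) x" for x
      using split[of \<nu> "\<nu> $ j" x] ab[of "x $ j"] split[of \<nu> "Suc (\<nu> $ j)" x] split[of \<nu> "\<nu> $ j - 1" x]
      by (metis (no_types, lifting) distrib_right mult.assoc)
    then have "complex_of_real (x $ j) * complex_of_real (hermite_function \<nu> x) =
        complex_of_real a * complex_of_real (hermite_function (up \<nu> (Suc (\<nu> $ j))) x)
        + complex_of_real b * complex_of_real (hermite_function (up \<nu> (\<nu> $ j - 1)) x)" for x
      by (simp flip: of_real_mult of_real_add)
    then show ?thesis by (simp add: hermite_span_add hermite_span_scale hermite_spanI)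
  qed
  obtain A a where A: "finite A" "f = (\<lambda>x. \<Sum>\<nu>\<in>A. a \<nu> * complex_of_real (hermite_function \<nu> x))"
    using assms by (auto simp: hermite_span_def)
  have "(\<lambda>x. \<Sum>\<nu>\<in>A. a \<nu> * (complex_of_real (x $ j) * complex_of_real (hermite_function \<nu> x))) \<in> hermite_span"
    by (intro hermite_span_sum A basic)
  then show ?thesis unfolding A by (simp add: sum_distrib_left mult_ac)
qed

lemma hermite_span_mult_inner:
  assumes "f \<in> hermite_span"
  shows "(\<lambda>x. complex_of_real (t \<bullet> x) * f x) \<in> hermite_span"
proof -
  have "(\<lambda>x. \<Sum>j\<in>UNIV. complex_of_real (t $ j) * (complex_of_real (x $ j) * f x)) \<in> hermite_span"
    using assms by (intro hermite_span_sum hermite_span_mult_coord) auto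
  then show ?thesis by (simp add: inner_vec_def sum_distrib_right mult.assoc)
qed

lemma gauss_in_hermite_span: "(\<lambda>x::real^'n. complex_of_real (gauss (1/2) x)) \<in> hermite_span"
proof -
  define c where "c = (\<Prod>j\<in>(UNIV::'n set). (sqrt pi) powr (- (1 / 2)))"
  have c: "c \<noteq> 0" by (simp add: c_def)
  have "hermite_function 0 x = c * gauss (1/2) x" for x :: "real ^ 'n"
    by (simp add: hermite_function_def hermite_function_1d_def gauss_prod c_def prod.distrib)
  then have "(\<lambda>x::real^'n. complex_of_real (gauss (1/2) x)) =
      (\<lambda>x. complex_of_real (1 / c) * complex_of_real (hermite_function 0 x))"
    using c by auto
  then show ?thesis by (simp only: hermite_span_scale hermite_spanI)
qed

lemma hermite_span_power_gauss:
  "(\<lambda>x. complex_of_real (t \<bullet> x) ^ k * complex_of_real (gauss (1/2) x)) \<in> hermite_span"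
proof (induction k)
  case (Suc k)
  then show ?case using hermite_span_mult_inner[OF Suc, of t] by (simp add: mult.assoc)
qed (simp add: gauss_in_hermite_span)

section \<open>Classes closed under Gaussian-dominated limits\<close>

lemma sgn_sin:
  assumes "\<bar>y\<bar> < pi"
  shows "sgn (sin y) = sgn (y :: real)"
proof (cases y "0::real" rule: linorder_cases)
  case less
  then show ?thesis using assms sin_gt_zero[of "- y"] by simp
next
  case greater
  then show ?thesis using assms sin_gt_zero[of y] by simp
qed simp

text \<open>Serves two classes: the L^p closure of the span, for density, and the functions whose
  product with a fixed \<open>f\<close> has integral 0, for injectivity. Dominated convergence gives
  \<open>lim\<close> in both. The Hermite functions decay like \<open>gauss (1/2)\<close> up to
  polynomials; requiring only the wider \<open>gauss (1/4)\<close> as a bound leaves room for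
  exponential factors.\<close>

locale gauss_closed =
  fixes C :: "(real ^ 'n \<Rightarrow> complex) set"
  assumes span: "hermite_span \<subseteq> C"
    and add: "\<And>f g. f \<in> C \<Longrightarrow> g \<in> C \<Longrightarrow> (\<lambda>x. f x + g x) \<in> C"
    and scale: "\<And>f c. f \<in> C \<Longrightarrow> (\<lambda>x. c * f x) \<in> C"
    and lim: "\<And>h f K. (\<And>k. h k \<in> C) \<Longrightarrow> (\<And>k x. cmod (h k x) \<le> K * gauss (1/4) x) \<Longrightarrow>
      (\<And>x. (\<lambda>k::nat. h k x) \<longlonglongrightarrow> f x) \<Longrightarrow> f \<in> C"
begin

definition char_fun :: "real ^ 'n \<Rightarrow> real ^ 'n \<Rightarrow> complex" where
  "char_fun t x = exp (\<i> * complex_of_real (t \<bullet> x))"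

lemma char_fun_add: "char_fun (s + t) x = char_fun s x * char_fun t x"
  by (simp add: char_fun_def exp_add[symmetric] inner_add_left distrib_left)

lemma norm_char_fun [simp]: "cmod (char_fun t x) = 1"
  by (simp add: char_fun_def)

lemma char_fun_gauss: "(\<lambda>x. char_fun t x * complex_of_real (gauss (1/2) x)) \<in> C"
proof (rule lim)
  let ?h = "\<lambda>k x. (\<Sum>i<k. (\<i> ^ i / fact i) * (complex_of_real (t \<bullet> x) ^ i * complex_of_real (gauss (1/2) x)))"
  show "?h k \<in> C" for k
  proof -
    have "?h k \<in> hermite_span" by (intro hermite_span_sum hermite_span_power_gauss) auto
    then show ?thesis using span by blast
  qed
  have eq: "?h k x = (\<Sum>i<k. (\<i> * complex_of_real (t \<bullet> x)) ^ i / fact i) * complex_of_real (gauss (1/2) x)" for k x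
    by (simp add: sum_distrib_left sum_distrib_right power_mult_distrib mult_ac)
  show "(\<lambda>k. ?h k x) \<longlonglongrightarrow> char_fun t x * complex_of_real (gauss (1/2) x)" for x
  proof -
    have "(\<lambda>i. (\<i> * complex_of_real (t \<bullet> x)) ^ i / fact i) sums char_fun t x"
      unfolding char_fun_def using exp_converges[of "\<i> * complex_of_real (t \<bullet> x)"]
      by (simp add: scaleR_conv_of_real field_simps)
    then show ?thesis unfolding eq sums_def by (intro tendsto_intros)
  qed
  \<comment> \<open>The Taylor sums are bounded by \<open>exp \<bar>t \<bullet> x\<bar>\<close>, and
    \<open>\<bar>t \<bullet> x\<bar> \<le> (norm t)\<^sup>2 + (norm x)\<^sup>2 / 4\<close>: this
    uses up half of the exponent of \<open>gauss (1/2)\<close> and leaves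
    \<open>gauss (1/4)\<close>.\<close>
  show "cmod (?h k x) \<le> exp ((norm t)\<^sup>2) * gauss (1/4) x" for k x
  proof -
    have "cmod (\<Sum>i<k. (\<i> * complex_of_real (t \<bullet> x)) ^ i / fact i) \<le> (\<Sum>i<k. \<bar>t \<bullet> x\<bar> ^ i /\<^sub>R fact i)"
      by (intro sum_norm_le) (simp add: norm_mult norm_power norm_divide field_simps)
    also have "\<dots> \<le> exp \<bar>t \<bullet> x\<bar>"
      unfolding exp_def by (intro sum_le_suminf summable_exp_generic) auto
    also have "\<dots> \<le> exp ((norm t)\<^sup>2 + (norm x)\<^sup>2 / 4)"
    proof -
      have "\<bar>t \<bullet> x\<bar> \<le> norm t * norm x" by (rule Cauchy_Schwarz_ineq2)
      also have "\<dots> \<le> (norm t)\<^sup>2 + (norm x)\<^sup>2 / 4"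
        using sum_squares_bound[of "norm t" "norm x / 2"] by (simp add: power_divide)
      finally show ?thesis by simp
    qed
    finally have "cmod (\<Sum>i<k. (\<i> * complex_of_real (t \<bullet> x)) ^ i / fact i) * gauss (1/2) x
        \<le> exp ((norm t)\<^sup>2 + (norm x)\<^sup>2 / 4) * gauss (1/2) x"
      by (intro mult_right_mono) (auto simp: gauss_pos less_imp_le)
    also have "\<dots> = exp ((norm t)\<^sup>2) * gauss (1/4) x"
      by (simp add: gauss_def exp_add[symmetric])
    finally show ?thesis unfolding eq by (simp add: norm_mult gauss_pos less_imp_le)
  qed
qed

text \<open>Factors that may multiply the Gaussian. Demanding membership for every character makes
  the class stable under characters, hence under sines; boundedness supplies the domination in
  \<open>lim\<close>.\<close>

definition tame :: "(real ^ 'n \<Rightarrow> complex) set" where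
  "tame = {g. (\<exists>K. \<forall>x. cmod (g x) \<le> K) \<and>
        (\<forall>t. (\<lambda>x. char_fun t x * g x * complex_of_real (gauss (1/2) x)) \<in> C)}"

lemma tame_one: "(\<lambda>x. 1) \<in> tame"
  using char_fun_gauss by (auto simp: tame_def)

lemma tame_add: assumes "f \<in> tame" "g \<in> tame" shows "(\<lambda>x. f x + g x) \<in> tame"
proof -
  obtain K L where "\<And>x. cmod (f x) \<le> K" "\<And>x. cmod (g x) \<le> L" using assms by (auto simp: tame_def)
  then have "cmod (f x + g x) \<le> K + L" for x
    using norm_triangle_ineq[of "f x" "g x"] by (meson add_mono order_trans)
  moreover have "(\<lambda>x. char_fun t x * f x * complex_of_real (gauss (1/2) x)
      + char_fun t x * g x * complex_of_real (gauss (1/2) x)) \<in> C" for t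
    using assms by (intro add) (auto simp: tame_def)
  ultimately show ?thesis by (auto simp: tame_def distrib_left distrib_right)
qed

lemma tame_scale: assumes "f \<in> tame" shows "(\<lambda>x. c * f x) \<in> tame"
proof -
  obtain K where "\<And>x. cmod (f x) \<le> K" using assms by (auto simp: tame_def)
  then have "cmod (c * f x) \<le> cmod c * K" for x
    by (simp add: norm_mult mult_left_mono)
  moreover have "(\<lambda>x. c * (char_fun t x * f x * complex_of_real (gauss (1/2) x))) \<in> C" for t
    using assms by (intro scale) (auto simp: tame_def)
  ultimately show ?thesis by (auto simp: tame_def mult_ac)
qed

lemma tame_diff: "f \<in> tame \<Longrightarrow> g \<in> tame \<Longrightarrow> (\<lambda>x. f x - g x) \<in> tame"
  using tame_add[of f "\<lambda>x. - 1 * g x"] tame_scale[of g "- 1"] by simp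

lemma tame_sum:
  assumes "finite I" "\<And>i. i \<in> I \<Longrightarrow> f i \<in> tame"
  shows "(\<lambda>x. \<Sum>i\<in>I. f i x) \<in> tame"
  using assms
proof (induction I rule: finite_induct)
  case empty
  then show ?case using tame_scale[OF tame_one, of 0] by simp
qed (auto intro: tame_add)

lemma tame_char: "f \<in> tame \<Longrightarrow> (\<lambda>x. char_fun s x * f x) \<in> tame"
proof -
  assume f: "f \<in> tame"
  have "(\<lambda>x. char_fun (t + s) x * f x * complex_of_real (gauss (1/2) x)) \<in> C" for t
    using f by (auto simp: tame_def)
  then show ?thesis using f by (auto simp: tame_def char_fun_add norm_mult mult.assoc)
qed

lemma tame_lim:
  assumes h: "\<And>k. h k \<in> tame" "\<And>k x. cmod (h k x) \<le> K" "\<And>x. (\<lambda>k::nat. h k x) \<longlonglongrightarrow> f x"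
  shows "f \<in> tame"
proof -
  have "cmod (f x) \<le> K" for x
    using h(2) by (intro Lim_norm_ubound[OF _ h(3)]) auto
  moreover have "(\<lambda>x. char_fun t x * f x * complex_of_real (gauss (1/2) x)) \<in> C" for t
  proof (rule lim)
    show "(\<lambda>x. char_fun t x * h k x * complex_of_real (gauss (1/2) x)) \<in> C" for k
      using h(1) by (auto simp: tame_def)
    show "(\<lambda>k. char_fun t x * h k x * complex_of_real (gauss (1/2) x))
        \<longlonglongrightarrow> char_fun t x * f x * complex_of_real (gauss (1/2) x)" for x
      by (intro tendsto_intros h)
    show "cmod (char_fun t x * h k x * complex_of_real (gauss (1/2) x)) \<le> K * gauss (1/4) x" for k x
    proof -
      have "0 \<le> K" using h(2) norm_ge_zero order_trans by blast
      then show ?thesis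
        using mult_mono[OF h(2)[of k x] gauss_half_le[of x]] by (simp add: norm_mult gauss_pos less_imp_le)
    qed
  qed
  ultimately show ?thesis by (auto simp: tame_def)
qed

text \<open>Euler's formula: the sine is a combination of the characters for \<open>s\<close> and
  \<open>- s\<close>, with the phase \<open>c\<close> in the coefficients.\<close>

lemma tame_sin: assumes f: "f \<in> tame" shows "(\<lambda>x. complex_of_real (sin (s \<bullet> x + c)) * f x) \<in> tame"
proof -
  have eq: "complex_of_real (sin (s \<bullet> x + c)) * f x =
      (exp (\<i> * c) / (2 * \<i>)) * (char_fun s x * f x) - (exp (- (\<i> * c)) / (2 * \<i>)) * (char_fun (- s) x * f x)" for x
  proof -
    have "complex_of_real (sin (s \<bullet> x + c)) = sin (complex_of_real (s \<bullet> x + c))"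
      by (rule sin_of_real[symmetric])
    also have "\<dots> = (exp (\<i> * (complex_of_real (s \<bullet> x + c))) - exp (- (\<i> * complex_of_real (s \<bullet> x + c)))) / (2 * \<i>)"
      by (rule sin_exp_eq)
    also have "exp (\<i> * complex_of_real (s \<bullet> x + c)) = exp (\<i> * c) * char_fun s x"
      by (simp add: char_fun_def exp_add[symmetric] algebra_simps)
    also have "exp (- (\<i> * complex_of_real (s \<bullet> x + c))) = exp (- (\<i> * c)) * char_fun (- s) x"
      by (simp add: char_fun_def exp_add[symmetric] algebra_simps)
    finally have e: "complex_of_real (sin (s \<bullet> x + c)) = (exp (\<i> * c) * char_fun s x - exp (- (\<i> * c)) * char_fun (- s) x) / (2 * \<i>)" .
    show ?thesis unfolding e by (simp add: algebra_simps diff_divide_distrib)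
  qed
  show ?thesis unfolding eq by (intro tame_diff tame_scale tame_char f)
qed

text \<open>The induction runs over all tame \<open>f\<close>, so that a product of polynomials is
  treated by applying one factor after the other.\<close>

lemma tame_poly_sin:
  assumes p: "real_polynomial_function p" and f: "f \<in> tame"
  shows "(\<lambda>x. complex_of_real (p (sin (s \<bullet> x + c))) * f x) \<in> tame"
  using p f
proof (induction p arbitrary: f rule: real_polynomial_function.induct)
  case (linear g)
  have "g u = g 1 * u" for u
    using linear_cmul[OF bounded_linear.linear[OF linear(1)], of u 1] by (simp add: mult.commute)
  then have "(\<lambda>x. complex_of_real (g (sin (s \<bullet> x + c))) * f x)
      = (\<lambda>x. complex_of_real (g 1) * (complex_of_real (sin (s \<bullet> x + c)) * f x))"
    by (metis (no_types) mult.assoc of_real_mult)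
  then show ?case using tame_scale[OF tame_sin[OF linear(2)]] by simp
next
  case (const k)
  then show ?case by (intro tame_scale)
next
  case (add g h)
  then show ?case using tame_add[OF add.IH(1) add.IH(2)] by (simp add: distrib_right)
next
  case (mult g h)
  then show ?case using mult.IH(1)[OF mult.IH(2)] by (simp add: mult.assoc)
qed

lemma tame_sgn_sin:
  assumes f: "f \<in> tame"
  shows "(\<lambda>x. complex_of_real (sgn (sin (s \<bullet> x + c))) * f x) \<in> tame"
proof -
  \<comment> \<open>A continuous substitute for \<open>sgn\<close>, linear near 0 and equal to it
    elsewhere. A polynomial within \<open>1 / Suc k\<close> of \<open>w k\<close> on [-1, 1] has the
    same pointwise limit and is bounded by 2.\<close>
  define w :: "nat \<Rightarrow> real \<Rightarrow> real" where "w = (\<lambda>k u. max (- 1) (min 1 (real k * u)))"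
  have "\<exists>p. real_polynomial_function p \<and> (\<forall>u\<in>{- 1..1}. \<bar>w k u - p u\<bar> < 1 / Suc k)" for k
  proof -
    have "continuous_on {- 1..1} (w k)" unfolding w_def by (intro continuous_intros)
    from Stone_Weierstrass_real_polynomial_function[OF compact_Icc this, of "1 / Suc k"]
    show ?thesis by (metis divide_pos_pos of_nat_0_less_iff zero_less_Suc zero_less_one)
  qed
  then obtain p where p: "\<And>k. real_polynomial_function (p k)"
    "\<And>k u. u \<in> {- 1..1} \<Longrightarrow> \<bar>w k u - p k u\<bar> < 1 / Suc k" by metis
  have w_lim: "(\<lambda>k. w k u) \<longlonglongrightarrow> sgn u" for u
  proof (cases "u = 0")
    case False
    obtain N where N: "1 \<le> real N * \<bar>u\<bar>"
      using reals_Archimedean3[of "\<bar>u\<bar>"] False by (metis less_imp_le zero_less_abs_iff)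
    have "\<forall>\<^sub>F k in sequentially. w k u = sgn u"
      using eventually_ge_at_top[of N]
    proof eventually_elim
      case (elim k)
      have "1 \<le> real k * \<bar>u\<bar>"
        using N mult_right_mono[of "real N" "real k" "\<bar>u\<bar>"] elim by linarith
      then show ?case using False by (auto simp: w_def sgn_if abs_if max_def min_def split: if_splits)
    qed
    then show ?thesis by (rule tendsto_eventually)
  qed (simp add: w_def)
  have p_lim: "(\<lambda>k. p k u) \<longlonglongrightarrow> sgn u" if u: "u \<in> {- 1..1}" for u
  proof -
    have "(\<lambda>k. w k u - p k u) \<longlonglongrightarrow> 0"
      using p(2)[OF u] by (intro Lim_null_comparison[OF _ LIMSEQ_Suc[OF lim_1_over_n]])
        (auto intro!: always_eventually less_imp_le)
    from tendsto_diff[OF w_lim[of u] this] show ?thesis by simp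
  qed
  have p_bound: "\<bar>p k u\<bar> \<le> 2" if u: "u \<in> {- 1..1}" for k u
  proof -
    have "\<bar>w k u\<bar> \<le> 1" by (auto simp: w_def)
    moreover have "1 / real (Suc k) \<le> 1" by simp
    ultimately show ?thesis using p(2)[OF u, of k] by linarith
  qed
  obtain K where K: "\<And>x. cmod (f x) \<le> K" using f by (auto simp: tame_def)
  show ?thesis
  proof (rule tame_lim)
    show "(\<lambda>x. complex_of_real (p k (sin (s \<bullet> x + c))) * f x) \<in> tame" for k
      by (rule tame_poly_sin[OF p(1) f])
    show "cmod (complex_of_real (p k (sin (s \<bullet> x + c))) * f x) \<le> 2 * K" for k x
      unfolding norm_mult using p_bound[of "sin (s \<bullet> x + c)" k] K[of x]
      by (intro mult_mono) auto
    show "(\<lambda>k. complex_of_real (p k (sin (s \<bullet> x + c))) * f x)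
        \<longlonglongrightarrow> complex_of_real (sgn (sin (s \<bullet> x + c))) * f x" for x
      by (intro tendsto_intros p_lim) auto
  qed
qed

text \<open>\<open>sgn\<close> is a bounded pointwise limit of polynomials on \<open>[-1, 1]\<close>, and \<open>sgn (sin (v / k)) = sgn v\<close>
  for large \<open>k\<close>; this leads from trigonometric functions to half-spaces.\<close>

lemma tame_sgn:
  assumes f: "f \<in> tame"
  shows "(\<lambda>x. complex_of_real (sgn (s \<bullet> x - a)) * f x) \<in> tame"
proof -
  obtain K where K: "\<And>x. cmod (f x) \<le> K" using f by (auto simp: tame_def)
  show ?thesis
  proof (rule tame_lim)
    show "(\<lambda>x. complex_of_real (sgn (sin ((s /\<^sub>R Suc k) \<bullet> x + - a / Suc k))) * f x) \<in> tame" for k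
      by (rule tame_sgn_sin[OF f])
    show "cmod (complex_of_real (sgn (sin ((s /\<^sub>R Suc k) \<bullet> x + - a / Suc k))) * f x) \<le> K" for k x
    proof -
      have "cmod (complex_of_real (sgn (sin ((s /\<^sub>R Suc k) \<bullet> x + - a / Suc k)))) \<le> 1"
        by (simp add: sgn_if)
      then have "cmod (complex_of_real (sgn (sin ((s /\<^sub>R Suc k) \<bullet> x + - a / Suc k))) * f x) \<le> 1 * K"
        unfolding norm_mult using K[of x] by (intro mult_mono) auto
      then show ?thesis by simp
    qed
    show "(\<lambda>k. complex_of_real (sgn (sin ((s /\<^sub>R Suc k) \<bullet> x + - a / Suc k))) * f x)
        \<longlonglongrightarrow> complex_of_real (sgn (s \<bullet> x - a)) * f x" for x
    proof (rule tendsto_eventually)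
      define v where "v = s \<bullet> x - a"
      obtain N where N: "\<bar>v\<bar> < real N * pi"
        using reals_Archimedean3[OF pi_gt_zero] by blast
      show "\<forall>\<^sub>F k in sequentially. complex_of_real (sgn (sin ((s /\<^sub>R Suc k) \<bullet> x + - a / Suc k))) * f x
          = complex_of_real (sgn (s \<bullet> x - a)) * f x"
        using eventually_ge_at_top[of N]
      proof eventually_elim
        case (elim k)
        have e: "(s /\<^sub>R Suc k) \<bullet> x + - a / Suc k = v / Suc k"
          by (simp add: v_def divide_inverse algebra_simps del: of_nat_Suc)
        have "\<bar>v\<bar> < real (Suc k) * pi"
          using N mult_right_mono[of "real N" "real (Suc k)" pi] elim by (simp add: less_le_trans)
        then have "\<bar>v / Suc k\<bar> < pi" by (simp add: field_simps)
        then have "sgn (sin (v / Suc k)) = sgn (v / Suc k)" by (rule sgn_sin)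
        also have "\<dots> = sgn v" by (simp add: sgn_divide)
        finally show ?case unfolding e by (simp add: v_def)
      qed
    qed
  qed
qed

definition indc :: "(real ^ 'n) set \<Rightarrow> real ^ 'n \<Rightarrow> complex" where
  "indc A x = (if x \<in> A then 1 else 0)"

text \<open>Induction over the sigma-algebra generated by open half-spaces. Quantifying over all
  tame \<open>f\<close> inside the induction allows products of indicators, that is,
  intersections.\<close>

lemma tame_indicator:
  assumes "A \<in> sets borel" "f \<in> tame"
  shows "(\<lambda>x. indc A x * f x) \<in> tame"
proof -
  have "A \<in> sigma_sets UNIV ((\<lambda>(a, i). {x. x \<bullet> i < a}) ` (UNIV \<times> Basis))"
    using assms(1) by (simp add: borel_eq_halfspace_less)
  then have "\<forall>f\<in>tame. (\<lambda>x. indc A x * f x) \<in> tame"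
  proof (induction rule: sigma_sets.induct)
    case (Basic A)
    then obtain a i where A: "A = {x. x \<bullet> i < a}" by auto
    show ?case
    proof
      fix f assume f: "f \<in> tame"
      \<comment> \<open>For a sign \<open>t\<close>, the number \<open>(t * t - t) / 2\<close> is 1
        if \<open>t = - 1\<close> and 0 if \<open>t\<close> is 0 or 1; so the bounding hyperplane is
        correctly left out.\<close>
      let ?s = "\<lambda>x. complex_of_real (sgn (i \<bullet> x - a))"
      have "(\<lambda>x. (1/2) * (?s x * (?s x * f x) - ?s x * f x)) \<in> tame"
        by (intro tame_scale tame_diff tame_sgn f)
      moreover have "(1/2) * (?s x * (?s x * f x) - ?s x * f x) = indc A x * f x" for x
        by (auto simp: A indc_def sgn_if inner_commute)
      ultimately show "(\<lambda>x. indc A x * f x) \<in> tame" by simp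
    qed
  next
    case Empty
    then show ?case using tame_scale[of _ 0] by (auto simp: indc_def)
  next
    case (Compl A)
    show ?case
    proof
      fix f assume f: "f \<in> tame"
      have "(\<lambda>x. f x - indc A x * f x) \<in> tame" using Compl.IH f by (intro tame_diff) auto
      moreover have "f x - indc A x * f x = indc (UNIV - A) x * f x" for x by (auto simp: indc_def)
      ultimately show "(\<lambda>x. indc (UNIV - A) x * f x) \<in> tame" by simp
    qed
  next
    case (Union A)
    show ?case
    proof
      fix f assume f: "f \<in> tame"
      have fin: "(\<lambda>x. indc (\<Union>i<n. A i) x * f x) \<in> tame" for n :: nat
      proof (induction n)
        case 0
        then show ?case using tame_scale[OF f, of 0] by (simp add: indc_def)
      next
        case (Suc n)
        \<comment> \<open>The indicator of \<open>A n\<close> is applied to what the earlier sets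
          leave of \<open>f\<close>, so overlaps are counted once.\<close>
        have "(\<lambda>x. indc (\<Union>i<n. A i) x * f x + indc (A n) x * (f x - indc (\<Union>i<n. A i) x * f x)) \<in> tame"
          by (intro tame_add Suc Union.IH[rule_format] tame_diff f)
        moreover have "indc (\<Union>i<n. A i) x * f x + indc (A n) x * (f x - indc (\<Union>i<n. A i) x * f x)
            = indc (\<Union>i<Suc n. A i) x * f x" for x
          by (auto simp: indc_def lessThan_Suc)
        ultimately show ?case by simp
      qed
      obtain K where K: "\<And>x. cmod (f x) \<le> K" using f by (auto simp: tame_def)
      show "(\<lambda>x. indc (\<Union>i. A i) x * f x) \<in> tame"
      proof (rule tame_lim[OF fin])
        show "cmod (indc (\<Union>i<k. A i) x * f x) \<le> K" for k x
          using K[of x] order_trans[OF norm_ge_zero K[of x]] by (auto simp: indc_def)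
        show "(\<lambda>k. indc (\<Union>i<k. A i) x * f x) \<longlonglongrightarrow> indc (\<Union>i. A i) x * f x" for x
        proof (cases "x \<in> (\<Union>i. A i)")
          case True
          then obtain i where i: "x \<in> A i" by auto
          have "\<forall>\<^sub>F k in sequentially. indc (\<Union>i<k. A i) x * f x = indc (\<Union>i. A i) x * f x"
            using eventually_gt_at_top[of i] by eventually_elim (use i in \<open>auto simp: indc_def\<close>)
          then show ?thesis by (rule tendsto_eventually)
        qed (auto simp: indc_def)
      qed
    qed
  qed
  then show ?thesis using assms(2) by blast
qed

lemma bounded_mult_gauss:
  assumes g: "g \<in> borel_measurable borel" and K: "\<And>x. cmod (g x) \<le> K"
  shows "(\<lambda>x. g x * complex_of_real (gauss (1/2) x)) \<in> C"
proof -
  obtain F where F: "\<And>i. simple_function borel (F i)" "\<And>x. (\<lambda>i. F i x) \<longlonglongrightarrow> g x"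
    "\<And>i x. dist (F i x) 0 \<le> 2 * dist (g x) 0"
    using borel_measurable_implies_sequence_metric[OF g, of 0] by auto
  have "g \<in> tame"
  proof (rule tame_lim)
    show "F k \<in> tame" for k
    proof -
      have fin: "finite (range (F k))" and m: "F k -` {y} \<in> sets borel" for y
        using F(1)[of k] simple_functionD[of borel "F k"] by (auto simp: simple_function_def)
      have "(\<lambda>x. \<Sum>y\<in>range (F k). y * (indc (F k -` {y}) x * 1)) \<in> tame"
        using fin m by (intro tame_sum tame_scale tame_indicator tame_one) auto
      moreover have "(\<Sum>y\<in>range (F k). y * (indc (F k -` {y}) x * 1)) = F k x" for x
      proof -
        have "(\<Sum>y\<in>range (F k). y * (indc (F k -` {y}) x * 1)) = (\<Sum>y\<in>range (F k). if y = F k x then y else 0)"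
          by (intro sum.cong) (auto simp: indc_def)
        then show ?thesis using fin by simp
      qed
      ultimately show ?thesis by simp
    qed
    show "cmod (F k x) \<le> 2 * K" for k x
      using F(3)[of k x] K[of x] by simp
    show "(\<lambda>k. F k x) \<longlonglongrightarrow> g x" for x by (rule F(2))
  qed
  then have "(\<lambda>x. char_fun 0 x * g x * complex_of_real (gauss (1/2) x)) \<in> C" by (auto simp: tame_def)
  then show ?thesis by (simp add: char_fun_def)
qed

end

section \<open>Density and injectivity in \<open>L\<^sup>p\<close>\<close>

lemma Lp_measurable: "f \<in> Lp p \<Longrightarrow> f \<in> borel_measurable lborel"
  and Lp_integrable: "f \<in> Lp p \<Longrightarrow> integrable lborel (\<lambda>x. cmod (f x) powr p)"
  by (auto simp: Lp_def)

text \<open>The norm before its root is taken. Density is proved with this quantity and the crude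
  estimate \<open>Lp_power_add\<close>, whose constant \<open>2 powr p\<close> is immaterial for
  limits.\<close>

definition Lp_power :: "real \<Rightarrow> (real ^ 'n \<Rightarrow> complex) \<Rightarrow> real" where
  "Lp_power p f = (LINT x|lborel. cmod (f x) powr p)"

lemma Lp_power_nonneg: "0 \<le> Lp_power p f"
  unfolding Lp_power_def by (rule Bochner_Integration.integral_nonneg) simp

lemma Lp_norm_nonneg: "0 \<le> Lp_norm p f"
  by (simp add: Lp_norm_def)

lemma Lp_norm_power: "Lp_norm p f = Lp_power p f powr (1 / p)"
  by (simp add: Lp_norm_def Lp_power_def)

lemma Lp_power_norm: "1 \<le> p \<Longrightarrow> Lp_power p f = Lp_norm p f powr p"
  using Lp_power_nonneg[of p f] by (simp add: Lp_norm_power powr_powr)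

lemma powr_add_le:
  fixes a b p :: real
  assumes "0 \<le> a" "0 \<le> b" "0 \<le> p"
  shows "(a + b) powr p \<le> 2 powr p * (a powr p + b powr p)"
proof -
  have "(a + b) powr p \<le> (2 * max a b) powr p"
    using assms by (intro powr_mono2) auto
  also have "\<dots> = 2 powr p * max a b powr p" by (simp add: powr_mult)
  also have "\<dots> \<le> 2 powr p * (a powr p + b powr p)"
    by (intro mult_left_mono) (auto simp: max_def)
  finally show ?thesis .
qed

lemma cmod_add_powr_le:
  "0 \<le> p \<Longrightarrow> cmod (a + b) powr p \<le> 2 powr p * (cmod a powr p + cmod b powr p)"
  using powr_mono2[OF _ _ norm_triangle_ineq[of a b], of p] powr_add_le[of "cmod a" "cmod b" p]
  by auto

lemma Lp_dominated:
  fixes f :: "real ^ 'n \<Rightarrow> complex"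
  assumes f: "f \<in> borel_measurable lborel" and int: "integrable lborel w"
    and le: "\<And>x. cmod (f x) powr p \<le> w x"
  shows "f \<in> Lp p"
proof -
  have "integrable lborel (\<lambda>x. cmod (f x) powr p)"
  proof (rule Bochner_Integration.integrable_bound[OF int])
    show "AE x in lborel. norm (cmod (f x) powr p) \<le> norm (w x)"
      using le by (auto intro!: AE_I2 order_trans[OF le])
  qed (use f in measurable)
  then show ?thesis using f by (simp add: Lp_def)
qed

lemma Lp_add:
  assumes p: "1 \<le> p" and f: "f \<in> Lp p" and g: "g \<in> Lp p"
  shows "(\<lambda>x. f x + g x) \<in> Lp p"
proof (rule Lp_dominated)
  show "integrable lborel (\<lambda>x. 2 powr p * (cmod (f x) powr p + cmod (g x) powr p))"
    using f g by (auto intro!: Bochner_Integration.integrable_add dest: Lp_integrable)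
  show "(\<lambda>x. f x + g x) \<in> borel_measurable lborel"
    using Lp_measurable[OF f] Lp_measurable[OF g] by (rule borel_measurable_add)
qed (use p in \<open>auto intro: cmod_add_powr_le\<close>)

lemma Lp_power_add:
  assumes p: "1 \<le> p" and f: "f \<in> Lp p" and g: "g \<in> Lp p"
  shows "Lp_power p (\<lambda>x. f x + g x) \<le> 2 powr p * (Lp_power p f + Lp_power p g)"
proof -
  have "Lp_power p (\<lambda>x. f x + g x) \<le> (LINT x|lborel. 2 powr p * (cmod (f x) powr p + cmod (g x) powr p))"
    unfolding Lp_power_def
    using p f g Lp_integrable[OF Lp_add[OF p f g]] Lp_integrable[OF f] Lp_integrable[OF g]
    by (intro integral_mono) (auto intro: cmod_add_powr_le)
  also have "\<dots> = 2 powr p * (Lp_power p f + Lp_power p g)"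
    unfolding Lp_power_def using Lp_integrable[OF f] Lp_integrable[OF g] by simp
  finally show ?thesis .
qed

lemma Lp_scale:
  assumes f: "f \<in> Lp p"
  shows "(\<lambda>x. c * f x) \<in> Lp p"
  using f unfolding Lp_def by (auto simp: norm_mult powr_mult)

lemma Lp_power_scale: "Lp_power p (\<lambda>x. c * f x) = cmod c powr p * Lp_power p f"
  unfolding Lp_power_def by (simp add: norm_mult powr_mult)

lemma Lp_norm_scale:
  assumes "1 \<le> p" shows "Lp_norm p (\<lambda>x. c * f x) = cmod c * Lp_norm p f"
  using assms by (simp add: Lp_norm_power Lp_power_scale powr_mult powr_powr)

lemma Lp_zero: "(\<lambda>x. 0) \<in> Lp p"
  by (simp add: Lp_def)

lemma Lp_diff: "1 \<le> p \<Longrightarrow> f \<in> Lp p \<Longrightarrow> g \<in> Lp p \<Longrightarrow> (\<lambda>x. f x - g x) \<in> Lp p"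
  using Lp_add[of p f "\<lambda>x. - 1 * g x"] Lp_scale[of g p "- 1"] by simp

lemma Lp_sum:
  assumes "1 \<le> p" "finite I" "\<And>i. i \<in> I \<Longrightarrow> f i \<in> Lp p"
  shows "(\<lambda>x. \<Sum>i\<in>I. c i * f i x) \<in> Lp p"
  using assms(2,3)
proof (induction I rule: finite_induct)
  case (insert i I)
  then show ?case using Lp_add[OF assms(1) Lp_scale[of "f i" p "c i"]] by simp
qed (simp add: Lp_zero)

lemma Lp_norm_cong_AE:
  assumes "AE x in lborel. f x = g x" "f \<in> borel_measurable lborel" "g \<in> borel_measurable lborel"
  shows "Lp_norm p f = Lp_norm p g"
  unfolding Lp_norm_def using assms by (subst integral_cong_AE[of _ _ "\<lambda>x. cmod (g x) powr p"]) auto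

lemma Lp_norm_eq_0:
  assumes "1 \<le> p" "f \<in> Lp p" "Lp_norm p f = 0"
  shows "AE x in lborel. f x = 0"
proof -
  have "Lp_power p f = 0" using assms Lp_power_norm[of p f] by simp
  then have "AE x in lborel. cmod (f x) powr p = 0"
    unfolding Lp_power_def using Lp_integrable[OF assms(2)]
    by (subst (asm) integral_nonneg_eq_0_iff_AE) auto
  then show ?thesis by simp
qed

lemma gauss_powr_le:
  assumes "1 \<le> p" "0 \<le> c" shows "gauss c x powr p \<le> gauss c x"
  using powr_mono'[of 1 p "gauss c x"] assms gauss_le_1[of c x] gauss_pos[of c x] by simp

lemma gauss_bound_powr:
  assumes p: "1 \<le> p" and K: "cmod z \<le> K * gauss (1/4) x"
  shows "cmod z powr p \<le> K powr p * gauss (1/4) x"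
proof -
  have K0: "0 \<le> K" using order_trans[OF norm_ge_zero K] gauss_pos[of "1/4" x]
    by (simp add: zero_le_mult_iff)
  have "cmod z powr p \<le> (K * gauss (1/4) x) powr p" using p K by (intro powr_mono2) auto
  also have "\<dots> = K powr p * gauss (1/4) x powr p" by (simp add: powr_mult)
  also have "\<dots> \<le> K powr p * gauss (1/4) x"
    using p by (intro mult_left_mono gauss_powr_le) auto
  finally show ?thesis .
qed

lemma Lp_gauss_bound:
  assumes p: "1 \<le> p" and f: "f \<in> borel_measurable lborel" and K: "\<And>x. cmod (f x) \<le> K * gauss (1/4) x"
  shows "f \<in> Lp p"
proof (rule Lp_dominated[OF f])
  show "integrable lborel (\<lambda>x::real^'n. K powr p * gauss (1/4) x)"
    by (intro Bochner_Integration.integrable_mult_right integrable_gauss) simp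
qed (rule gauss_bound_powr[OF p K])

lemma hermite_function_Lp: "1 \<le> p \<Longrightarrow> (\<lambda>x. complex_of_real (hermite_function \<nu> x)) \<in> Lp p"
  using hermite_function_bound[of \<nu>] by (auto intro!: Lp_gauss_bound)

lemma hermite_span_Lp: "1 \<le> p \<Longrightarrow> hermite_span \<subseteq> Lp p"
  by (auto simp: hermite_span_def intro!: Lp_sum hermite_function_Lp)

lemma Lp_power_tendsto_0:
  fixes f :: "real ^ 'n \<Rightarrow> complex"
  assumes p: "1 \<le> p" and meas: "\<And>k. h k \<in> borel_measurable lborel" "f \<in> borel_measurable lborel"
    and int: "integrable lborel w" and le: "\<And>k x. cmod (f x - h k x) powr p \<le> w x"
    and lim: "\<And>x. (\<lambda>k::nat. h k x) \<longlonglongrightarrow> f x"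
  shows "(\<lambda>k. Lp_power p (\<lambda>x. f x - h k x)) \<longlonglongrightarrow> 0"
proof -
  have "(\<lambda>k. LINT x|lborel. cmod (f x - h k x) powr p) \<longlonglongrightarrow> (LINT x|(lborel :: (real ^ 'n) measure). 0)"
  proof (rule integral_dominated_convergence[where w = w])
    show "AE x in lborel. (\<lambda>k. cmod (f x - h k x) powr p) \<longlonglongrightarrow> 0"
    proof (rule AE_I2)
      fix x
      have "(\<lambda>k. cmod (f x - h k x)) \<longlonglongrightarrow> cmod (f x - f x)" by (intro tendsto_intros lim)
      then have "(\<lambda>k. cmod (f x - h k x) powr p) \<longlonglongrightarrow> 0 powr p"
        using p by (intro tendsto_powr2) auto
      then show "(\<lambda>k. cmod (f x - h k x) powr p) \<longlonglongrightarrow> 0" by simp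
    qed
  qed (use meas le int in auto)
  then show ?thesis by (simp add: Lp_power_def)
qed

section \<open>Density of the span of the Hermite functions\<close>

definition Lp_closure :: "real \<Rightarrow> (real ^ 'n \<Rightarrow> complex) set" where
  "Lp_closure p = {f \<in> Lp p. \<forall>e>0. \<exists>g\<in>hermite_span. Lp_power p (\<lambda>x. f x - g x) < e}"

lemma Lp_closure_limit:
  assumes p: "1 \<le> p" and f: "f \<in> Lp p" and h: "\<And>k::nat. h k \<in> Lp_closure p"
    and lim: "(\<lambda>k. Lp_power p (\<lambda>x. f x - h k x)) \<longlonglongrightarrow> 0"
  shows "f \<in> Lp_closure p"
  unfolding Lp_closure_def
proof (clarify, intro conjI allI impI)
  fix e :: real assume e: "0 < e"
  \<comment> \<open>Two errors below \<open>d\<close>, multiplied by the constant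
    \<open>2 powr p\<close> of \<open>Lp_power_add\<close>, stay below \<open>e\<close>.\<close>
  define d where "d = e / (2 * 2 powr p)"
  have d: "0 < d" using e by (simp add: d_def)
  obtain k where k: "Lp_power p (\<lambda>x. f x - h k x) < d"
    using order_tendstoD(2)[OF lim d] by (auto simp: eventually_sequentially)
  obtain g where g: "g \<in> hermite_span" "Lp_power p (\<lambda>x. h k x - g x) < d"
    using h[of k] d by (auto simp: Lp_closure_def)
  have Lps: "h k \<in> Lp p" "g \<in> Lp p" using h[of k] g hermite_span_Lp[OF p] by (auto simp: Lp_closure_def)
  have "Lp_power p (\<lambda>x. f x - g x) = Lp_power p (\<lambda>x. (f x - h k x) + (h k x - g x))" by simp
  also have "\<dots> \<le> 2 powr p * (Lp_power p (\<lambda>x. f x - h k x) + Lp_power p (\<lambda>x. h k x - g x))"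
    using p f Lps by (intro Lp_power_add Lp_diff)
  also have "\<dots> < 2 powr p * (d + d)" using k g by (intro mult_strict_left_mono) auto
  also have "\<dots> = e" by (simp add: d_def)
  finally show "\<exists>g\<in>hermite_span. Lp_power p (\<lambda>x. f x - g x) < e" using g by blast
qed (rule f)

lemma gauss_closed_Lp_closure:
  assumes p: "1 \<le> p" shows "gauss_closed (Lp_closure p)"
proof
  show "hermite_span \<subseteq> Lp_closure p"
  proof
    fix f :: "real ^ 'n \<Rightarrow> complex" assume f: "f \<in> hermite_span"
    have "Lp_power p (\<lambda>x. f x - f x) = 0" by (simp add: Lp_power_def)
    then show "f \<in> Lp_closure p" using f hermite_span_Lp[OF p] by (force simp: Lp_closure_def)
  qed
next
  fix f g :: "real ^ 'n \<Rightarrow> complex" assume f: "f \<in> Lp_closure p" and g: "g \<in> Lp_closure p"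
  show "(\<lambda>x. f x + g x) \<in> Lp_closure p"
    unfolding Lp_closure_def
  proof (clarify, intro conjI allI impI)
    show "(\<lambda>x. f x + g x) \<in> Lp p" using f g by (intro Lp_add[OF p]) (auto simp: Lp_closure_def)
    fix e :: real assume e: "0 < e"
    define d where "d = e / (2 * 2 powr p)"
    have d: "0 < d" using e by (simp add: d_def)
    obtain u where u: "u \<in> hermite_span" "Lp_power p (\<lambda>x. f x - u x) < d"
      using f d by (auto simp: Lp_closure_def)
    obtain v where v: "v \<in> hermite_span" "Lp_power p (\<lambda>x. g x - v x) < d"
      using g d by (auto simp: Lp_closure_def)
    have "Lp_power p (\<lambda>x. f x + g x - (u x + v x)) = Lp_power p (\<lambda>x. (f x - u x) + (g x - v x))"
      by (simp add: algebra_simps)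
    also have "\<dots> \<le> 2 powr p * (Lp_power p (\<lambda>x. f x - u x) + Lp_power p (\<lambda>x. g x - v x))"
      using f g u v hermite_span_Lp[OF p] by (intro Lp_power_add Lp_diff p) (auto simp: Lp_closure_def)
    also have "\<dots> < 2 powr p * (d + d)" using u v by (intro mult_strict_left_mono) auto
    also have "\<dots> = e" by (simp add: d_def)
    finally show "\<exists>w\<in>hermite_span. Lp_power p (\<lambda>x. f x + g x - w x) < e"
      using hermite_span_add[OF u(1) v(1)] by (intro bexI[of _ "\<lambda>x. u x + v x"])
  qed
next
  fix f :: "real ^ 'n \<Rightarrow> complex" and c assume f: "f \<in> Lp_closure p"
  show "(\<lambda>x. c * f x) \<in> Lp_closure p"
    unfolding Lp_closure_def
  proof (clarify, intro conjI allI impI)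
    show "(\<lambda>x. c * f x) \<in> Lp p" using f by (intro Lp_scale) (auto simp: Lp_closure_def)
    fix e :: real assume e: "0 < e"
    define d where "d = e / (cmod c powr p + 1)"
    have c: "0 < cmod c powr p + 1" by (simp add: add_nonneg_pos)
    then have d: "0 < d" using e by (simp add: d_def)
    obtain u where u: "u \<in> hermite_span" "Lp_power p (\<lambda>x. f x - u x) < d"
      using f d by (auto simp: Lp_closure_def)
    have "Lp_power p (\<lambda>x. c * f x - c * u x) = cmod c powr p * Lp_power p (\<lambda>x. f x - u x)"
      using Lp_power_scale[of p c "\<lambda>x. f x - u x"] by (simp add: right_diff_distrib)
    also have "\<dots> \<le> cmod c powr p * d" using u by (intro mult_left_mono) auto
    also have "\<dots> < (cmod c powr p + 1) * d" using d by (intro mult_strict_right_mono) auto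
    also have "\<dots> = e" using c by (simp add: d_def)
    finally show "\<exists>w\<in>hermite_span. Lp_power p (\<lambda>x. c * f x - w x) < e"
      using hermite_span_scale[OF u(1)] by (intro bexI[of _ "\<lambda>x. c * u x"])
  qed
next
  fix h :: "nat \<Rightarrow> real ^ 'n \<Rightarrow> complex" and f K
  assume h: "\<And>k. h k \<in> Lp_closure p" and le: "\<And>k x. cmod (h k x) \<le> K * gauss (1/4) x"
    and lim: "\<And>x. (\<lambda>k. h k x) \<longlonglongrightarrow> f x"
  have hm: "h k \<in> borel_measurable lborel" for k
    using h[of k] by (auto simp: Lp_closure_def dest: Lp_measurable)
  have fm: "f \<in> borel_measurable lborel"
    by (rule borel_measurable_LIMSEQ_metric[OF hm]) (use lim in auto)
  have fb: "cmod (f x) \<le> K * gauss (1/4) x" for x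
    using le by (intro Lim_norm_ubound[OF _ lim]) auto
  show "f \<in> Lp_closure p"
  proof (rule Lp_closure_limit[OF p _ h])
    show "f \<in> Lp p" by (rule Lp_gauss_bound[OF p fm fb])
    show "(\<lambda>k. Lp_power p (\<lambda>x. f x - h k x)) \<longlonglongrightarrow> 0"
    proof (rule Lp_power_tendsto_0[OF p hm fm _ _ lim])
      show "integrable lborel (\<lambda>x::real^'n. (2 * K) powr p * gauss (1/4) x)"
        by (intro Bochner_Integration.integrable_mult_right integrable_gauss) simp
      fix k x
      have "cmod (f x - h k x) \<le> (2 * K) * gauss (1/4) x"
        using norm_triangle_ineq4[of "f x" "h k x"] fb[of x] le[of k x] by linarith
      then show "cmod (f x - h k x) powr p \<le> (2 * K) powr p * gauss (1/4) x"
        by (rule gauss_bound_powr[OF p])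
    qed
  qed
qed

lemma hermite_span_dense:
  assumes p: "1 \<le> p" and f: "f \<in> Lp p"
  shows "f \<in> Lp_closure p"
proof -
  interpret gauss_closed "Lp_closure p" by (rule gauss_closed_Lp_closure[OF p])
  have fm [measurable]: "f \<in> borel_measurable borel" using Lp_measurable[OF f] by simp
  \<comment> \<open>Truncation in value and in space: on a ball the Gaussian is bounded below, so
    the quotient of \<open>h k\<close> by it is bounded.\<close>
  define h where "h = (\<lambda>k x. if cmod (f x) \<le> real k \<and> norm x \<le> real k then f x else 0)"
  have hm: "h k \<in> borel_measurable lborel" for k unfolding h_def by measurable
  have hC: "h k \<in> Lp_closure p" for k :: nat
  proof -
    have "(\<lambda>x. (h k x / complex_of_real (gauss (1/2) x)) * complex_of_real (gauss (1/2) x)) \<in> Lp_closure p"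
    proof (rule bounded_mult_gauss)
      show "(\<lambda>x. h k x / complex_of_real (gauss (1/2) x)) \<in> borel_measurable borel"
        using hm[of k] by simp
      fix x
      show "cmod (h k x / complex_of_real (gauss (1/2) x)) \<le> real k * exp (1/2 * (real k)\<^sup>2)"
      proof (cases "cmod (f x) \<le> real k \<and> norm x \<le> real k")
        case True
        then have "(norm x)\<^sup>2 \<le> (real k)\<^sup>2" by (intro power_mono) auto
        then have "exp (1/2 * (norm x)\<^sup>2) \<le> exp (1/2 * (real k)\<^sup>2)" by simp
        then have "cmod (f x) * exp (1/2 * (norm x)\<^sup>2) \<le> real k * exp (1/2 * (real k)\<^sup>2)"
          using True by (intro mult_mono) auto
        then show ?thesis using True by (simp add: h_def gauss_def norm_divide norm_mult exp_minus field_simps)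
      qed (auto simp: h_def)
    qed
    then show ?thesis by (simp add: gauss_def)
  qed
  show ?thesis
  proof (rule Lp_closure_limit[OF p f hC])
    show "(\<lambda>k. Lp_power p (\<lambda>x. f x - h k x)) \<longlonglongrightarrow> 0"
    proof (rule Lp_power_tendsto_0[OF p hm _ Lp_integrable[OF f]])
      show "cmod (f x - h k x) powr p \<le> cmod (f x) powr p" for k x
        using p by (auto simp: h_def)
      show "(\<lambda>k. h k x) \<longlonglongrightarrow> f x" for x
      proof (rule tendsto_eventually)
        obtain N where N: "max (cmod (f x)) (norm x) \<le> real N" using real_arch_simple by blast
        show "\<forall>\<^sub>F k in sequentially. h k x = f x"
          using eventually_ge_at_top[of N]
        proof eventually_elim
          case (elim k)
          then have "real N \<le> real k" by simp
          then show ?case using N by (auto simp: h_def)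
        qed
      qed
    qed simp
  qed
qed

lemma hermite_span_dense_norm:
  assumes p: "1 \<le> p" and f: "f \<in> Lp p" and e: "0 < e"
  shows "\<exists>g\<in>hermite_span. Lp_norm p (\<lambda>x. f x - g x) < e"
proof -
  obtain g where g: "g \<in> hermite_span" "Lp_power p (\<lambda>x. f x - g x) < e powr p"
  proof -
    have "0 < e powr p" using e by simp
    then show ?thesis using hermite_span_dense[OF p f] that unfolding Lp_closure_def by blast
  qed
  have "Lp_norm p (\<lambda>x. f x - g x) < (e powr p) powr (1 / p)"
    unfolding Lp_norm_power using g p Lp_power_nonneg by (intro powr_less_mono2) auto
  then show ?thesis using g e p by (auto simp: powr_powr)
qed

text \<open>With \<open>a = \<parallel>f\<parallel>\<close>, integrating \<open>t \<le> 1 + t powr p\<close> for \<open>t = \<bar>f(x)\<bar> / a\<close> against the Gaussian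
  replaces Hoelder's inequality, and treats \<open>p = 1\<close> alike.\<close>

lemma Lp_gauss_pairing:
  assumes p: "1 \<le> p" and f: "f \<in> Lp p"
  shows "integrable lborel (\<lambda>x. cmod (f x) * gauss (1/4) x)"
    and "(LINT x|lborel. cmod (f x) * gauss (1/4) x)
      \<le> (1 + (LINT x|(lborel :: (real^'n) measure). gauss (1/4) x)) * Lp_norm p (f :: real^'n \<Rightarrow> complex)"
proof -
  have fm [measurable]: "f \<in> borel_measurable borel" using Lp_measurable[OF f] by simp
  have gi: "integrable lborel (gauss (1/4) :: real^'n \<Rightarrow> real)" by (rule integrable_gauss) simp
  have le: "cmod (f x) * gauss (1/4) x \<le> a * gauss (1/4) x + a * (cmod (f x) powr p / a powr p)"
    if a: "0 < a" for a x
  proof -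
    let ?t = "cmod (f x) / a"
    have t: "?t \<le> 1 + ?t powr p"
    proof (cases "?t \<le> 1")
      case False
      then show ?thesis using powr_mono[of 1 p ?t] p a by simp
    qed (simp add: add_increasing2)
    have "cmod (f x) * gauss (1/4) x = a * (?t * gauss (1/4) x)" using a by simp
    also have "\<dots> \<le> a * ((1 + ?t powr p) * gauss (1/4) x)"
      using t a gauss_pos[of "1/4" x] by (intro mult_left_mono mult_right_mono) auto
    also have "\<dots> = a * (gauss (1/4) x + ?t powr p * gauss (1/4) x)" by (simp add: algebra_simps)
    also have "\<dots> \<le> a * (gauss (1/4) x + ?t powr p * 1)"
      using a gauss_le_1[of "1/4" x] by (intro mult_left_mono add_left_mono) auto
    finally show ?thesis using a by (simp add: powr_divide distrib_left)
  qed
  have wi: "integrable lborel (\<lambda>x. a * gauss (1/4) x + a * (cmod (f x) powr p / a powr p))" for a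
    using gi Lp_integrable[OF f] by auto
  show int: "integrable lborel (\<lambda>x. cmod (f x) * gauss (1/4) x)"
  proof (rule Bochner_Integration.integrable_bound[OF wi[of 1]])
    have "norm (cmod (f x) * gauss (1/4) x) \<le> norm (1 * gauss (1/4) x + 1 * (cmod (f x) powr p / 1 powr p))" for x
      using le[of 1 x] gauss_pos[of "1/4" x] by (simp add: abs_mult)
    then show "AE x in lborel. norm (cmod (f x) * gauss (1/4) x) \<le> norm (1 * gauss (1/4) x + 1 * (cmod (f x) powr p / 1 powr p))"
      by simp
  qed measurable
  define a where "a = Lp_norm p f"
  show "(LINT x|lborel. cmod (f x) * gauss (1/4) x)
      \<le> (1 + (LINT x|(lborel :: (real^'n) measure). gauss (1/4) x)) * Lp_norm p f"
  proof (cases "a = 0")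
    case True
    then have "AE x in lborel. cmod (f x) * gauss (1/4) x = 0"
      using Lp_norm_eq_0[OF p f] by (auto simp: a_def)
    then have "(LINT x|lborel. cmod (f x) * gauss (1/4) x) = 0" by (rule integral_eq_zero_AE)
    then show ?thesis using True by (simp add: a_def)
  next
    case False
    then have a: "0 < a" using Lp_norm_nonneg[of p f] by (simp add: a_def)
    have "(LINT x|lborel. cmod (f x) * gauss (1/4) x)
        \<le> (LINT x|lborel. a * gauss (1/4) x + a * (cmod (f x) powr p / a powr p))"
      by (rule integral_mono[OF int wi le[OF a]])
    also have "\<dots> = a * (LINT x|(lborel :: (real^'n) measure). gauss (1/4) x) + a * (Lp_power p f / a powr p)"
      using gi Lp_integrable[OF f] by (simp add: Lp_power_def)
    also have "Lp_power p f / a powr p = 1"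
      using a by (simp add: Lp_power_norm[OF p] a_def)
    finally show ?thesis by (simp add: a_def algebra_simps)
  qed
qed

lemma Lp_mult_gauss_bound_integrable:
  assumes p: "1 \<le> p" and f: "f \<in> Lp p" and h: "h \<in> borel_measurable borel"
    and K: "\<And>x. cmod (h x) \<le> K * gauss (1/4) x"
  shows "integrable lborel (\<lambda>x. f x * h x)"
    and "cmod (LINT x|lborel. f x * h x) \<le> K * (LINT x|lborel. cmod (f x) * gauss (1/4) x)"
proof -
  have le: "cmod (f x * h x) \<le> K * (cmod (f x) * gauss (1/4) x)" for x
    using mult_left_mono[OF K[of x], of "cmod (f x)"] by (simp add: norm_mult mult_ac)
  have i: "integrable lborel (\<lambda>x. K * (cmod (f x) * gauss (1/4) x))"
    using Lp_gauss_pairing(1)[OF p f] by (rule Bochner_Integration.integrable_mult_right)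
  show int: "integrable lborel (\<lambda>x. f x * h x)"
    by (rule Bochner_Integration.integrable_bound[OF i])
       (use Lp_measurable[OF f] h le in \<open>auto intro!: AE_I2 order_trans[OF le]\<close>)
  have "cmod (LINT x|lborel. f x * h x) \<le> (LINT x|lborel. cmod (f x * h x))"
    by (rule integral_norm_bound)
  also have "\<dots> \<le> (LINT x|lborel. K * (cmod (f x) * gauss (1/4) x))"
    using int by (intro integral_mono i le) auto
  finally show "cmod (LINT x|lborel. f x * h x) \<le> K * (LINT x|lborel. cmod (f x) * gauss (1/4) x)"
    by simp
qed

section \<open>Hermite coefficients as functionals on L^p\<close>

lemma hermite_coeff_integrable:
  assumes p: "1 \<le> p" and f: "f \<in> Lp p"
  shows "integrable lborel (\<lambda>x. f x * complex_of_real (hermite_function \<nu> x))"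
  using hermite_function_bound[of \<nu>] by (auto intro!: Lp_mult_gauss_bound_integrable[OF p f])

lemma hermite_coeff_bound:
  assumes p: "1 \<le> p"
  shows "\<exists>K. \<forall>f\<in>Lp p. cmod (hermite_coeff f (\<nu> :: nat ^ 'n)) \<le> K * Lp_norm p f"
proof -
  obtain C where C: "C \<ge> 0" "\<And>x::real^'n. \<bar>hermite_function \<nu> x\<bar> \<le> C * gauss (1/4) x"
    using hermite_function_bound by blast
  let ?M = "1 + (LINT x|(lborel :: (real^'n) measure). gauss (1/4) x)"
  have "cmod (hermite_coeff f \<nu>) \<le> (C * ?M) * Lp_norm p f" if f: "f \<in> Lp p" for f
  proof -
    have "cmod (hermite_coeff f \<nu>) \<le> C * (LINT x|lborel. cmod (f x) * gauss (1/4) x)"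
      unfolding hermite_coeff_def
      by (rule Lp_mult_gauss_bound_integrable(2)[OF p f]) (use C in auto)
    also have "\<dots> \<le> C * (?M * Lp_norm p f)"
      using Lp_gauss_pairing(2)[OF p f] C by (intro mult_left_mono) auto
    finally show ?thesis by (simp add: mult.assoc)
  qed
  then show ?thesis by blast
qed

lemma hermite_coeff_scale: "hermite_coeff (\<lambda>x. c * f x) \<nu> = c * hermite_coeff f \<nu>"
  by (simp add: hermite_coeff_def mult.assoc)

lemma hermite_coeff_add:
  assumes p: "1 \<le> p" and f: "f \<in> Lp p" "g \<in> Lp p"
  shows "hermite_coeff (\<lambda>x. f x + g x) \<nu> = hermite_coeff f \<nu> + hermite_coeff g \<nu>"
  unfolding hermite_coeff_def distrib_right
  by (intro Bochner_Integration.integral_add hermite_coeff_integrable[OF p] f)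

lemma hermite_coeff_diff:
  assumes p: "1 \<le> p" and f: "f \<in> Lp p" "g \<in> Lp p"
  shows "hermite_coeff (\<lambda>x. f x - g x) \<nu> = hermite_coeff f \<nu> - hermite_coeff g \<nu>"
  unfolding hermite_coeff_def left_diff_distrib
  by (intro Bochner_Integration.integral_diff hermite_coeff_integrable[OF p] f)

lemma hermite_coeff_sum:
  assumes p: "1 \<le> p" and "finite I" "\<And>i. i \<in> I \<Longrightarrow> f i \<in> Lp p"
  shows "hermite_coeff (\<lambda>x. \<Sum>i\<in>I. c i * f i x) \<nu> = (\<Sum>i\<in>I. c i * hermite_coeff (f i) \<nu>)"
  using assms(2,3)
proof (induction I rule: finite_induct)
  case (insert i I)
  have "hermite_coeff (\<lambda>x. c i * f i x + (\<Sum>i\<in>I. c i * f i x)) \<nu>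
      = hermite_coeff (\<lambda>x. c i * f i x) \<nu> + hermite_coeff (\<lambda>x. \<Sum>i\<in>I. c i * f i x) \<nu>"
    using insert by (intro hermite_coeff_add[OF p] Lp_scale Lp_sum p) auto
  then show ?case using insert by (simp add: hermite_coeff_scale)
qed (simp add: hermite_coeff_def)

lemma hermite_coeff_cong_AE:
  assumes "AE x in lborel. f x = g x" "f \<in> borel_measurable lborel" "g \<in> borel_measurable lborel"
  shows "hermite_coeff f \<nu> = hermite_coeff g \<nu>"
  unfolding hermite_coeff_def using assms by (intro integral_cong_AE) auto

lemma hermite_coeff_hermite:
  "hermite_coeff (\<lambda>x. complex_of_real (hermite_function \<mu> x)) \<nu> = (if \<mu> = \<nu> then 1 else 0)"
proof -
  have "hermite_coeff (\<lambda>x. complex_of_real (hermite_function \<mu> x)) \<nu>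
      = (LINT x|lborel. complex_of_real (hermite_function \<mu> x * hermite_function \<nu> x))"
    by (simp add: hermite_coeff_def)
  also have "\<dots> = complex_of_real (LINT x|lborel. hermite_function \<mu> x * hermite_function \<nu> x)"
    by (rule integral_complex_of_real)
  finally show ?thesis by (simp add: hermite_function_orthonormal)
qed

text \<open>The functions whose product with \<open>f\<close> has integral 0 satisfy
  \<open>gauss_closed\<close>, so they include every bounded measurable function times the Gaussian.
  Taking the conjugate phase of \<open>f\<close> as the bounded factor leaves the integral of
  \<open>cmod (f x) * gauss (1/2) x\<close>, whose vanishing forces \<open>f\<close> to
  vanish.\<close>

lemma hermite_coeff_injective:
  fixes f :: "real ^ 'n \<Rightarrow> complex"
  assumes p: "1 \<le> p" and f: "f \<in> Lp p" and zero: "\<And>\<nu>. hermite_coeff f \<nu> = 0"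
  shows "AE x in lborel. f x = 0"
proof -
  have fm [measurable]: "f \<in> borel_measurable borel" using Lp_measurable[OF f] by simp
  define C where "C = {h. h \<in> borel_measurable borel \<and> integrable lborel (\<lambda>x. f x * h x)
    \<and> (LINT x|lborel. f x * h x) = 0}"
  have fD: "integrable lborel (\<lambda>x. cmod (f x) * gauss (1/4) x)" by (rule Lp_gauss_pairing(1)[OF p f])
  interpret gauss_closed C
  proof
    show "hermite_span \<subseteq> C"
    proof
      fix h assume "h \<in> (hermite_span :: (real ^ 'n \<Rightarrow> complex) set)"
      then obtain A c where A: "finite A" "h = (\<lambda>x. \<Sum>\<nu>\<in>A. c \<nu> * complex_of_real (hermite_function \<nu> x))"
        by (auto simp: hermite_span_def)
      have eq: "f x * h x = (\<Sum>\<nu>\<in>A. c \<nu> * (f x * complex_of_real (hermite_function \<nu> x)))" for x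
        unfolding A by (simp add: sum_distrib_left mult_ac)
      have "h \<in> borel_measurable borel" unfolding A by measurable
      moreover have "integrable lborel (\<lambda>x. f x * h x)" unfolding eq
        using hermite_coeff_integrable[OF p f]
        by (intro Bochner_Integration.integrable_sum Bochner_Integration.integrable_mult_right)
      moreover have "(LINT x|lborel. f x * h x) = (\<Sum>\<nu>\<in>A. c \<nu> * hermite_coeff f \<nu>)"
        unfolding eq hermite_coeff_def using hermite_coeff_integrable[OF p f]
        by (subst Bochner_Integration.integral_sum) auto
      ultimately show "h \<in> C" using zero by (simp add: C_def)
    qed
    show "\<And>g h. g \<in> C \<Longrightarrow> h \<in> C \<Longrightarrow> (\<lambda>x. g x + h x) \<in> C"
      by (auto simp: C_def distrib_left)
    show "\<And>h c. h \<in> C \<Longrightarrow> (\<lambda>x. c * h x) \<in> C"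
      by (auto simp: C_def mult.left_commute)
    fix h :: "nat \<Rightarrow> real ^ 'n \<Rightarrow> complex" and g K
    assume h: "\<And>k. h k \<in> C" and le: "\<And>k x. cmod (h k x) \<le> K * gauss (1/4) x"
      and lim: "\<And>x. (\<lambda>k. h k x) \<longlonglongrightarrow> g x"
    have hm: "h k \<in> borel_measurable borel" for k using h by (auto simp: C_def)
    have gm [measurable]: "g \<in> borel_measurable borel"
      by (rule borel_measurable_LIMSEQ_metric[OF hm]) (use lim in auto)
    have gb: "cmod (g x) \<le> K * gauss (1/4) x" for x
      using le by (intro Lim_norm_ubound[OF _ lim]) auto
    have "(\<lambda>k. LINT x|lborel. f x * h k x) \<longlonglongrightarrow> (LINT x|lborel. f x * g x)"
    proof (rule integral_dominated_convergence)
      show "integrable lborel (\<lambda>x. K * (cmod (f x) * gauss (1/4) x))" using fD by simp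
      show "AE x in lborel. (\<lambda>k. f x * h k x) \<longlonglongrightarrow> f x * g x"
        by (intro AE_I2 tendsto_intros lim)
      show "AE x in lborel. norm (f x * h k x) \<le> K * (cmod (f x) * gauss (1/4) x)" for k
      proof (rule AE_I2)
        fix x show "norm (f x * h k x) \<le> K * (cmod (f x) * gauss (1/4) x)"
          using mult_left_mono[OF le[of k x], of "cmod (f x)"] by (simp add: norm_mult mult_ac)
      qed
    qed (use hm in \<open>simp_all\<close>)
    moreover have "(LINT x|lborel. f x * h k x) = 0" for k using h[of k] by (simp add: C_def)
    ultimately have "(LINT x|lborel. f x * g x) = 0" by (simp add: LIMSEQ_const_iff)
    moreover have "integrable lborel (\<lambda>x. f x * g x)"
      by (rule Lp_mult_gauss_bound_integrable(1)[OF p f gm gb])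
    ultimately show "g \<in> C" by (simp add: C_def)
  qed
  \<comment> \<open>Where \<open>f x = 0\<close> the phase is 0 by the convention for division, so
    it stays bounded by 1 and agrees with the intended product.\<close>
  have "(\<lambda>x. (cnj (f x) / cmod (f x)) * complex_of_real (gauss (1/2) x)) \<in> C"
  proof (rule bounded_mult_gauss)
    show "cmod (cnj (f x) / complex_of_real (cmod (f x))) \<le> 1" for x by (simp add: norm_divide)
    have "cnj \<in> borel_measurable borel" by (intro borel_measurable_continuous_onI continuous_intros)
    then show "(\<lambda>x. cnj (f x) / complex_of_real (cmod (f x))) \<in> borel_measurable borel" by measurable
  qed
  then have I: "integrable lborel (\<lambda>x. f x * ((cnj (f x) / cmod (f x)) * complex_of_real (gauss (1/2) x)))"
    and "(LINT x|lborel. f x * ((cnj (f x) / cmod (f x)) * complex_of_real (gauss (1/2) x))) = 0"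
    by (auto simp: C_def)
  moreover have eq: "f x * ((cnj (f x) / cmod (f x)) * complex_of_real (gauss (1/2) x))
      = complex_of_real (cmod (f x) * gauss (1/2) x)" for x
  proof (cases "f x = 0")
    case False
    have "f x * ((cnj (f x) / cmod (f x)) * complex_of_real (gauss (1/2) x))
        = (f x * cnj (f x)) * complex_of_real (gauss (1/2) x) / cmod (f x)" by simp
    then show ?thesis using False
      unfolding complex_norm_square[symmetric] by (simp add: power2_eq_square)
  qed simp
  ultimately have "integrable lborel (\<lambda>x. complex_of_real (cmod (f x) * gauss (1/2) x))"
    and "(LINT x|lborel. complex_of_real (cmod (f x) * gauss (1/2) x)) = 0"
    by auto
  then have "integrable lborel (\<lambda>x. cmod (f x) * gauss (1/2) x)"
    and "(LINT x|lborel. cmod (f x) * gauss (1/2) x) = 0"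
    by (simp_all only: complex_of_real_integrable_eq integral_complex_of_real of_real_eq_0_iff)
  then have "AE x in lborel. cmod (f x) * gauss (1/2) x = 0"
    by (subst (asm) integral_nonneg_eq_0_iff_AE) (auto simp: gauss_pos less_imp_le)
  then show ?thesis
  proof eventually_elim
    case (elim x)
    then show ?case using gauss_pos[of "1/2" x] by simp
  qed
qed

section \<open>From a nuclear representation to a diagonal model\<close>

lemma Lp_dual_add: "e \<in> Lp_dual p \<Longrightarrow> f \<in> Lp p \<Longrightarrow> g \<in> Lp p \<Longrightarrow> e (\<lambda>x. f x + g x) = e f + e g"
  and Lp_dual_scale: "e \<in> Lp_dual p \<Longrightarrow> f \<in> Lp p \<Longrightarrow> e (\<lambda>x. c * f x) = c * e f"
  by (auto simp: Lp_dual_def)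

lemma Lp_dual_sum:
  assumes p: "1 \<le> p" and e: "e \<in> Lp_dual p" and "finite I" "\<And>i. i \<in> I \<Longrightarrow> f i \<in> Lp p"
  shows "e (\<lambda>x. \<Sum>i\<in>I. c i * f i x) = (\<Sum>i\<in>I. c i * e (f i))"
  using assms(3,4)
proof (induction I rule: finite_induct)
  case empty
  show ?case using Lp_dual_scale[OF e Lp_zero, of 0] by simp
next
  case (insert i I)
  have "e (\<lambda>x. c i * f i x + (\<Sum>i\<in>I. c i * f i x)) = e (\<lambda>x. c i * f i x) + e (\<lambda>x. \<Sum>i\<in>I. c i * f i x)"
    using insert by (intro Lp_dual_add[OF e] Lp_scale Lp_sum p) auto
  then show ?case using insert by (simp add: Lp_dual_scale[OF e])
qed

lemma Lp_dual_diff: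
  assumes p: "1 \<le> p" and e: "e \<in> Lp_dual p" and f: "f \<in> Lp p" "g \<in> Lp p"
  shows "e (\<lambda>x. f x - g x) = e f - e g"
  using Lp_dual_add[OF e f(1) Lp_scale[OF f(2), of "- 1"]] Lp_dual_scale[OF e f(2), of "- 1"] by simp

lemma
  fixes e :: "(real ^ 'n \<Rightarrow> complex) \<Rightarrow> complex"
  assumes p: "1 \<le> p" and e: "e \<in> Lp_dual p"
  shows Lp_dual_norm_nonneg: "0 \<le> Lp_dual_norm p e"
    and Lp_dual_norm_bound: "f \<in> Lp p \<Longrightarrow> cmod (e f) \<le> Lp_dual_norm p e * Lp_norm p f"
proof -
  have "\<exists>C. \<forall>f\<in>Lp p. cmod (e f) \<le> C * Lp_norm p f" using e by (simp add: Lp_dual_def)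
  then obtain C where C: "\<And>f. f \<in> Lp p \<Longrightarrow> cmod (e f) \<le> C * Lp_norm p f" by blast
  let ?U = "{f \<in> Lp p. Lp_norm p f \<le> 1}"
  have "cmod (e f) \<le> \<bar>C\<bar>" if "f \<in> ?U" for f
  proof -
    have "C * Lp_norm p f \<le> \<bar>C\<bar> * 1" using that Lp_norm_nonneg[of p f] by (intro mult_mono) auto
    then show ?thesis using C[of f] that by simp
  qed
  then have bdd: "bdd_above ((\<lambda>f. cmod (e f)) ` ?U)" by (auto intro!: bdd_aboveI[of _ "\<bar>C\<bar>"])
  have sup: "cmod (e f) \<le> Lp_dual_norm p e" if "f \<in> ?U" for f
    unfolding Lp_dual_norm_def by (rule cSUP_upper[OF that bdd])
  have "Lp_norm p (\<lambda>x::real^'n. 0) = 0" using p by (simp add: Lp_norm_def)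
  then show "0 \<le> Lp_dual_norm p e"
    using order_trans[OF norm_ge_zero sup[of "\<lambda>x. 0"]] by (simp add: Lp_zero)
  show "cmod (e f) \<le> Lp_dual_norm p e * Lp_norm p f" if f: "f \<in> Lp p"
  proof (cases "Lp_norm p f = 0")
    case True
    then show ?thesis using C[OF f] by simp
  next
    case False
    then have n: "0 < Lp_norm p f" using Lp_norm_nonneg[of p f] by simp
    let ?c = "complex_of_real (1 / Lp_norm p f)"
    have "(\<lambda>x. ?c * f x) \<in> Lp p" by (rule Lp_scale[OF f])
    moreover have "Lp_norm p (\<lambda>x. ?c * f x) = 1"
      unfolding Lp_norm_scale[OF p] using n by (simp add: norm_divide)
    ultimately have "(\<lambda>x. ?c * f x) \<in> ?U" by (intro CollectI conjI) simp_all
    from sup[OF this] have "cmod (e f) / Lp_norm p f \<le> Lp_dual_norm p e"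
      using n unfolding Lp_dual_scale[OF e f] by (simp add: norm_mult norm_divide)
    then show ?thesis using n by (simp add: field_simps)
  qed
qed

text \<open>Functionals are given on functions rather than on classes. Boundedness identifies them
  on equivalent functions because the difference has norm 0.\<close>

lemma Lp_dual_cong_AE:
  fixes f g :: "real ^ 'n \<Rightarrow> complex"
  assumes p: "1 \<le> p" and e: "e \<in> Lp_dual p" and f: "f \<in> Lp p" "g \<in> Lp p"
    and eq: "AE x in lborel. f x = g x"
  shows "e f = e g"
proof -
  have "Lp_norm p (\<lambda>x. f x - g x) = Lp_norm p (\<lambda>x::real^'n. 0)"
    using Lp_diff[OF p f] eq by (intro Lp_norm_cong_AE) (auto dest: Lp_measurable)
  also have "\<dots> = 0" using p by (simp add: Lp_norm_def)
  finally have "cmod (e (\<lambda>x. f x - g x)) \<le> 0"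
    using Lp_dual_norm_bound[OF p e Lp_diff[OF p f]] by simp
  then show ?thesis using Lp_dual_diff[OF p e f] by simp
qed

lemma summable_powr_ge_1:
  fixes a :: "nat \<Rightarrow> real"
  assumes a: "\<And>i. 0 \<le> a i" "summable a" and q: "1 \<le> q"
  shows "summable (\<lambda>i. a i powr q)"
proof (rule summable_comparison_test_ev[OF _ a(2)])
  have "\<forall>\<^sub>F i in sequentially. a i < 1"
    using order_tendstoD(2)[OF summable_LIMSEQ_zero[OF a(2)], of 1] by simp
  then show "\<forall>\<^sub>F i in sequentially. norm (a i powr q) \<le> a i"
  proof eventually_elim
    case (elim i)
    then show ?case using powr_mono'[of 1 q "a i"] a(1)[of i] q by simp
  qed
qed

text \<open>The kernel is the complex conjugate of the matrix of the projection onto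
  \<open>G\<close>, cut down to \<open>I\<close> and \<open>J\<close>. With \<open>v\<close> the
  conjugate of \<open>z\<close> extended by 0, the inner sums become conjugates of entries of
  \<open>proj G v\<close>, and Bessel's inequality gives the bound.\<close>

lemma kernel_contraction:
  assumes G: "orthonormal G" and I: "finite I" and J: "finite J"
  shows "(\<Sum>i\<in>I. (cmod (\<Sum>j\<in>J. (\<Sum>g\<in>G. cnj (g i) * g j) * z j))\<^sup>2) \<le> (\<Sum>j\<in>J. (cmod (z j))\<^sup>2)"
proof -
  define v where "v = (\<lambda>j. if j \<in> J then cnj (z j) else 0)"
  have v_l2: "v \<in> l2" and nv: "norm2 v = (\<Sum>j\<in>J. (cmod (z j))\<^sup>2)"
  proof -
    have z: "(cmod (v j))\<^sup>2 = 0" if "j \<notin> J" for j using that by (simp add: v_def)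
    show "v \<in> l2" unfolding l2_def using summable_finite[OF J z] by simp
    show "norm2 v = (\<Sum>j\<in>J. (cmod (z j))\<^sup>2)"
      unfolding norm2_def by (subst suminf_finite[OF J z]) (auto simp: v_def)
  qed
  have ipv: "ip v g = (\<Sum>j\<in>J. cnj (z j) * cnj (g j))" for g
    unfolding ip_def by (subst suminf_finite[OF J]) (auto simp: v_def)
  have "(\<Sum>i\<in>I. (cmod (\<Sum>j\<in>J. (\<Sum>g\<in>G. cnj (g i) * g j) * z j))\<^sup>2)
      = (\<Sum>i\<in>I. (cmod (\<Sum>g\<in>G. ip v g * g i))\<^sup>2)"
  proof (intro sum.cong refl)
    fix i
    have "(\<Sum>j\<in>J. (\<Sum>g\<in>G. cnj (g i) * g j) * z j) = (\<Sum>g\<in>G. \<Sum>j\<in>J. cnj (g i) * g j * z j)"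
      unfolding sum_distrib_right by (rule sum.swap)
    also have "\<dots> = cnj (\<Sum>g\<in>G. ip v g * g i)"
      by (simp add: ipv sum_distrib_left sum_distrib_right mult_ac)
    finally show "(cmod (\<Sum>j\<in>J. (\<Sum>g\<in>G. cnj (g i) * g j) * z j))\<^sup>2 = (cmod (\<Sum>g\<in>G. ip v g * g i))\<^sup>2"
      by (simp only: complex_mod_cnj)
  qed
  also have "\<dots> \<le> norm2 (\<lambda>i. \<Sum>g\<in>G. ip v g * g i)"
    by (rule sum_le_norm2[OF comb_l2[OF G] I])
  also have "\<dots> \<le> norm2 v"
    unfolding norm2_comb[OF G] by (rule bessel[OF G v_l2])
  finally show ?thesis unfolding nv .
qed

lemma hermite_multiplier_span:
  assumes "finite A"
  shows "hermite_multiplier m (\<lambda>x. \<Sum>\<nu>\<in>A. c \<nu> * complex_of_real (hermite_function \<nu> x)) x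
    = (\<Sum>\<nu>\<in>A. m \<nu> * c \<nu> * complex_of_real (hermite_function \<nu> x))"
proof -
  have co: "hermite_coeff (\<lambda>x. \<Sum>\<nu>\<in>A. c \<nu> * complex_of_real (hermite_function \<nu> x)) \<mu>
      = (if \<mu> \<in> A then c \<mu> else 0)" for \<mu>
  proof -
    have "hermite_coeff (\<lambda>x. \<Sum>\<nu>\<in>A. c \<nu> * complex_of_real (hermite_function \<nu> x)) \<mu>
        = (\<Sum>\<nu>\<in>A. if \<nu> = \<mu> then c \<nu> else 0)"
      using assms by (subst hermite_coeff_sum[of 1])
        (auto simp: hermite_coeff_hermite if_distrib[of "\<lambda>x. _ * x"] intro!: hermite_function_Lp cong: if_cong)
    then show ?thesis using assms by simp
  qed
  have "hermite_multiplier m (\<lambda>x. \<Sum>\<nu>\<in>A. c \<nu> * complex_of_real (hermite_function \<nu> x)) x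
      = (\<Sum>\<^sub>\<infinity>\<nu>\<in>A. m \<nu> * c \<nu> * complex_of_real (hermite_function \<nu> x))"
    unfolding hermite_multiplier_def co by (intro infsum_cong_neutral) auto
  then show ?thesis using assms by simp
qed

locale nuclear_hermite_multiplier =
  fixes p r :: real and m :: "nat ^ 'n \<Rightarrow> complex"
    and T :: "(real ^ 'n \<Rightarrow> complex) \<Rightarrow> real ^ 'n \<Rightarrow> complex"
    and e :: "nat \<Rightarrow> (real ^ 'n \<Rightarrow> complex) \<Rightarrow> complex" and y :: "nat \<Rightarrow> real ^ 'n \<Rightarrow> complex"
  assumes p: "1 \<le> p" and r_eq: "1 / r = 1 + \<bar>1 / p - 1 / 2\<bar>"
    and T: "is_hermite_multiplier p m T" and rep: "nuclear_representation p r T e y"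
begin

abbreviation (input) \<phi> :: "nat ^ 'n \<Rightarrow> real ^ 'n \<Rightarrow> complex" where
  "\<phi> \<nu> \<equiv> (\<lambda>x. complex_of_real (hermite_function \<nu> x))"

lemma \<phi>_Lp: "\<phi> \<nu> \<in> Lp p"
  by (rule hermite_function_Lp[OF p])

lemma e_dual: "e i \<in> Lp_dual p" and y_Lp: "y i \<in> Lp p"
  and T_rep: "f \<in> Lp p \<Longrightarrow> (\<lambda>N. Lp_norm p (\<lambda>x. T f x - (\<Sum>i<N. e i f * y i x))) \<longlonglongrightarrow> 0"
  and rep_summable: "summable (\<lambda>i. Lp_dual_norm p (e i) powr r * Lp_norm p (y i) powr r)"
  using rep by (auto simp: nuclear_representation_def)

lemma T_Lp: "f \<in> Lp p \<Longrightarrow> T f \<in> Lp p"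
  using T by (auto simp: is_hermite_multiplier_def Lp_linear_def)

lemma T_span:
  assumes "finite A"
  shows "AE x in lborel. T (\<lambda>x. \<Sum>\<nu>\<in>A. c \<nu> * \<phi> \<nu> x) x = (\<Sum>\<nu>\<in>A. m \<nu> * c \<nu> * \<phi> \<nu> x)"
proof -
  have "(\<lambda>x. \<Sum>\<nu>\<in>A. c \<nu> * \<phi> \<nu> x) \<in> hermite_span" using assms by (auto simp: hermite_span_def)
  then have "AE x in lborel. T (\<lambda>x. \<Sum>\<nu>\<in>A. c \<nu> * \<phi> \<nu> x) x = hermite_multiplier m (\<lambda>x. \<Sum>\<nu>\<in>A. c \<nu> * \<phi> \<nu> x) x"
    using T unfolding is_hermite_multiplier_def by blast
  then show ?thesis by (simp add: hermite_multiplier_span[OF assms])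
qed

lemma T_\<phi>: "AE x in lborel. T (\<phi> \<nu>) x = m \<nu> * \<phi> \<nu> x"
  using T_span[of "{\<nu>}" "\<lambda>_. 1"] by simp

definition \<alpha> :: real where "\<alpha> = max p 2 / (max p 2 - 1)"
definition \<beta> :: real where "\<beta> = min p 2"

text \<open>The reciprocals of \<alpha> and \<beta> are 1/2 and 1/p if \<open>p \<le> 2\<close>, and
  1 - 1/p and 1/2 otherwise. In both cases their sum is 1 + |1/p - 1/2|.\<close>

lemma exponents: "0 < r" "1 < \<alpha>" "\<alpha> \<le> 2" "1 \<le> \<beta>" "\<beta> \<le> 2" "r / \<alpha> + r / \<beta> = 1"
proof -
  have "0 < 1 / r" unfolding r_eq by (simp add: add_pos_nonneg)
  then show r: "0 < r" by simp
  show "1 < \<alpha>" "\<alpha> \<le> 2" by (auto simp: \<alpha>_def field_simps)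
  show "1 \<le> \<beta>" "\<beta> \<le> 2" using p by (auto simp: \<beta>_def)
  have "1 / \<alpha> + 1 / \<beta> = 1 / r"
  proof (cases "p \<le> 2")
    case True
    then have "1 / 2 \<le> 1 / p" using p by (simp add: field_simps)
    then have "1 / r = 1 / p + 1 / 2" unfolding r_eq by simp
    then show ?thesis using True by (simp add: \<alpha>_def \<beta>_def max_absorb2 min_absorb1)
  next
    case False
    then have "1 / p \<le> 1 / 2" using p by (simp add: field_simps)
    then have "1 / r = (1 - 1 / p) + 1 / 2" unfolding r_eq by simp
    moreover have "1 / \<alpha> = 1 - 1 / p" using False by (simp add: \<alpha>_def max_absorb1 diff_divide_distrib)
    ultimately show ?thesis using False by (simp add: \<beta>_def min_absorb2)
  qed
  then have "r * (1 / \<alpha> + 1 / \<beta>) = 1" using r by simp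
  then show "r / \<alpha> + r / \<beta> = 1" by (simp add: distrib_left)
qed

definition d :: "nat \<Rightarrow> real" where "d i = Lp_dual_norm p (e i) * Lp_norm p (y i)"

lemma d_nonneg: "0 \<le> d i"
  unfolding d_def by (intro mult_nonneg_nonneg Lp_dual_norm_nonneg[OF p e_dual] Lp_norm_nonneg)

lemma d_summable: "summable (\<lambda>i. d i powr r)"
  using rep_summable by (simp add: d_def powr_mult)

text \<open>The scalar that shifts weight between functional and vector: it gives \<open>Y i\<close>
  the norm \<open>d i powr (r / \<beta>)\<close>, and since the exponents add up to 1, what remains
  for \<open>E i\<close> is \<open>d i powr (r / \<alpha>)\<close>.\<close>

definition k :: "nat \<Rightarrow> real" where
  "k i = (if d i = 0 then 0 else d i powr (r / \<beta>) / Lp_norm p (y i))"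

text \<open>If \<open>d i = 0\<close>, then \<open>k i = 0\<close> and \<open>E i f = e i f / 0 = 0\<close>.\<close>

definition E :: "nat \<Rightarrow> (real ^ 'n \<Rightarrow> complex) \<Rightarrow> complex" where "E i f = e i f / k i"
definition Y :: "nat \<Rightarrow> real ^ 'n \<Rightarrow> complex" where "Y i = (\<lambda>x. k i * y i x)"

definition A :: "nat \<Rightarrow> real" where "A i = d i powr (r / \<alpha>)"
definition B :: "nat \<Rightarrow> real" where "B i = d i powr (r / \<beta>)"

lemma A_nonneg: "0 \<le> A i" and B_nonneg: "0 \<le> B i"
  by (simp_all add: A_def B_def)

lemma k_nonneg: "0 \<le> k i"
  by (simp add: k_def Lp_norm_nonneg)

lemma y_norm_pos: "d i \<noteq> 0 \<Longrightarrow> 0 < Lp_norm p (y i)"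
  using Lp_norm_nonneg[of p "y i"] by (auto simp: d_def)

lemma k_pos: "d i \<noteq> 0 \<Longrightarrow> 0 < k i"
  using y_norm_pos[of i] by (simp add: k_def)

lemma Y_Lp: "Y i \<in> Lp p"
  unfolding Y_def by (rule Lp_scale[OF y_Lp])

lemma Y_norm: "Lp_norm p (Y i) = B i"
  unfolding Y_def Lp_norm_scale[OF p] using y_norm_pos[of i] k_nonneg[of i]
  by (cases "d i = 0") (auto simp: k_def B_def norm_divide)

lemma E_bound:
  assumes f: "f \<in> Lp p" shows "cmod (E i f) \<le> A i * Lp_norm p f"
proof (cases "d i = 0")
  case False
  have "d i powr 1 = d i powr (r / \<alpha>) * d i powr (r / \<beta>)"
    unfolding powr_add[symmetric] exponents(6) ..
  then have "Lp_dual_norm p (e i) / k i = A i"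
    using False y_norm_pos[OF False] d_nonneg[of i] by (simp add: k_def A_def d_def[symmetric] field_simps)
  moreover have "cmod (E i f) \<le> Lp_dual_norm p (e i) * Lp_norm p f / k i"
    unfolding E_def using Lp_dual_norm_bound[OF p e_dual f] k_pos[OF False]
    by (simp add: norm_divide divide_right_mono)
  ultimately show ?thesis by (simp add: mult.commute flip: times_divide_eq_right)
qed (simp add: E_def k_def A_def)

lemma E_sum:
  assumes "finite I" "\<And>i. i \<in> I \<Longrightarrow> f i \<in> Lp p"
  shows "E j (\<lambda>x. \<Sum>i\<in>I. c i * f i x) = (\<Sum>i\<in>I. c i * E j (f i))"
  unfolding E_def using Lp_dual_sum[OF p e_dual assms] by (simp add: sum_divide_distrib)

lemma E_diff: "f \<in> Lp p \<Longrightarrow> g \<in> Lp p \<Longrightarrow> E i (\<lambda>x. f x - g x) = E i f - E i g"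
  by (simp add: E_def Lp_dual_diff[OF p e_dual] diff_divide_distrib)

lemma E_scale: "f \<in> Lp p \<Longrightarrow> E i (\<lambda>x. c * f x) = c * E i f"
  by (simp add: E_def Lp_dual_scale[OF e_dual])

lemma E_cong_AE: "f \<in> Lp p \<Longrightarrow> g \<in> Lp p \<Longrightarrow> AE x in lborel. f x = g x \<Longrightarrow> E i f = E i g"
  unfolding E_def using Lp_dual_cong_AE[OF p e_dual] by metis

text \<open>If \<open>d i = 0\<close>, the functional or the vector has norm 0, and the term was
  already zero almost everywhere; otherwise \<open>k i\<close> cancels.\<close>

lemma EY_term: assumes f: "f \<in> Lp p" shows "AE x in lborel. E i f * Y i x = e i f * y i x"
proof (cases "d i = 0")
  case True
  then consider "Lp_dual_norm p (e i) = 0" | "Lp_norm p (y i) = 0" by (auto simp: d_def)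
  then show ?thesis
  proof cases
    case 1
    then have "e i f = 0" using Lp_dual_norm_bound[OF p e_dual f, of i] by simp
    then show ?thesis using True by (simp add: E_def k_def)
  next
    case 2
    from Lp_norm_eq_0[OF p y_Lp 2] show ?thesis
      by eventually_elim (use True in \<open>simp add: E_def k_def\<close>)
  qed
qed (use k_pos[of i] in \<open>simp add: E_def Y_def\<close>)

text \<open>Hence the diagonal of the matrix carries the trace of the given representation.\<close>

lemma EY_diagonal: "E i (Y i) = e i (y i)"
proof (cases "d i = 0")
  case True
  have "cmod (e i (y i)) \<le> d i"
    unfolding d_def by (rule Lp_dual_norm_bound[OF p e_dual y_Lp])
  then show ?thesis using True by (simp add: E_def k_def)
qed (use k_pos[of i] in \<open>simp add: E_def Y_def Lp_dual_scale[OF e_dual y_Lp]\<close>)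

lemma T_rep_EY:
  assumes f: "f \<in> Lp p"
  shows "(\<lambda>N. Lp_norm p (\<lambda>x. T f x - (\<Sum>i<N. E i f * Y i x))) \<longlonglongrightarrow> 0"
proof -
  have "Lp_norm p (\<lambda>x. T f x - (\<Sum>i<N. E i f * Y i x)) = Lp_norm p (\<lambda>x. T f x - (\<Sum>i<N. e i f * y i x))" for N
  proof (rule Lp_norm_cong_AE)
    have "AE x in lborel. \<forall>i\<in>{..<N}. E i f * Y i x = e i f * y i x"
      using EY_term[OF f] by (intro AE_finite_allI) auto
    then show "AE x in lborel. T f x - (\<Sum>i<N. E i f * Y i x) = T f x - (\<Sum>i<N. e i f * y i x)"
      by eventually_elim auto
    have "(\<lambda>x. T f x - (\<Sum>i<N. E i f * Y i x)) \<in> Lp p" "(\<lambda>x. T f x - (\<Sum>i<N. e i f * y i x)) \<in> Lp p"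
      by (intro Lp_diff Lp_sum p T_Lp f y_Lp Y_Lp; simp)+
    then show "(\<lambda>x. T f x - (\<Sum>i<N. E i f * Y i x)) \<in> borel_measurable lborel"
      "(\<lambda>x. T f x - (\<Sum>i<N. e i f * y i x)) \<in> borel_measurable lborel"
      by (simp_all only: Lp_measurable)
  qed
  then show ?thesis using T_rep[OF f] by simp
qed

text \<open>The intertwining relation: \<open>E i\<close> is continuous and passes through the
  series for \<open>T f\<close>.\<close>

lemma E_T_sums:
  assumes f: "f \<in> Lp p" shows "(\<lambda>j. E j f * E i (Y j)) sums E i (T f)"
proof -
  have "(\<lambda>N. E i (T f) - (\<Sum>j<N. E j f * E i (Y j))) \<longlonglongrightarrow> 0"
  proof (rule Lim_null_comparison)
    have L: "(\<lambda>x. \<Sum>j<N. E j f * Y j x) \<in> Lp p" for N by (intro Lp_sum p Y_Lp) simp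
    have "E i (\<lambda>x. T f x - (\<Sum>j<N. E j f * Y j x)) = E i (T f) - (\<Sum>j<N. E j f * E i (Y j))" for N
      using E_diff[OF T_Lp[OF f] L] E_sum[of "{..<N}" Y i "\<lambda>j. E j f"] Y_Lp by simp
    then show "\<forall>\<^sub>F N in sequentially. norm (E i (T f) - (\<Sum>j<N. E j f * E i (Y j)))
        \<le> A i * Lp_norm p (\<lambda>x. T f x - (\<Sum>j<N. E j f * Y j x))"
      using E_bound[OF Lp_diff[OF p T_Lp[OF f] L]] by (metis (no_types, lifting) always_eventually)
    show "(\<lambda>N. A i * Lp_norm p (\<lambda>x. T f x - (\<Sum>j<N. E j f * Y j x))) \<longlonglongrightarrow> 0"
      by (intro tendsto_mult_right_zero T_rep_EY f)
  qed
  from tendsto_diff[OF tendsto_const[of "E i (T f)"] this] show ?thesis by (simp add: sums_def)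
qed

lemma A_powr: "A i powr \<alpha> = d i powr r" and B_powr: "B i powr \<beta> = d i powr r"
  using exponents by (simp_all add: A_def B_def powr_powr)

text \<open>As \<open>q\<close> is at most 2, the square is a power with exponent
  \<open>2 / q\<close>, at least 1, of the summable \<open>d i powr r\<close>.\<close>

lemma square_summable: "summable (\<lambda>i. (d i powr (r / q))\<^sup>2)" if "1 \<le> q" "q \<le> 2" for q
proof -
  have "summable (\<lambda>i. (d i powr r) powr (2 / q))"
    using that by (intro summable_powr_ge_1 d_summable) auto
  moreover have "(d i powr (r / q))\<^sup>2 = (d i powr r) powr (2 / q)" for i
    using that by (simp add: powr_powr mult.commute flip: powr_numeral)
  ultimately show ?thesis by simp
qed

text \<open>The source of the uniform tail estimate. The projection is transferred from sequences to
  functions: the projected diagonal sums to the series of the \<open>E i (F i)\<close>, with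
  \<open>F i\<close> a combination of the \<open>Y j\<close>. \<open>kernel_contraction\<close>
  compares the square functions at every point, \<open>mixed_norm_bound\<close> converts this into
  norms of the \<open>F i\<close>, and \<open>young_sum_bound\<close> pairs them with the
  \<open>A i\<close>. The size of \<open>G\<close> does not enter.\<close>

lemma projection_sum_bound:
  assumes G: "orthonormal G" and J: "finite J"
  shows "cmod (\<Sum>j\<in>J. proj G (\<lambda>i. E i (Y j)) j)
    \<le> (\<Sum>j\<in>J. d j powr r) powr (1 / \<beta>) * ((\<Sum>i. d i powr r) + 1)"
proof -
  \<comment> \<open>\<open>mixed_norm_bound\<close> divides by the \<open>B j\<close>; the columns
    left out here are zero.\<close>
  define J' where "J' = {j\<in>J. d j \<noteq> 0}"
  have J': "finite J'" "J' \<subseteq> J" using J by (auto simp: J'_def)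
  define X where "X = (\<lambda>i j. \<Sum>g\<in>G. cnj (g i) * g j)"
  define F where "F = (\<lambda>i x. \<Sum>j\<in>J'. X i j * Y j x)"
  have F_Lp: "F i \<in> Lp p" for i unfolding F_def by (intro Lp_sum p J' Y_Lp)
  \<comment> \<open>Chosen so that \<open>\<tau> powr max p 2\<close> is the right-hand side
    supplied by \<open>mixed_norm_bound\<close>.\<close>
  define \<tau> where "\<tau> = (\<Sum>j\<in>J. d j powr r) powr (1 / \<beta>)"
  have J'_sum: "(\<Sum>j\<in>J'. B j powr \<beta>) = (\<Sum>j\<in>J. d j powr r)"
    unfolding B_powr J'_def using J exponents by (intro sum.mono_neutral_left) auto
  have s_l2: "(\<lambda>i. E i (Y j)) \<in> l2" for j
  proof -
    have "summable (\<lambda>i. (A i)\<^sup>2 * (B j)\<^sup>2)"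
      using square_summable[of \<alpha>] exponents by (intro summable_mult2) (auto simp: A_def)
    moreover have "norm ((cmod (E i (Y j)))\<^sup>2) \<le> (A i)\<^sup>2 * (B j)\<^sup>2" for i
      using power_mono[OF E_bound[OF Y_Lp[of j]], of i 2] by (simp add: Y_norm power_mult_distrib)
    ultimately have "summable (\<lambda>i. (cmod (E i (Y j)))\<^sup>2)"
      by (intro summable_comparison_test[of "\<lambda>i. (cmod (E i (Y j)))\<^sup>2" "\<lambda>i. (A i)\<^sup>2 * (B j)\<^sup>2"]) auto
    then show ?thesis by (simp add: l2_def)
  qed
  have "(\<Sum>j\<in>J. proj G (\<lambda>i. E i (Y j)) j) = (\<Sum>j\<in>J'. proj G (\<lambda>i. E i (Y j)) j)"
  proof (rule sum.mono_neutral_right[OF J J'(2)], rule ballI)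
    fix j assume "j \<in> J - J'"
    then have "B j = 0" using exponents by (auto simp: J'_def B_def)
    then have "E i (Y j) = 0" for i using E_bound[OF Y_Lp[of j], of i] by (simp add: Y_norm)
    then show "proj G (\<lambda>i. E i (Y j)) j = 0" by (simp add: proj_def ip_zero_left)
  qed
  \<comment> \<open>Each \<open>ip\<close> is a series over \<open>i\<close>; linearity of
    \<open>E i\<close> gathers the finitely many terms for fixed \<open>i\<close> into one
    function.\<close>
  moreover have "(\<lambda>i. E i (F i)) sums (\<Sum>j\<in>J'. proj G (\<lambda>i. E i (Y j)) j)"
  proof -
    have "(\<lambda>i. \<Sum>j\<in>J'. \<Sum>g\<in>G. (E i (Y j) * cnj (g i)) * g j) sums (\<Sum>j\<in>J'. \<Sum>g\<in>G. ip (\<lambda>i. E i (Y j)) g * g j)"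
      unfolding ip_def using G s_l2
      by (intro sums_sum sums_mult2 summable_sums ip_summable) (auto simp: orthonormal_def)
    moreover have "(\<Sum>j\<in>J'. \<Sum>g\<in>G. (E i (Y j) * cnj (g i)) * g j) = E i (F i)" for i
      unfolding F_def using E_sum[OF J'(1) Y_Lp, where c = "X i" and j = i]
      by (simp add: X_def sum_distrib_left sum_distrib_right mult_ac)
    ultimately show ?thesis by (simp add: proj_def)
  qed
  moreover have "cmod (\<Sum>i<I. E i (F i)) \<le> \<tau> * ((\<Sum>i. d i powr r) + 1)" for I
  proof -
    have mixed: "(\<Sum>i<I. (LINT x|lborel. cmod (F i x) powr p) powr (max p 2 / p))
        \<le> (\<Sum>j\<in>J'. B j powr min p 2) powr (max p 2 / min p 2)"
    proof (rule mixed_norm_bound[OF p])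
      show "(\<Sum>i<I. (cmod (F i x))\<^sup>2) \<le> (\<Sum>j\<in>J'. (cmod (Y j x))\<^sup>2)" for x
        unfolding F_def X_def by (rule kernel_contraction[OF G _ J'(1)]) simp
      show "0 < B j" if "j \<in> J'" for j using that by (auto simp: J'_def B_def)
      show "(LINT x|lborel. cmod (Y j x) powr p) \<le> B j powr p" for j
        using Lp_power_norm[OF p, of "Y j"] by (simp add: Y_norm Lp_power_def)
    qed (use J'(1) Lp_measurable[OF F_Lp] Lp_measurable[OF Y_Lp]
        Lp_integrable[OF F_Lp] Lp_integrable[OF Y_Lp] in auto)
    have t: "(\<Sum>i<I. Lp_norm p (F i) powr max p 2) \<le> \<tau> powr max p 2"
    proof -
      have "(LINT x|lborel. cmod (F i x) powr p) powr (max p 2 / p) = Lp_norm p (F i) powr max p 2" for i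
        using p by (simp add: Lp_norm_def powr_powr)
      then show ?thesis
        using mixed J'_sum by (simp add: \<tau>_def powr_powr flip: \<beta>_def)
    qed
    have "cmod (\<Sum>i<I. E i (F i)) \<le> (\<Sum>i<I. A i * Lp_norm p (F i))"
      by (intro sum_norm_le E_bound F_Lp)
    also have "\<dots> \<le> \<tau> * ((\<Sum>i<I. A i powr \<alpha>) + 1)"
      unfolding \<alpha>_def using t
      by (intro young_sum_bound) (auto simp: A_nonneg Lp_norm_nonneg \<tau>_def)
    also have "\<dots> \<le> \<tau> * ((\<Sum>i. d i powr r) + 1)"
      unfolding A_powr by (intro mult_left_mono add_right_mono sum_le_suminf d_summable) (auto simp: \<tau>_def)
    finally show ?thesis .
  qed
  ultimately show ?thesis
    unfolding \<tau>_def sums_def by (intro Lim_norm_ubound[of sequentially "\<lambda>I. \<Sum>i<I. E i (F i)"]) auto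
qed

sublocale diagonal_model "\<lambda>j i. E i (Y j)" A B "\<lambda>\<nu> i. E i (\<phi> \<nu>)" m
proof
  show "0 \<le> A i" "0 \<le> B i" for i by (fact A_nonneg B_nonneg)+
  show "summable (\<lambda>i. (A i)\<^sup>2)" "summable (\<lambda>i. (B i)\<^sup>2)"
    unfolding A_def B_def using exponents by (auto intro: square_summable)
  show "cmod (E i (Y j)) \<le> A i * B j" for i j
    using E_bound[OF Y_Lp[of j], of i] by (simp add: Y_norm)
  have A2: "summable (\<lambda>i. (A i)\<^sup>2)" unfolding A_def using exponents by (auto intro: square_summable)
  have E_square: "(\<lambda>i. E i f) \<in> l2 \<and> norm2 (\<lambda>i. E i f) \<le> (\<Sum>i. (A i)\<^sup>2) * (Lp_norm p f)\<^sup>2" if f: "f \<in> Lp p" for f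
  proof -
    have le: "(cmod (E i f))\<^sup>2 \<le> (A i)\<^sup>2 * (Lp_norm p f)\<^sup>2" for i
      using power_mono[OF E_bound[OF f], of i 2] by (simp add: power_mult_distrib)
    have s: "summable (\<lambda>i. (A i)\<^sup>2 * (Lp_norm p f)\<^sup>2)" using A2 by (rule summable_mult2)
    have s': "summable (\<lambda>i. (cmod (E i f))\<^sup>2)"
      by (rule summable_comparison_test[OF _ s]) (use le in auto)
    moreover have "norm2 (\<lambda>i. E i f) \<le> (\<Sum>i. (A i)\<^sup>2 * (Lp_norm p f)\<^sup>2)"
      unfolding norm2_def by (rule suminf_le[OF le s' s])
    ultimately show ?thesis using A2 by (simp add: l2_def suminf_mult2)
  qed
  show "(\<lambda>i. E i (\<phi> \<nu>)) \<in> l2" for \<nu> using E_square[OF \<phi>_Lp] by blast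
  show "(\<lambda>j. E j (\<phi> \<nu>) * E i (Y j)) sums (m \<nu> * E i (\<phi> \<nu>))" for \<nu> i
    using E_T_sums[OF \<phi>_Lp, of \<nu> i] E_cong_AE[OF T_Lp[OF \<phi>_Lp] Lp_scale[OF \<phi>_Lp] T_\<phi>, of i \<nu>]
    by (simp add: E_scale[OF \<phi>_Lp])
  \<comment> \<open>A relation says that every \<open>E i\<close> vanishes on \<open>h\<close>. Then
    all partial sums of the series for \<open>T h\<close> are 0, so \<open>T h\<close> vanishes
    almost everywhere, and orthonormality isolates the coefficients
    \<open>m \<nu> * c \<nu>\<close>.\<close>
  show "c \<nu> * m \<nu> = 0" if F: "finite F" "\<And>i. (\<Sum>\<nu>\<in>F. c \<nu> * E i (\<phi> \<nu>)) = 0" "\<nu> \<in> F" for F c \<nu>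
  proof -
    define h where "h = (\<lambda>x. \<Sum>\<nu>\<in>F. c \<nu> * \<phi> \<nu> x)"
    have h: "h \<in> Lp p" unfolding h_def by (intro Lp_sum p F \<phi>_Lp)
    have "E i h = 0" for i unfolding h_def using E_sum[OF F(1) \<phi>_Lp] F(2) by simp
    then have "Lp_norm p (T h) = 0" using T_rep_EY[OF h] by (simp add: LIMSEQ_const_iff)
    from Lp_norm_eq_0[OF p T_Lp[OF h] this]
    have "AE x in lborel. (\<Sum>\<nu>\<in>F. (m \<nu> * c \<nu>) * \<phi> \<nu> x) = 0"
      using T_span[OF F(1), of c] unfolding h_def by eventually_elim simp
    moreover have L: "(\<lambda>x. \<Sum>\<nu>\<in>F. (m \<nu> * c \<nu>) * \<phi> \<nu> x) \<in> Lp p" by (intro Lp_sum p F \<phi>_Lp)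
    ultimately have "hermite_coeff (\<lambda>x. \<Sum>\<nu>\<in>F. (m \<nu> * c \<nu>) * \<phi> \<nu> x) \<nu> = hermite_coeff (\<lambda>x. 0) \<nu>"
      using Lp_measurable[OF L] by (intro hermite_coeff_cong_AE) auto
    moreover have "hermite_coeff (\<lambda>x. \<Sum>\<nu>\<in>F. (m \<nu> * c \<nu>) * \<phi> \<nu> x) \<nu> = (\<Sum>\<kappa>\<in>F. if \<kappa> = \<nu> then m \<kappa> * c \<kappa> else 0)"
      unfolding hermite_coeff_sum[OF p F(1) \<phi>_Lp] by (intro sum.cong) (auto simp: hermite_coeff_hermite)
    ultimately show ?thesis using F by (simp add: hermite_coeff_def mult.commute)
  qed
  show "\<exists>F c. finite F \<and> norm2 (\<lambda>i. E i (Y j) - (\<Sum>\<nu>\<in>F. c \<nu> * E i (\<phi> \<nu>))) < \<epsilon>" if \<epsilon>: "0 < \<epsilon>" for j \<epsilon>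
  proof -
    define S where "S = (\<Sum>i. (A i)\<^sup>2)"
    have S: "0 \<le> S" unfolding S_def by (intro suminf_nonneg A2) simp
    \<comment> \<open>Makes \<open>(S + 1) * \<delta>\<^sup>2\<close> equal to \<epsilon>; the added
      1 allows \<open>S = 0\<close>.\<close>
    define \<delta> where "\<delta> = sqrt (\<epsilon> / (S + 1))"
    have \<delta>: "0 < \<delta>" using \<epsilon> S by (simp add: \<delta>_def)
    obtain g where g: "g \<in> hermite_span" "Lp_norm p (\<lambda>x. Y j x - g x) < \<delta>"
      using hermite_span_dense_norm[OF p Y_Lp \<delta>] by blast
    obtain F c where F: "finite F" "g = (\<lambda>x. \<Sum>\<nu>\<in>F. c \<nu> * \<phi> \<nu> x)"
      using g(1) by (auto simp: hermite_span_def)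
    have gL: "g \<in> Lp p" using g hermite_span_Lp[OF p] by auto
    have "E i (Y j) - (\<Sum>\<nu>\<in>F. c \<nu> * E i (\<phi> \<nu>)) = E i (\<lambda>x. Y j x - g x)" for i
      using E_diff[OF Y_Lp gL] E_sum[OF F(1) \<phi>_Lp] by (simp add: F(2))
    then have "norm2 (\<lambda>i. E i (Y j) - (\<Sum>\<nu>\<in>F. c \<nu> * E i (\<phi> \<nu>))) \<le> S * (Lp_norm p (\<lambda>x. Y j x - g x))\<^sup>2"
      using E_square[OF Lp_diff[OF p Y_Lp gL]] by (simp add: S_def)
    also have "\<dots> \<le> S * \<delta>\<^sup>2"
      using S g(2) Lp_norm_nonneg by (intro mult_left_mono power_mono) auto
    also have "\<dots> < (S + 1) * \<delta>\<^sup>2" using \<delta> by (intro mult_strict_right_mono) auto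
    also have "\<dots> = \<epsilon>" using \<epsilon> S by (simp add: \<delta>_def)
    finally show ?thesis using F(1) by blast
  qed
  show "\<exists>N0. \<forall>N\<ge>N0. \<forall>M G. orthonormal G \<longrightarrow> cmod (\<Sum>j\<in>{N..<M}. proj G (\<lambda>i. E i (Y j)) j) \<le> \<epsilon>"
    if \<epsilon>: "0 < \<epsilon>" for \<epsilon>
  proof -
    define K where "K = (\<Sum>i. d i powr r) + 1"
    have K: "0 < K" unfolding K_def using suminf_nonneg[OF d_summable] by (simp add: add_nonneg_pos)
    \<comment> \<open>Chosen so that \<open>\<delta> powr (1 / \<beta>) * K\<close> is
      \<epsilon>.\<close>
    define \<delta> where "\<delta> = (\<epsilon> / K) powr \<beta>"
    have \<delta>: "0 < \<delta>" using \<epsilon> K by (simp add: \<delta>_def)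
    obtain N0 where N0: "\<And>N M. N \<ge> N0 \<Longrightarrow> norm (\<Sum>j\<in>{N..<M}. d j powr r) < \<delta>"
      using d_summable \<delta> unfolding summable_Cauchy by blast
    have "cmod (\<Sum>j\<in>{N..<M}. proj G (\<lambda>i. E i (Y j)) j) \<le> \<epsilon>" if "N \<ge> N0" "orthonormal G" for N M G
    proof -
      have "(\<Sum>j\<in>{N..<M}. d j powr r) powr (1 / \<beta>) \<le> \<delta> powr (1 / \<beta>)"
        using N0[OF that(1), of M] exponents by (intro powr_mono2) (auto intro: sum_nonneg)
      also have "\<dots> = \<epsilon> / K" using \<epsilon> K exponents by (simp add: \<delta>_def powr_powr)
      finally have "(\<Sum>j\<in>{N..<M}. d j powr r) powr (1 / \<beta>) * K \<le> \<epsilon> / K * K"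
        using K by (intro mult_right_mono) auto
      then show ?thesis using projection_sum_bound[OF that(2), of "{N..<M}"] K by (simp add: K_def)
    qed
    then show ?thesis by blast
  qed
qed

lemma trace_sums: "(\<lambda>i. e i (y i)) sums (\<Sum>i. e i (y i))"
  and symbol_has_sum: "(m has_sum (\<Sum>i. e i (y i))) UNIV"
  using diagonal_summable trace_has_sum by (simp_all add: EY_diagonal summable_sums)

end

section \<open>Eigenvalues\<close>

text \<open>Beyond a suitable finite set, inserting one more index changes the sum by less than
  \<open>cmod \<mu>\<close>. An infinite level set always offers a new index that changes it by
  exactly that amount.\<close>

lemma has_sum_finite_level_set:
  fixes m :: "'a \<Rightarrow> complex"
  assumes "(m has_sum t) UNIV" "\<mu> \<noteq> 0"
  shows "finite {\<nu>. m \<nu> = \<mu>}"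
proof (rule ccontr)
  assume inf: "infinite {\<nu>. m \<nu> = \<mu>}"
  have "\<forall>\<^sub>F X in finite_subsets_at_top UNIV. dist (sum m X) t < cmod \<mu> / 2"
    using assms unfolding has_sum_def by (intro tendstoD) auto
  then obtain X where X: "finite X" "\<And>Z. finite Z \<Longrightarrow> X \<subseteq> Z \<Longrightarrow> dist (sum m Z) t < cmod \<mu> / 2"
    unfolding eventually_finite_subsets_at_top by auto
  obtain \<nu> where \<nu>: "m \<nu> = \<mu>" "\<nu> \<notin> X"
    using inf X(1) by (metis (mono_tags, lifting) mem_Collect_eq rev_finite_subset subsetI)
  have "\<mu> = sum m (insert \<nu> X) - sum m X" using X(1) \<nu> by simp
  then have "cmod \<mu> \<le> dist (sum m (insert \<nu> X)) t + dist (sum m X) t"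
    using dist_triangle2[of "sum m (insert \<nu> X)" "sum m X" t] by (simp add: dist_norm)
  also have "\<dots> < cmod \<mu>" using X(2)[OF _ subset_insertI, of \<nu>] X(2)[OF X(1) order_refl] X(1) by simp
  finally show False by simp
qed

text \<open>Bijections between the level sets of nonzero values glue to one bijection between the
  supports. The numbers of zero terms may differ without affecting an unconditional sum.\<close>

lemma has_sum_same_multiplicities:
  fixes m :: "'a \<Rightarrow> complex" and l :: "'b \<Rightarrow> complex"
  assumes card: "\<And>\<mu>. \<mu> \<noteq> 0 \<Longrightarrow> finite {i. l i = \<mu>} \<and> finite {\<nu>. m \<nu> = \<mu>} \<and> card {i. l i = \<mu>} = card {\<nu>. m \<nu> = \<mu>}"
    and m: "(m has_sum t) UNIV"
  shows "(l has_sum t) UNIV"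
proof -
  have "\<forall>\<mu>. \<mu> \<noteq> 0 \<longrightarrow> (\<exists>g. bij_betw g {i. l i = \<mu>} {\<nu>. m \<nu> = \<mu>})"
    using card finite_same_card_bij by blast
  then obtain g where g: "\<And>\<mu>. \<mu> \<noteq> 0 \<Longrightarrow> bij_betw (g \<mu>) {i. l i = \<mu>} {\<nu>. m \<nu> = \<mu>}" by metis
  define f where "f i = g (l i) i" for i
  have mf: "m (f i) = l i" if "l i \<noteq> 0" for i
    using bij_betwE[OF g[OF that]] by (auto simp: f_def)
  have "bij_betw f {i. l i \<noteq> 0} {\<nu>. m \<nu> \<noteq> 0}"
    unfolding bij_betw_def
  proof
    show "inj_on f {i. l i \<noteq> 0}"
    proof (rule inj_onI)
      fix i j assume ij: "i \<in> {i. l i \<noteq> 0}" "j \<in> {i. l i \<noteq> 0}" and eq: "f i = f j"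
      have "l i = l j" using mf[of i] mf[of j] ij eq by simp
      then show "i = j" using eq ij bij_betw_imp_inj_on[OF g[of "l i"]] by (auto simp: f_def inj_on_def)
    qed
    show "f ` {i. l i \<noteq> 0} = {\<nu>. m \<nu> \<noteq> 0}"
    proof
      show "f ` {i. l i \<noteq> 0} \<subseteq> {\<nu>. m \<nu> \<noteq> 0}" using mf by auto
      show "{\<nu>. m \<nu> \<noteq> 0} \<subseteq> f ` {i. l i \<noteq> 0}"
      proof
        fix \<nu> assume "\<nu> \<in> {\<nu>. m \<nu> \<noteq> 0}"
        then have n: "m \<nu> \<noteq> 0" by simp
        have "\<nu> \<in> g (m \<nu>) ` {i. l i = m \<nu>}" using bij_betw_imp_surj_on[OF g[OF n]] by simp
        then obtain i where "l i = m \<nu>" "\<nu> = g (m \<nu>) i" by auto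
        then show "\<nu> \<in> f ` {i. l i \<noteq> 0}" using n by (auto simp: f_def intro!: image_eqI[of _ _ i])
      qed
    qed
  qed
  then have "((\<lambda>i. m (f i)) has_sum t) {i. l i \<noteq> 0} \<longleftrightarrow> (m has_sum t) {\<nu>. m \<nu> \<noteq> 0}"
    by (rule has_sum_reindex_bij_betw)
  moreover have "(m has_sum t) {\<nu>. m \<nu> \<noteq> 0}"
    using m by (subst has_sum_cong_neutral[of UNIV _ m m]) auto
  moreover have "((\<lambda>i. m (f i)) has_sum t) {i. l i \<noteq> 0} \<longleftrightarrow> (l has_sum t) UNIV"
    using mf by (intro has_sum_cong_neutral) auto
  ultimately show ?thesis by simp
qed

text \<open>The change of basis matrices \<open>P\<close> and \<open>Q\<close> satisfy \<open>P Q = 1\<close> and \<open>Q P = 1\<close>, so the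
  dimensions agree because \<open>P Q\<close> and \<open>Q P\<close> have the same trace.\<close>

lemma has_dim_ae_unique:
  fixes V :: "(real ^ 'n \<Rightarrow> complex) set"
  assumes "has_dim_ae V d" "has_dim_ae V d'"
  shows "d = d'"
proof -
  obtain b where b: "\<And>i. i < d \<Longrightarrow> b i \<in> V"
    "\<And>c. AE x in lborel. (\<Sum>i<d. c i * b i x) = 0 \<Longrightarrow> \<forall>i<d. c i = 0"
    "\<And>f. f \<in> V \<Longrightarrow> \<exists>c. AE x in lborel. f x = (\<Sum>i<d. c i * b i x)"
    using assms(1) unfolding has_dim_ae_def by blast
  obtain b' where b': "\<And>i. i < d' \<Longrightarrow> b' i \<in> V"
    "\<And>c. AE x in lborel. (\<Sum>i<d'. c i * b' i x) = 0 \<Longrightarrow> \<forall>i<d'. c i = 0"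
    "\<And>f. f \<in> V \<Longrightarrow> \<exists>c. AE x in lborel. f x = (\<Sum>i<d'. c i * b' i x)"
    using assms(2) unfolding has_dim_ae_def by blast
  have "\<forall>i. \<exists>c. i < d \<longrightarrow> (AE x in lborel. b i x = (\<Sum>j<d'. c j * b' j x))" using b(1) b'(3) by blast
  then obtain P where P: "\<And>i. i < d \<Longrightarrow> AE x in lborel. b i x = (\<Sum>j<d'. P i j * b' j x)" by metis
  have "\<forall>j. \<exists>c. j < d' \<longrightarrow> (AE x in lborel. b' j x = (\<Sum>i<d. c i * b i x))" using b'(1) b(3) by blast
  then obtain Q where Q: "\<And>j. j < d' \<Longrightarrow> AE x in lborel. b' j x = (\<Sum>i<d. Q j i * b i x)" by metis
  \<comment> \<open>Stated for arbitrary families and matrices, so that exchanging the two bases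
    gives the diagonals of both products.\<close>
  have inverse: "(\<Sum>j<n'. P i j * Q j i) = (1 :: complex)"
    if ind: "\<And>c. AE x in lborel. (\<Sum>i<n. c i * b i x) = 0 \<Longrightarrow> \<forall>i<n. c i = 0"
      and P: "\<And>i. i < n \<Longrightarrow> AE x in lborel. b i x = (\<Sum>j<n'. P i j * b' j x)"
      and Q: "\<And>j. j < n' \<Longrightarrow> AE x in lborel. b' j x = (\<Sum>i<n. Q j i * b i x)"
      and i: "i < n" for n n' i P Q and b b' :: "nat \<Rightarrow> real ^ 'n \<Rightarrow> complex"
  proof -
    have "AE x in lborel. \<forall>j\<in>{..<n'}. b' j x = (\<Sum>i<n. Q j i * b i x)"
      using Q by (intro AE_finite_allI) auto
    with P[OF i] have "AE x in lborel. (\<Sum>k<n. ((\<Sum>j<n'. P i j * Q j k) - (if k = i then 1 else 0)) * b k x) = 0"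
    proof eventually_elim
      case (elim x)
      have "b i x = (\<Sum>j<n'. \<Sum>k<n. P i j * Q j k * b k x)"
        using elim by (simp add: sum_distrib_left mult.assoc)
      also have "\<dots> = (\<Sum>k<n. (\<Sum>j<n'. P i j * Q j k) * b k x)"
        by (subst sum.swap) (simp add: sum_distrib_right)
      finally have "b i x = (\<Sum>k<n. (\<Sum>j<n'. P i j * Q j k) * b k x)" .
      moreover have "(\<Sum>k<n. (if k = i then 1 else 0) * b k x) = b i x"
        using i by (simp add: if_distrib[of "\<lambda>z. z * _"] cong: if_cong)
      ultimately show ?case by (simp add: left_diff_distrib sum_subtractf)
    qed
    from ind[OF this] i show ?thesis by auto
  qed
  have "of_nat d = (\<Sum>i<d. \<Sum>j<d'. P i j * Q j i)"
    using inverse[OF b(2) P Q] by simp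
  also have "\<dots> = (\<Sum>j<d'. \<Sum>i<d. Q j i * P i j)"
    by (subst sum.swap) (simp add: mult.commute)
  also have "\<dots> = of_nat d'"
    using inverse[OF b'(2) Q P] by simp
  finally show ?thesis by (simp only: of_nat_eq_iff)
qed

section \<open>The spectrum of the multiplier\<close>

context nuclear_hermite_multiplier
begin

lemma T_diff:
  assumes f: "f \<in> Lp p" and g: "g \<in> Lp p"
  shows "AE x in lborel. T (\<lambda>x. f x - g x) x = T f x - T g x"
proof -
  have add: "\<forall>f\<in>Lp p. \<forall>g\<in>Lp p. AE x in lborel. T (\<lambda>x. f x + g x) x = T f x + T g x"
    and scale: "\<forall>c. \<forall>f\<in>Lp p. AE x in lborel. T (\<lambda>x. c * f x) x = c * T f x"
    using T by (simp_all add: is_hermite_multiplier_def Lp_linear_def)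
  have "AE x in lborel. T (\<lambda>x. f x + - 1 * g x) x = T f x + T (\<lambda>x. - 1 * g x) x"
    by (rule add[rule_format, OF f Lp_scale[OF g]])
  moreover have "AE x in lborel. T (\<lambda>x. - 1 * g x) x = - 1 * T g x"
    by (rule scale[rule_format, OF g])
  ultimately show ?thesis by eventually_elim simp
qed

text \<open>Both sides are linear and continuous in \<open>f\<close> and agree on the dense span;
  \<open>L\<close> is their difference.\<close>

lemma hermite_coeff_T:
  assumes f: "f \<in> Lp p"
  shows "hermite_coeff (T f) \<nu> = m \<nu> * hermite_coeff f \<nu>"
proof -
  define L where "L f = hermite_coeff (T f) \<nu> - m \<nu> * hermite_coeff f \<nu>" for f
  obtain C where C: "\<And>f. f \<in> Lp p \<Longrightarrow> Lp_norm p (T f) \<le> C * Lp_norm p f"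
    using T by (auto simp: is_hermite_multiplier_def Lp_bounded_def)
  obtain K0 where K0: "\<And>f. f \<in> Lp p \<Longrightarrow> cmod (hermite_coeff f \<nu>) \<le> K0 * Lp_norm p f"
    using hermite_coeff_bound[OF p, of \<nu>] by blast
  define K where "K = max K0 0"
  have K: "0 \<le> K" "cmod (hermite_coeff f \<nu>) \<le> K * Lp_norm p f" if "f \<in> Lp p" for f
    using order_trans[OF K0[OF that] mult_right_mono[OF _ Lp_norm_nonneg, of K0 K p f]]
    by (auto simp: K_def)
  \<comment> \<open>The maximum and the added 1 make \<open>M\<close> positive, so
    \<open>\<epsilon> / M\<close> can serve as the tolerance of the approximation.\<close>
  define M where "M = max (K * C + cmod (m \<nu>) * K) 0 + 1"
  have M: "0 < M" "cmod (L f) \<le> M * Lp_norm p f" if f: "f \<in> Lp p" for f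
  proof -
    show "0 < M" by (simp add: M_def)
    have "cmod (L f) \<le> cmod (hermite_coeff (T f) \<nu>) + cmod (m \<nu>) * cmod (hermite_coeff f \<nu>)"
      unfolding L_def norm_mult[symmetric] by (rule norm_triangle_ineq4)
    also have "\<dots> \<le> K * (C * Lp_norm p f) + cmod (m \<nu>) * (K * Lp_norm p f)"
      using order_trans[OF K(2)[OF T_Lp[OF f]] mult_left_mono[OF C[OF f] K(1)[OF f]]] K(2)[OF f]
      by (intro add_mono mult_left_mono) auto
    also have "\<dots> = (K * C + cmod (m \<nu>) * K) * Lp_norm p f" by (simp add: algebra_simps)
    also have "\<dots> \<le> M * Lp_norm p f"
      by (intro mult_right_mono Lp_norm_nonneg) (simp add: M_def)
    finally show "cmod (L f) \<le> M * Lp_norm p f" .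
  qed
  have L_span: "L g = 0" if gs: "g \<in> hermite_span" for g
  proof -
    obtain A c where A: "finite A" "g = (\<lambda>x. \<Sum>\<nu>\<in>A. c \<nu> * \<phi> \<nu> x)"
      using gs by (auto simp: hermite_span_def)
    have gL: "g \<in> Lp p" using gs hermite_span_Lp[OF p] by auto
    have "hermite_coeff (T g) \<nu> = hermite_coeff (\<lambda>x. \<Sum>\<kappa>\<in>A. (m \<kappa> * c \<kappa>) * \<phi> \<kappa> x) \<nu>"
      using T_span[OF A(1), of c] Lp_measurable[OF T_Lp[OF gL]]
      by (intro hermite_coeff_cong_AE) (auto simp: A(2) intro!: Lp_measurable[OF Lp_sum[OF p A(1) \<phi>_Lp], simplified])
    also have "\<dots> = (\<Sum>\<kappa>\<in>A. if \<kappa> = \<nu> then m \<nu> * c \<nu> else 0)"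
      unfolding hermite_coeff_sum[OF p A(1) \<phi>_Lp] by (intro sum.cong) (auto simp: hermite_coeff_hermite)
    also have "\<dots> = m \<nu> * (\<Sum>\<kappa>\<in>A. if \<kappa> = \<nu> then c \<nu> else 0)"
      using A(1) by simp
    also have "(\<Sum>\<kappa>\<in>A. if \<kappa> = \<nu> then c \<nu> else 0) = hermite_coeff g \<nu>"
      unfolding A(2) hermite_coeff_sum[OF p A(1) \<phi>_Lp] by (intro sum.cong) (auto simp: hermite_coeff_hermite)
    finally show ?thesis by (simp add: L_def)
  qed
  have "cmod (L f) \<le> \<epsilon>" if \<epsilon>: "0 < \<epsilon>" for \<epsilon>
  proof -
    obtain g where g: "g \<in> hermite_span" "Lp_norm p (\<lambda>x. f x - g x) < \<epsilon> / M"
      using hermite_span_dense_norm[OF p f, of "\<epsilon> / M"] M(1)[OF f] \<epsilon> by auto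
    have gL: "g \<in> Lp p" using g hermite_span_Lp[OF p] by auto
    note fg = Lp_diff[OF p f gL]
    have "hermite_coeff (T (\<lambda>x. f x - g x)) \<nu> = hermite_coeff (\<lambda>x. T f x - T g x) \<nu>"
      using T_diff[OF f gL] Lp_measurable[OF T_Lp[OF fg]] Lp_measurable[OF Lp_diff[OF p T_Lp[OF f] T_Lp[OF gL]]]
      by (rule hermite_coeff_cong_AE)
    then have "L (\<lambda>x. f x - g x) = L f - L g"
      unfolding L_def by (simp add: hermite_coeff_diff[OF p] f gL T_Lp right_diff_distrib)
    then have "cmod (L f) \<le> M * Lp_norm p (\<lambda>x. f x - g x)"
      using M(2)[OF fg] L_span[OF g(1)] by simp
    also have "\<dots> \<le> M * (\<epsilon> / M)" using g M(1)[OF f] by (intro mult_left_mono) auto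
    finally show ?thesis using M(1)[OF f] by simp
  qed
  then have "cmod (L f) \<le> 0" by (rule field_le_epsilon[of _ 0, simplified])
  then show ?thesis by (simp add: L_def)
qed

lemma shifted_power:
  assumes f: "f \<in> Lp p"
  shows "((\<lambda>g x. T g x - \<mu> * g x) ^^ n) f \<in> Lp p \<and>
    hermite_coeff (((\<lambda>g x. T g x - \<mu> * g x) ^^ n) f) \<nu> = (m \<nu> - \<mu>) ^ n * hermite_coeff f \<nu>"
proof (induction n)
  case (Suc n)
  let ?h = "((\<lambda>g x. T g x - \<mu> * g x) ^^ n) f"
  have h: "?h \<in> Lp p" using Suc by simp
  have "hermite_coeff (\<lambda>x. T ?h x - \<mu> * ?h x) \<nu> = (m \<nu> - \<mu>) * hermite_coeff ?h \<nu>"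
    unfolding hermite_coeff_diff[OF p T_Lp[OF h] Lp_scale[OF h]] hermite_coeff_scale hermite_coeff_T[OF h]
    by (simp add: left_diff_distrib)
  then show ?case using Suc Lp_diff[OF p T_Lp[OF h] Lp_scale[OF h]] by simp
qed (simp add: f)

text \<open>The iterate multiplies the coefficient at \<open>\<nu>\<close> by a power of the nonzero
  \<open>m \<nu> - \<mu>\<close> and vanishes almost everywhere. So a generalized eigenvector has
  coefficients only on the level set of \<open>\<mu>\<close>, and Jordan blocks cannot
  occur.\<close>

lemma gen_eigenspace_coeff:
  assumes f: "f \<in> gen_eigenspace p T \<mu>" and ne: "m \<nu> \<noteq> \<mu>"
  shows "hermite_coeff f \<nu> = 0"
proof -
  obtain n where n: "AE x in lborel. ((\<lambda>g x. T g x - \<mu> * g x) ^^ n) f x = 0" and fL: "f \<in> Lp p"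
    using f by (auto simp: gen_eigenspace_def)
  note h = shifted_power[OF fL, where \<mu> = \<mu> and n = n and \<nu> = \<nu>]
  have "hermite_coeff (((\<lambda>g x. T g x - \<mu> * g x) ^^ n) f) \<nu> = hermite_coeff (\<lambda>x. 0) \<nu>"
    using n Lp_measurable[OF conjunct1[OF h]] by (intro hermite_coeff_cong_AE) auto
  then show ?thesis using h ne by (simp add: hermite_coeff_def)
qed

text \<open>The Hermite functions of the level set form a basis. They span because \<open>f\<close>
  and its finite Hermite sum \<open>g\<close> have the same coefficients, and coefficients determine
  a function up to null sets.\<close>

lemma gen_eigenspace_dim:
  assumes fin: "finite {\<nu>. m \<nu> = \<mu>}"
  shows "has_dim_ae (gen_eigenspace p T \<mu>) (card {\<nu>. m \<nu> = \<mu>})"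
proof -
  define A where "A = {\<nu>. m \<nu> = \<mu>}"
  obtain h where h: "bij_betw h {..<card A} A"
    using ex_bij_betw_nat_finite[OF fin] by (auto simp: A_def atLeast0LessThan)
  have hA: "m (h i) = \<mu>" if "i < card A" for i
    using bij_betwE[OF h] that by (auto simp: A_def)
  have h_inj: "h i = h j \<longleftrightarrow> i = j" if "i < card A" "j < card A" for i j
    using bij_betw_imp_inj_on[OF h] that by (auto simp: inj_on_def)
  have sum_h: "(\<Sum>i<card A. u (h i)) = (\<Sum>\<nu>\<in>A. u \<nu>)" for u :: "nat ^ 'n \<Rightarrow> complex"
    by (rule sum.reindex_bij_betw[OF h])
  show ?thesis
    unfolding has_dim_ae_def A_def[symmetric]
  proof (intro exI[of _ "\<lambda>i. \<phi> (h i)"] conjI allI impI ballI)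
    fix i assume i: "i < card A"
    have "AE x in lborel. ((\<lambda>g x. T g x - \<mu> * g x) ^^ 1) (\<phi> (h i)) x = 0"
      using T_\<phi>[of "h i"] hA[OF i] by simp
    then show "\<phi> (h i) \<in> gen_eigenspace p T \<mu>" using \<phi>_Lp unfolding gen_eigenspace_def by blast
  next
    fix c j assume z: "AE x in lborel. (\<Sum>i<card A. c i * \<phi> (h i) x) = 0" and j: "j < card A"
    have L: "(\<lambda>x. \<Sum>i<card A. c i * \<phi> (h i) x) \<in> Lp p" by (intro Lp_sum p \<phi>_Lp) simp
    have "hermite_coeff (\<lambda>x. \<Sum>i<card A. c i * \<phi> (h i) x) (h j) = hermite_coeff (\<lambda>x. 0) (h j)"
      using z Lp_measurable[OF L] by (intro hermite_coeff_cong_AE) auto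
    moreover have "hermite_coeff (\<lambda>x. \<Sum>i<card A. c i * \<phi> (h i) x) (h j) = (\<Sum>i<card A. if i = j then c i else 0)"
      unfolding hermite_coeff_sum[OF p finite_lessThan \<phi>_Lp]
      using j by (intro sum.cong) (auto simp: hermite_coeff_hermite h_inj)
    ultimately show "c j = 0" using j by (simp add: hermite_coeff_def)
  next
    fix f assume f: "f \<in> gen_eigenspace p T \<mu>"
    then have fL: "f \<in> Lp p" by (simp add: gen_eigenspace_def)
    define g where "g = (\<lambda>x. \<Sum>\<nu>\<in>A. hermite_coeff f \<nu> * \<phi> \<nu> x)"
    have gL: "g \<in> Lp p" unfolding g_def using fin by (intro Lp_sum p \<phi>_Lp) (simp add: A_def)
    have "hermite_coeff g \<nu> = hermite_coeff f \<nu>" for \<nu>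
    proof -
      have "hermite_coeff g \<nu> = (\<Sum>\<kappa>\<in>A. if \<kappa> = \<nu> then hermite_coeff f \<nu> else 0)"
        unfolding g_def using fin
        by (subst hermite_coeff_sum[OF p _ \<phi>_Lp]) (auto simp: A_def hermite_coeff_hermite if_distrib[of "\<lambda>z. _ * z"] cong: if_cong)
      also have "\<dots> = hermite_coeff f \<nu>"
        using fin gen_eigenspace_coeff[OF f, of \<nu>] by (auto simp: A_def)
      finally show ?thesis .
    qed
    then have "AE x in lborel. f x - g x = 0"
      by (intro hermite_coeff_injective[OF p Lp_diff[OF p fL gL]]) (simp add: hermite_coeff_diff[OF p fL gL])
    then have "AE x in lborel. f x = (\<Sum>i<card A. hermite_coeff f (h i) * \<phi> (h i) x)"
    proof eventually_elim
      case (elim x)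
      then show ?case using sum_h[of "\<lambda>\<nu>. hermite_coeff f \<nu> * \<phi> \<nu> x"] by (simp add: g_def)
    qed
    then show "\<exists>c. AE x in lborel. f x = (\<Sum>i<card A. c i * \<phi> (h i) x)"
      by (intro exI[of _ "\<lambda>i. hermite_coeff f (h i)"])
  qed
qed

lemma level_set_finite: "\<mu> \<noteq> 0 \<Longrightarrow> finite {\<nu>. m \<nu> = \<mu>}"
  using has_sum_finite_level_set[OF symbol_has_sum] .

text \<open>The multi-indices are countably infinite, so an enumeration turns the symbol itself into
  such a sequence; its zero values may stay.\<close>

lemma eigenvalue_sequence_exists: "\<exists>l. eigenvalue_sequence p T l"
proof -
  have "infinite (UNIV :: (nat ^ 'n) set)"
  proof
    assume "finite (UNIV :: (nat ^ 'n) set)"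
    then have "finite (range (\<lambda>k::nat. (\<chi> i. k) :: nat ^ 'n))" by (rule rev_finite_subset) simp
    then have "finite (UNIV :: nat set)" by (rule finite_imageD) (auto simp: inj_on_def vec_eq_iff)
    then show False by simp
  qed
  then have h: "bij_betw (from_nat_into UNIV) UNIV (UNIV :: (nat ^ 'n) set)"
    by (intro bij_betw_from_nat_into) auto
  define l where "l i = m (from_nat_into UNIV i)" for i
  have "bij_betw (from_nat_into UNIV) {i. l i = \<mu>} {\<nu>. m \<nu> = \<mu>}" for \<mu>
  proof (rule bij_betw_subset[OF h])
    show "from_nat_into UNIV ` {i. l i = \<mu>} = {\<nu>. m \<nu> = \<mu>}"
    proof
      show "{\<nu>. m \<nu> = \<mu>} \<subseteq> from_nat_into UNIV ` {i. l i = \<mu>}"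
      proof
        fix \<nu> assume "\<nu> \<in> {\<nu>. m \<nu> = \<mu>}"
        moreover obtain i where "\<nu> = from_nat_into UNIV i" using surjD[OF bij_betw_imp_surj_on[OF h]] by blast
        ultimately show "\<nu> \<in> from_nat_into UNIV ` {i. l i = \<mu>}" by (auto simp: l_def)
      qed
    qed (auto simp: l_def)
  qed simp
  then have "finite {i. l i = \<mu>} \<longleftrightarrow> finite {\<nu>. m \<nu> = \<mu>}" "card {i. l i = \<mu>} = card {\<nu>. m \<nu> = \<mu>}" for \<mu>
    by (auto intro: bij_betw_same_card dest: bij_betw_finite)
  then have "eigenvalue_sequence p T l"
    unfolding eigenvalue_sequence_def using gen_eigenspace_dim level_set_finite by simp
  then show ?thesis by blast
qed

lemma eigenvalue_sequence_has_sum: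
  assumes l: "eigenvalue_sequence p T l"
  shows "(l has_sum (\<Sum>i. e i (y i))) UNIV"
proof (rule has_sum_same_multiplicities[OF _ symbol_has_sum])
  fix \<mu> :: complex assume \<mu>: "\<mu> \<noteq> 0"
  then have "finite {i. l i = \<mu>}" "has_dim_ae (gen_eigenspace p T \<mu>) (card {i. l i = \<mu>})"
    using l by (auto simp: eigenvalue_sequence_def)
  then show "finite {i. l i = \<mu>} \<and> finite {\<nu>. m \<nu> = \<mu>} \<and> card {i. l i = \<mu>} = card {\<nu>. m \<nu> = \<mu>}"
    using has_dim_ae_unique gen_eigenspace_dim level_set_finite[OF \<mu>] by blast
qed

text \<open>Any other representation satisfies the same locale, so its trace is also the sum of
  \<open>m\<close>. Uniqueness of that sum makes the definite description well defined.\<close>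

lemma nuclear_trace_eq: "nuclear_trace p r T = (\<Sum>i. e i (y i))"
  unfolding nuclear_trace_def
proof (rule the_equality)
  show "\<forall>e' y'. nuclear_representation p r T e' y' \<longrightarrow> (\<lambda>i. e' i (y' i)) sums (\<Sum>i. e i (y i))"
  proof (intro allI impI)
    fix e' y' assume "nuclear_representation p r T e' y'"
    then interpret other: nuclear_hermite_multiplier p r m T e' y'
      using p r_eq T by unfold_locales
    show "(\<lambda>i. e' i (y' i)) sums (\<Sum>i. e i (y i))"
      using other.trace_sums has_sum_unique[OF symbol_has_sum other.symbol_has_sum] by simp
  qed
  show "t = (\<Sum>i. e i (y i))"
    if "\<forall>e y. nuclear_representation p r T e y \<longrightarrow> (\<lambda>i. e i (y i)) sums t" for t
    using that rep trace_sums sums_unique2 by blast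
qed

end

theorem mainTheorem6:
  fixes p r :: real
    and m :: "nat ^ 'n \<Rightarrow> complex"
    and T :: "(real ^ 'n \<Rightarrow> complex) \<Rightarrow> real ^ 'n \<Rightarrow> complex"
  assumes "1 \<le> p"
    and "1 / r = 1 + \<bar>1 / p - 1 / 2\<bar>"
    and "is_hermite_multiplier p m T"
    and "r_nuclear p r T"
  shows "(m has_sum nuclear_trace p r T) UNIV \<and>
    (\<exists>l. eigenvalue_sequence p T l) \<and>
    (\<forall>l. eigenvalue_sequence p T l \<longrightarrow> (l has_sum nuclear_trace p r T) UNIV)"
proof -
  obtain e y where "nuclear_representation p r T e y"
    using assms(4) by (auto simp: r_nuclear_def)
  then interpret nuclear_hermite_multiplier p r m T e y
    using assms by unfold_locales
  show ?thesis
    unfolding nuclear_trace_eq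
    using symbol_has_sum eigenvalue_sequence_exists eigenvalue_sequence_has_sum by blast
qed

end
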